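(* Let $R$ be an even skew-invertible Hecke symmetry of bi-rank $(m|0)$ on $V$, $\dim_{\mathbb C}V=N$, with parameter $q$, let $\mathbf{Y}(R)$ be the corresponding braided Yangian of Reflection Equation type with generating matrix $L(u)$, and let $$e_k(u)=\mathrm{Tr}_{R(12\ldots k)}\,A^{(k)}_{12\ldots k}\,L_{\overline 1}(u)\,L_{\overline 2}(q^{-2}u)\cdots L_{\overline k}(q^{-2(k-1)}u),\qquad k\ge 1,$$ be the quantum elementary symmetric polynomials. Then these commute with each other: $$e_k(u)\,e_p(v)=e_p(v)\,e_k(u)\qquad\text{for all } k,p\ge 1 \text{ and all } u,v$$ (as an identity of formal series in $u^{-1},v^{-1}$ with coefficients in $\mathbf{Y}(R)$).
   Context: Let $V$ be a complex vector space of dimension $N$. A braiding is an operator $R\in\mathrm{End}(V^{\otimes 2})$ with $R_1R_2R_1=R_2R_1R_2$ in $\mathrm{End}(V^{\otimes 3})$, where $R_k=R_{k\,k+1}$ denotes $R$ acting in the positions $k,k+1$ of a tensor power of $V$. $R$ is a Hecke symmetry if moreover $(R-qI)(R+q^{-1}I)=0$ for some $q\in\mathbb C\setminus\{0,\pm1\}$; $q$ is assumed generic: $q^k\neq 1$ for all integers $k\ge1$. Put $k_q=(q^k-q^{-k})/(q-q^{-1})$. Skew-symmetrizers: $A^{(1)}=I$, $A^{(k+1)}_{1\dots k+1}=\frac{k_q}{(k+1)_q}A^{(k)}_{1\dots k}\left(\frac{q^k}{k_q}I-R_k\right)A^{(k)}_{1\dots k}$, $k\ge1$; lower indices indicate the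 tensor positions. $R$ is skew-invertible if there is $\Psi\in\mathrm{End}(V^{\otimes2})$ with $\mathrm{Tr}_{(2)}R_{12}\Psi_{23}=P_{13}=\mathrm{Tr}_{(2)}\Psi_{12}R_{23}$ ($P$ is the flip). Then $C=\mathrm{Tr}_{(2)}\Psi_{12}$ is an $N\times N$ matrix with $\mathrm{Tr}_{(2)}R_{12}C_2=I_1$ and $R_kC_kC_{k+1}=C_kC_{k+1}R_k$. $R$ is even of bi-rank $(m|0)$ if $A^{(m+1)}=0$ and $\mathrm{rank}\,A^{(m)}=1$; then $\mathrm{Tr}\,C=m_q/q^m$. $R$-trace: $\mathrm{Tr}_{R(12\dots k)}X=\mathrm{Tr}_{(12\dots k)}(C_1C_2\cdots C_kX)$ for a matrix $X\in(\mathrm{Mat}_N(\mathcal A))^{\otimes k}$ with entries in an algebra $\mathcal A$. Current $R$-matrix: $R(u,v)=R-\frac{(q-q^{-1})u}{u-v}I$; $R_k(u,v)$ acts in positions $k,k+1$. The braided Yangian (of Reflection Equation type) $\mathbf{Y}(R)$ is the unital associative algebra generated by the entries of the $N\times N$ matrices $L[k]$, $k\ge1$, where $L(u)=I+\sum_{k\ge1}L[k]u^{-k}$, subject to $$R_1(u,v)L_{\overline1}(u)L_{\overline2}(v)=L_{\overline1}(v)L_{\overline2}(u)R_1(u,v),$$ where $L_{\overline1}(u)=L_1(u)$ and $L_{\overline{k+1}}(u)=R_kL_{\overline k}(u)R_k^{-1}$ for $k\ge1$. *)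

theory Defs
  imports
    "HOL-Analysis.Analysis"
    "HOL-Library.Function_Algebras"
    "HOL-Library.Poly_Mapping"
    "HOL-Computational_Algebra.Formal_Power_Series"
    "HOL-Algebra.QuotRing"
begin

section \<open>Operators on tensor powers\<close>

text \<open>
  A basis of \<open>V\<close> is indexed by the finite type \<open>'n\<close>, so that \<open>N = CARD('n)\<close>. The basis of
  \<open>V\<^sup>\<otimes>\<^sup>K\<close> is indexed by the lists of length \<open>K\<close>, and an element of
  \<open>Mat\<^sub>N(A)\<^sup>\<otimes>\<^sup>K\<close> is a function of two such lists (row, column). All operations below produce,
  from such functions,
  functions that vanish off the lists of length \<open>K\<close>, hence equality of functions is equality
  of operators. Tensor positions are numbered \<open>1,\<dots>,K\<close>.
\<close>

type_synonym ('n, 'a) tmat = "'n list \<Rightarrow> 'n list \<Rightarrow> 'a"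

definition tone :: "nat \<Rightarrow> ('n, 'a::zero_neq_one) tmat" where
  "tone K = (\<lambda>i j. if length i = K \<and> i = j then 1 else 0)"

definition tmul :: "nat \<Rightarrow> ('n::finite, 'a::semiring_0) tmat \<Rightarrow> ('n, 'a) tmat \<Rightarrow> ('n, 'a) tmat" where
  "tmul K X Y = (\<lambda>i j. \<Sum>l | length l = K. X i l * Y l j)"

definition tdiff :: "('n, 'a::minus) tmat \<Rightarrow> ('n, 'a) tmat \<Rightarrow> ('n, 'a) tmat" where
  "tdiff X Y = (\<lambda>i j. X i j - Y i j)"

definition tscale :: "'a::times \<Rightarrow> ('n, 'a) tmat \<Rightarrow> ('n, 'a) tmat" where
  "tscale c X = (\<lambda>i j. c * X i j)"

definition tmap :: "('a \<Rightarrow> 'b) \<Rightarrow> ('n, 'a) tmat \<Rightarrow> ('n, 'b) tmat" where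
  "tmap f X = (\<lambda>i j. f (X i j))"

definition ttrace :: "nat \<Rightarrow> ('n::finite, 'a::comm_monoid_add) tmat \<Rightarrow> 'a" where
  "ttrace K X = (\<Sum>i | length i = K. X i i)"

text \<open>The ordered product \<open>f 1 \<cdots> f k\<close>.\<close>

primrec tprod :: "nat \<Rightarrow> (nat \<Rightarrow> ('n::finite, 'a::semiring_1) tmat) \<Rightarrow> nat \<Rightarrow> ('n, 'a) tmat" where
  "tprod K f 0 = tone K"
| "tprod K f (Suc k) = tmul K (tprod K f k) (f (Suc k))"

text \<open>\<open>M\<^sub>k\<close> for an \<open>N \<times> N\<close> matrix \<open>M\<close>, and \<open>S\<^sub>k = S\<^sub>k\<^sub>,\<^sub>k\<^sub>+\<^sub>1\<close> for a matrix \<open>S\<close> on \<open>V \<otimes> V\<close>.\<close>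

definition at1 :: "nat \<Rightarrow> nat \<Rightarrow> 'a::zero ^ 'n ^ 'n::finite \<Rightarrow> ('n, 'a) tmat" where
  "at1 K k M = (\<lambda>i j.
     if length i = K \<and> length j = K \<and> (\<forall>s<K. s \<noteq> k - 1 \<longrightarrow> i ! s = j ! s)
     then M $ (i ! (k - 1)) $ (j ! (k - 1)) else 0)"

definition at2 :: "nat \<Rightarrow> nat \<Rightarrow> 'a::zero ^ ('n::finite \<times> 'n) ^ ('n \<times> 'n) \<Rightarrow> ('n, 'a) tmat" where
  "at2 K k S = (\<lambda>i j.
     if length i = K \<and> length j = K \<and> (\<forall>s<K. s \<noteq> k - 1 \<and> s \<noteq> k \<longrightarrow> i ! s = j ! s)
     then S $ (i ! (k - 1), i ! k) $ (j ! (k - 1), j ! k) else 0)"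

definition trank :: "nat \<Rightarrow> ('n::finite, complex) tmat \<Rightarrow> nat" where
  "trank K X = vector_space.dim (\<lambda>(c::complex) f i. c * f i)
     (range (\<lambda>v i. \<Sum>j | length j = K. X i j * v j))"


section \<open>Even skew-invertible Hecke symmetries\<close>

type_synonym 'n rmat = "complex ^ ('n \<times> 'n) ^ ('n \<times> 'n)"

definition braiding :: "'n::finite rmat \<Rightarrow> bool" where
  "braiding R \<longleftrightarrow>
     tmul 3 (tmul 3 (at2 3 1 R) (at2 3 2 R)) (at2 3 1 R) =
     tmul 3 (tmul 3 (at2 3 2 R) (at2 3 1 R)) (at2 3 2 R)"

definition hecke_symmetry :: "complex \<Rightarrow> 'n::finite rmat \<Rightarrow> bool" where
  "hecke_symmetry q R \<longleftrightarrow> braiding R \<and> q \<notin> {0, 1, -1} \<and>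
     (R - mat q) ** (R + mat (inverse q)) = 0"

definition generic :: "complex \<Rightarrow> bool" where
  "generic q \<longleftrightarrow> (\<forall>k\<ge>1. q ^ k \<noteq> 1)"

definition qnum :: "complex \<Rightarrow> nat \<Rightarrow> complex" where
  "qnum q k = (q ^ k - inverse q ^ k) / (q - inverse q)"

text \<open>\<open>skew_symmetrizer q R K k\<close> is \<open>A\<^sup>(\<^sup>k\<^sup>)\<close> in the positions \<open>1,\<dots>,k\<close> of \<open>V\<^sup>\<otimes>\<^sup>K\<close>, for \<open>1 \<le> k \<le> K\<close>;
  the value at \<open>k = 0\<close> is a dummy.\<close>

primrec skew_symmetrizer :: "complex \<Rightarrow> 'n::finite rmat \<Rightarrow> nat \<Rightarrow> nat \<Rightarrow> ('n, complex) tmat" where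
  "skew_symmetrizer q R K 0 = tone K"
| "skew_symmetrizer q R K (Suc k) =
     (if k = 0 then tone K
      else tscale (qnum q k / qnum q (k + 1))
        (tmul K
          (tmul K (skew_symmetrizer q R K k)
            (tdiff (tscale (q ^ k / qnum q k) (tone K)) (at2 K k R)))
          (skew_symmetrizer q R K k)))"

definition even_birank :: "complex \<Rightarrow> 'n::finite rmat \<Rightarrow> nat \<Rightarrow> bool" where
  "even_birank q R m \<longleftrightarrow> m \<ge> 1 \<and>
     skew_symmetrizer q R (m + 1) (m + 1) = (\<lambda>i j. 0) \<and>
     trank m (skew_symmetrizer q R m m) = 1"

text \<open>The partial trace over the second factor of \<open>V\<^sup>\<otimes>\<^sup>3\<close>, leaving a matrix in the positions 1, 3.\<close>

definition ptrace_13 :: "('n::finite, complex) tmat \<Rightarrow> 'n rmat" where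
  "ptrace_13 X = (\<chi> r s. \<Sum>b\<in>UNIV. X [fst r, b, snd r] [fst s, b, snd s])"

definition flip :: "'n::finite rmat" where
  "flip = (\<chi> r s. if fst r = snd s \<and> snd r = fst s then 1 else 0)"

definition skew_inverse_of :: "'n::finite rmat \<Rightarrow> 'n rmat \<Rightarrow> bool" where
  "skew_inverse_of R \<Psi> \<longleftrightarrow>
     ptrace_13 (tmul 3 (at2 3 1 R) (at2 3 2 \<Psi>)) = flip \<and>
     ptrace_13 (tmul 3 (at2 3 1 \<Psi>) (at2 3 2 R)) = flip"

definition skew_invertible :: "'n::finite rmat \<Rightarrow> bool" where
  "skew_invertible R \<longleftrightarrow> (\<exists>\<Psi>. skew_inverse_of R \<Psi>)"

text \<open>\<open>\<Psi>\<close> is uniquely determined by \<open>R\<close>, so the choice is harmless.\<close>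

definition C_matrix :: "'n::finite rmat \<Rightarrow> complex ^ 'n ^ 'n" where
  "C_matrix R = (let \<Psi> = (SOME \<Psi>. skew_inverse_of R \<Psi>) in
     (\<chi> a a'. \<Sum>b\<in>UNIV. \<Psi> $ (a, b) $ (a', b)))"


section \<open>The free algebra on the entries of the generating matrices\<close>

datatype 'g free_monoid = Word "'g list"

instantiation free_monoid :: (type) monoid_add
begin

definition zero_free_monoid :: "'a free_monoid" where
  "zero_free_monoid = Word []"

fun plus_free_monoid :: "'a free_monoid \<Rightarrow> 'a free_monoid \<Rightarrow> 'a free_monoid" where
  "plus_free_monoid (Word v) (Word w) = Word (v @ w)"

instance
proof
  fix a b c :: "'a free_monoid"
  show "a + b + c = a + (b + c)" by (cases a; cases b; cases c) simp
  show "0 + a = a" by (cases a) (simp add: zero_free_monoid_def)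
  show "a + 0 = a" by (cases a) (simp add: zero_free_monoid_def)
qed

end

text \<open>The free algebra is the monoid algebra of the free monoid: multiplication on
  \<open>_ \<Rightarrow>\<^sub>0 _\<close> is convolution. The letter \<open>(k, i, j)\<close> stands for the entry \<open>L[k+1]\<^sub>i\<^sub>j\<close>, so that
  exactly the \<open>L[k]\<close> with \<open>k \<ge> 1\<close> occur.\<close>

type_synonym 'n freealg = "(nat \<times> 'n \<times> 'n) free_monoid \<Rightarrow>\<^sub>0 complex"

definition scalar :: "complex \<Rightarrow> 'n freealg" where
  "scalar c = Poly_Mapping.single 0 c"

definition gen :: "nat \<Rightarrow> 'n \<Rightarrow> 'n \<Rightarrow> 'n freealg" where
  "gen k i j = Poly_Mapping.single (Word [(k, i, j)]) 1"

definition freealg_ring :: "'n freealg ring" where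
  "freealg_ring = \<lparr>carrier = UNIV, monoid.mult = (*), one = 1, ring.zero = 0, add = (+)\<rparr>"

text \<open>A series in \<open>u\<^sup>-\<^sup>1\<close> is an \<open>fps\<close> whose variable is \<open>u\<^sup>-\<^sup>1\<close>.\<close>

definition L_series :: "('n freealg fps) ^ 'n ^ 'n::finite" where
  "L_series = (\<chi> i j. Abs_fps (\<lambda>k. case k of
      0 \<Rightarrow> if i = j then 1 else 0
    | Suc r \<Rightarrow> gen r i j))"

text \<open>\<open>f(u) \<mapsto> f(c u)\<close> on series in \<open>u\<^sup>-\<^sup>1\<close>.\<close>

definition rescale :: "complex \<Rightarrow> 'n freealg fps \<Rightarrow> 'n freealg fps" where
  "rescale c f = Abs_fps (\<lambda>k. scalar (inverse c ^ k) * fps_nth f k)"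

text \<open>\<open>Lbar \<iota> R K M k\<close> is \<open>M\<close> with lower index \<open>k\<close> overlined, in \<open>V\<^sup>\<otimes>\<^sup>K\<close>, for \<open>1 \<le> k \<le> K\<close>; the map \<open>\<iota>\<close>
  embeds the scalars into the coefficient ring. The value at \<open>k = 0\<close> is a dummy.\<close>

primrec Lbar :: "(complex \<Rightarrow> 'a::ring_1) \<Rightarrow> 'n::finite rmat \<Rightarrow> nat \<Rightarrow> 'a ^ 'n ^ 'n \<Rightarrow> nat
    \<Rightarrow> ('n, 'a) tmat" where
  "Lbar \<iota> R K M 0 = tone K"
| "Lbar \<iota> R K M (Suc k) =
     (if k = 0 then at1 K 1 M
      else tmul K (tmul K (tmap \<iota> (at2 K k R)) (Lbar \<iota> R K M k)) (tmap \<iota> (at2 K k (matrix_inv R))))"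


section \<open>The braided Yangian of Reflection Equation type\<close>

text \<open>Series in \<open>u\<^sup>-\<^sup>1\<close> and \<open>v\<^sup>-\<^sup>1\<close>: the inner variable is \<open>u\<^sup>-\<^sup>1\<close>, the outer one is \<open>v\<^sup>-\<^sup>1\<close>.\<close>

type_synonym 'n freealg2 = "'n freealg fps fps"

definition scalar2 :: "complex \<Rightarrow> 'n freealg2" where
  "scalar2 c = fps_const (fps_const (scalar c))"

definition u_inv :: "'n freealg2" where "u_inv = fps_const fps_X"
definition v_inv :: "'n freealg2" where "v_inv = fps_X"

definition in_u :: "'n freealg fps \<Rightarrow> 'n freealg2" where
  "in_u f = fps_const f"

definition in_v :: "'n freealg fps \<Rightarrow> 'n freealg2" where
  "in_v f = Abs_fps (\<lambda>b. fps_const (fps_nth f b))"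

text \<open>The current \<open>R\<close>-matrix with its denominator cleared. Since
  \<open>u / (u - v) = v\<^sup>-\<^sup>1 / (v\<^sup>-\<^sup>1 - u\<^sup>-\<^sup>1)\<close>, this is
  \<open>(v\<^sup>-\<^sup>1 - u\<^sup>-\<^sup>1) R(u,v) = (v\<^sup>-\<^sup>1 - u\<^sup>-\<^sup>1) R - (q - q\<^sup>-\<^sup>1) v\<^sup>-\<^sup>1 I\<close>. The factor is central and becomes a unit
  when \<open>1 / (u - v)\<close> is expanded, so the defining relations are unaffected.\<close>

definition current_R :: "complex \<Rightarrow> 'n::finite rmat \<Rightarrow> ('n, 'n freealg2) tmat" where
  "current_R q R =
     tdiff (tscale (v_inv - u_inv) (tmap scalar2 (at2 2 1 R)))
           (tscale (scalar2 (q - inverse q) * v_inv) (tone 2))"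

definition RE_relation :: "complex \<Rightarrow> 'n::finite rmat \<Rightarrow> ('n, 'n freealg2) tmat" where
  "RE_relation q R =
    (let L = (\<lambda>k f. Lbar scalar2 R 2 (map_matrix f L_series) k) in
     tdiff (tmul 2 (tmul 2 (current_R q R) (L 1 in_u)) (L 2 in_v))
           (tmul 2 (tmul 2 (L 1 in_v) (L 2 in_u)) (current_R q R)))"

definition RE_relators :: "complex \<Rightarrow> 'n::finite rmat \<Rightarrow> 'n freealg set" where
  "RE_relators q R = {fps_nth (fps_nth (RE_relation q R i j) b) a | i j a b. True}"

definition yangian_ideal :: "complex \<Rightarrow> 'n::finite rmat \<Rightarrow> 'n freealg set" where
  "yangian_ideal q R = Idl\<^bsub>freealg_ring\<^esub> (RE_relators q R)"

definition braided_yangian :: "complex \<Rightarrow> 'n::finite rmat \<Rightarrow> 'n freealg set ring" where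
  "braided_yangian q R = freealg_ring Quot (yangian_ideal q R)"

definition to_yangian :: "complex \<Rightarrow> 'n::finite rmat \<Rightarrow> 'n freealg \<Rightarrow> 'n freealg set" where
  "to_yangian q R x = yangian_ideal q R +>\<^bsub>freealg_ring\<^esub> x"


section \<open>Quantum elementary symmetric polynomials\<close>

definition const_series :: "complex \<Rightarrow> 'n freealg fps" where
  "const_series c = fps_const (scalar c)"

definition R_trace :: "'n::finite rmat \<Rightarrow> nat \<Rightarrow> ('n, 'n freealg fps) tmat \<Rightarrow> 'n freealg fps" where
  "R_trace R k X =
     ttrace k (tmul k (tmap const_series (tprod k (\<lambda>r. at1 k r (C_matrix R)) k)) X)"

definition elem_sym_free :: "complex \<Rightarrow> 'n::finite rmat \<Rightarrow> nat \<Rightarrow> 'n freealg fps" where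
  "elem_sym_free q R k =
     R_trace R k
       (tmul k (tmap const_series (skew_symmetrizer q R k k))
         (tprod k (\<lambda>r. Lbar const_series R k
            (map_matrix (rescale (inverse q ^ (2 * (r - 1)))) L_series) r) k))"

text \<open>\<open>elem_sym q R k a\<close> is the coefficient of \<open>u\<^sup>-\<^sup>a\<close> in \<open>e\<^sub>k(u)\<close>, an element of the braided Yangian:
  the projection from the free algebra is a ring homomorphism, so the defining formula of
  \<open>e\<^sub>k(u)\<close> may be evaluated on representatives.\<close>

definition elem_sym :: "complex \<Rightarrow> 'n::finite rmat \<Rightarrow> nat \<Rightarrow> nat \<Rightarrow> 'n freealg set" where
  "elem_sym q R k a = to_yangian q R (fps_nth (elem_sym_free q R k) a)"

end

theory Submission
  imports Defs
begin

text \<open>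
  Let \<open>E = A\<^sup>(\<^sup>k\<^sup>) A\<^sup>(\<^sup>p\<^sup>)\<close> act in the positions \<open>1..k\<close> and \<open>k+1..k+p\<close>, let \<open>E'\<close> be the same with
  \<open>k\<close> and \<open>p\<close> exchanged, and let \<open>L\<close>, \<open>L'\<close> be the products of the overlined generating matrices
  with spectral parameters \<open>u, q\<^sup>-\<^sup>2u, \<dots>, v, q\<^sup>-\<^sup>2v, \<dots>\<close> and \<open>v, q\<^sup>-\<^sup>2v, \<dots>, u, q\<^sup>-\<^sup>2u, \<dots>\<close>.
  Overlining turns a shift of positions into a conjugation by a braid, under which the \<open>R\<close>-trace
  is invariant; hence \<open>e\<^sub>k(u) e\<^sub>p(v)\<close> is the \<open>R\<close>-trace of \<open>E L\<close>, and \<open>e\<^sub>p(v) e\<^sub>k(u)\<close> that of \<open>E' L'\<close>.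
  Let \<open>F\<close> be the product of current \<open>R\<close>-matrices that carries the block of the \<open>u\<close>'s through that of
  the \<open>v\<close>'s, so that \<open>F L = L' F\<close>, and \<open>F\<^sup>-\<close> the reversed product, so that \<open>F F\<^sup>-\<close> is a central
  non-zero-divisor \<open>z\<close>. At spectral ratio \<open>q\<^sup>2\<close> the current \<open>R\<close>-matrix is a multiple of \<open>R - q\<close>, and
  this gives \<open>E L = E L E\<close>, \<open>E' F = E' F E\<close> and \<open>E F\<^sup>- = E F\<^sup>- E'\<close>. By cyclicity
  \<open>z Tr (E' L') = Tr (E' F L F\<^sup>-) = Tr (E' F E L E F\<^sup>-) = Tr (E F\<^sup>- E' F E L) = z Tr (E L)\<close>.
\<close>

section \<open>Hecke exchange relations with an R-trace\<close>

text \<open>All absorption identities come from one test: \<open>E\<close> annihilates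
  \<open>R_j + q^-1\<close> for every neighbouring pair inside a block, and conversely X E = X
  modulo the relations as soon as X (R_j + q^-1) = 0 for all those pairs. So
  \<open>R_j + q^-1\<close> only has to be moved leftwards through L, F or F^- until it meets
  \<open>E\<close> or \<open>E'\<close>. In F and F^- this is the Yang-Baxter equation, because the
  current R-matrix at the inverse ratio is a multiple of R + q^-1.

  The entries of L do not commute with each other, so the R-trace is cyclic only in factors made of
  braidings and central elements. This is why E has to be produced to the right of L: the factor E
  F^-, free of generating matrices, can then be carried around the trace.

  Inside one block the defining relation is needed at v = q^-2 u, where an expanded 1/(u - v) has no
  value. With the denominator cleared the substitution makes sense. The price is that u^-1 and the
  product z are not units among the series: they have to be cancelled modulo the ideal of relations,
  which is never shown to be prime or explicit, by looking at lowest coefficients.\<close>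

definition central :: "'b::ring_1 \<Rightarrow> bool" where
  "central z \<longleftrightarrow> (\<forall>X. X * z = z * X)"

lemma centralD: "central z \<Longrightarrow> X * z = z * X"
  by (simp add: central_def)

lemma central_left_commute: "central z \<Longrightarrow> X * (z * Y) = z * (X * Y)"
  by (metis central_def mult.assoc)

lemma central_closed [simp]:
  fixes a b :: "'b::ring_1"
  shows "central (1::'b)" "central (0::'b)"
  "central a \<Longrightarrow> central b \<Longrightarrow> central (a * b)"
  "central a \<Longrightarrow> central b \<Longrightarrow> central (a + b)"
  "central a \<Longrightarrow> central b \<Longrightarrow> central (a - b)"
  "central a \<Longrightarrow> central (- a)"
proof -
  show "central (a * b)" if "central a" "central b"
    using that by (metis central_def mult.assoc)
qed (simp_all add: central_def algebra_simps)

text \<open>On expansion the cubic terms agree by the braid relation, the terms in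
  \<open>R1 * R2\<close> and \<open>R2 * R1\<close> cancel, and the squares are reduced by the Hecke
  relation. A central multiple of \<open>R1 - R2\<close> is left over, and the last assumption says
  that its coefficient vanishes.\<close>

lemma exchange_aux:
  fixes R1 R2 p s t u c l :: "'b::ring_1"
  assumes "R1 * R2 * R1 = R2 * R1 * R2"
    and "R1 * R1 = 1 + l * R1" "R2 * R2 = 1 + l * R2"
    and "central p" "central s" "central t" "central u" "central c" "central l"
    and "t * u + s * t * c = p * u * l + p * u * c"
  shows "(p * R1 - t) * (s * R2 - u) * (R1 + c) = (R2 + c) * (s * R1 - u) * (p * R2 - t)"
proof -
  note com =
    centralD[OF assms(4), of s] centralD[OF assms(4), of t] centralD[OF assms(4), of u] centralD[OF assms(4), of c] centralD[OF assms(4), of l] centralD[OF assms(4), of R1] centralD[OF assms(4), of R2]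
    central_left_commute[OF assms(4), of s] central_left_commute[OF assms(4), of t] central_left_commute[OF assms(4), of u] central_left_commute[OF assms(4), of c] central_left_commute[OF assms(4), of l] central_left_commute[OF assms(4), of R1] central_left_commute[OF assms(4), of R2]
    centralD[OF assms(5), of t] centralD[OF assms(5), of u] centralD[OF assms(5), of c] centralD[OF assms(5), of l] centralD[OF assms(5), of R1] centralD[OF assms(5), of R2]
    central_left_commute[OF assms(5), of t] central_left_commute[OF assms(5), of u] central_left_commute[OF assms(5), of c] central_left_commute[OF assms(5), of l] central_left_commute[OF assms(5), of R1] central_left_commute[OF assms(5), of R2]
    centralD[OF assms(6), of u] centralD[OF assms(6), of c] centralD[OF assms(6), of l] centralD[OF assms(6), of R1] centralD[OF assms(6), of R2]
    central_left_commute[OF assms(6), of u] central_left_commute[OF assms(6), of c] central_left_commute[OF assms(6), of l] central_left_commute[OF assms(6), of R1] central_left_commute[OF assms(6), of R2]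
    centralD[OF assms(7), of c] centralD[OF assms(7), of l] centralD[OF assms(7), of R1] centralD[OF assms(7), of R2]
    central_left_commute[OF assms(7), of c] central_left_commute[OF assms(7), of l] central_left_commute[OF assms(7), of R1] central_left_commute[OF assms(7), of R2]
    centralD[OF assms(8), of l] centralD[OF assms(8), of R1] centralD[OF assms(8), of R2]
    central_left_commute[OF assms(8), of l] central_left_commute[OF assms(8), of R1] central_left_commute[OF assms(8), of R2]
    centralD[OF assms(9), of R1] centralD[OF assms(9), of R2]
    central_left_commute[OF assms(9), of R1] central_left_commute[OF assms(9), of R2]
  let ?D = "(p * R1 - t) * (s * R2 - u) * (R1 + c) - (R2 + c) * (s * R1 - u) * (p * R2 - t)"
  have "?D = p * (s * (R1 * R2 * R1 - R2 * R1 * R2)) - p * (u * (R1 * R1)) + p * (u * (R2 * R2))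
      + ((t * u + s * t * c) - p * u * c) * (R1 - R2)"
    by (simp add: algebra_simps com)
  also have "\<dots> = 0"
    unfolding assms(1-3,10) by (simp add: algebra_simps com)
  finally show ?thesis by simp
qed

lemma qnum_nonzero:
  assumes "generic q" "q \<noteq> 0" "n \<ge> 1"
  shows "qnum q n \<noteq> 0"
proof -
  have *: "q ^ k \<noteq> inverse q ^ k" if "k \<ge> 1" for k
  proof
    assume "q ^ k = inverse q ^ k"
    then have "q ^ k * q ^ k = 1"
      using assms(2) by (simp add: power_inverse field_simps)
    then have "q ^ (2 * k) = 1"
      by (simp add: mult_2 power_add)
    then show False using assms(1) that unfolding generic_def by (metis One_nat_def mult_le_mono nat_mult_1 one_le_numeral)
  qed
  from *[of 1] *[OF assms(3)] show ?thesis by (simp add: qnum_def)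
qed

text \<open>Both coefficient identities behind the skew-symmetrizers, \<open>qnum_coeff\<close> and
  the one inside \<open>skew_S_zero\<close>, reduce to this recursion.\<close>

lemma qnum_Suc:
  assumes "q \<noteq> 0" "q - inverse q \<noteq> 0"
  shows "qnum q (Suc n) = q ^ n + inverse q * qnum q n"
proof -
  have "(q - inverse q) * qnum q (Suc n) = (q - inverse q) * (q ^ n + inverse q * qnum q n)"
    using assms by (simp add: qnum_def field_simps)
  then show ?thesis using assms(2) by simp
qed

text \<open>
  Positions are numbered from \<open>0\<close> here, so that \<open>R i\<close> is the braiding \<open>R\<^sub>i\<^sub>+\<^sub>1\<close> of the paper.
  The set \<open>loc k\<close> models the operators on the first \<open>k\<close> positions, \<open>tr k\<close> the \<open>R\<close>-trace over
  position \<open>k\<close>, and \<open>J\<close> the ideal generated by the defining relations. An element \<open>l\<close> of type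
  \<open>'l\<close> is a spectral parameter, with inverse \<open>x l\<close> and generating matrix \<open>L l\<close>.
\<close>

locale trace_tower =
  fixes q :: complex
    and sc :: "complex \<Rightarrow> 'b::ring_1"
    and R :: "nat \<Rightarrow> 'b"
    and loc :: "nat \<Rightarrow> 'b set"
    and tr :: "nat \<Rightarrow> 'b \<Rightarrow> 'b"
    and J :: "'b set"
    and x :: "'l \<Rightarrow> 'b"
    and L :: "'l \<Rightarrow> 'b"
  assumes q0: "q \<noteq> 0" and generic: "generic q"
    and sc_add: "sc (a + b) = sc a + sc b"
    and sc_mult: "sc (a * b) = sc a * sc b"
    and sc_1: "sc 1 = 1"
    and sc_central: "central (sc a)"
    and braid: "R i * R (Suc i) * R i = R (Suc i) * R i * R (Suc i)"
    and hecke: "R i * R i = 1 + sc (q - inverse q) * R i"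
    and loc_mono: "i \<le> j \<Longrightarrow> loc i \<subseteq> loc j"
    and loc_minus: "X \<in> loc i \<Longrightarrow> Y \<in> loc i \<Longrightarrow> X - Y \<in> loc i"
    and loc_mult: "X \<in> loc i \<Longrightarrow> Y \<in> loc i \<Longrightarrow> X * Y \<in> loc i"
    and loc_sc: "sc a \<in> loc 0"
    and loc_x: "x l \<in> loc 0"
    and loc_R: "R i \<in> loc (i + 2)"
    and loc_L: "L l \<in> loc 1"
    and x_central: "central (x l)"
    and R_commute_loc: "X \<in> loc i \<Longrightarrow> R i * X = X * R i"
    and tr_diff: "tr k (X - Y) = tr k X - tr k Y"
    and tr_loc: "X \<in> loc (Suc k) \<Longrightarrow> tr k X \<in> loc k"
    and tr_left: "X \<in> loc k \<Longrightarrow> tr k (X * Y) = X * tr k Y"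
    and tr_right: "X \<in> loc k \<Longrightarrow> tr k (Y * X) = tr k Y * X"
    and tr_R: "X \<in> loc (Suc k) \<Longrightarrow> tr (Suc k) (R k * X * (R k - sc (q - inverse q))) = tr k X"
    and tr_cyclic: "tr k (tr (Suc k) (R k * X)) = tr k (tr (Suc k) (X * R k))"
    and J_0: "0 \<in> J"
    and J_add: "X \<in> J \<Longrightarrow> Y \<in> J \<Longrightarrow> X + Y \<in> J"
    and J_left: "X \<in> J \<Longrightarrow> Y * X \<in> J"
    and J_right: "X \<in> J \<Longrightarrow> X * Y \<in> J"
    and J_tr: "X \<in> J \<Longrightarrow> tr k X \<in> J"
begin

section \<open>Congruence and cancellation modulo the ideal of relations\<close>

lemma J_minus: "X \<in> J \<Longrightarrow> Y \<in> J \<Longrightarrow> X - Y \<in> J"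
  using J_add[of X "- 1 * Y"] J_left[of Y "- 1"] by simp

definition cong :: "'b \<Rightarrow> 'b \<Rightarrow> bool" (infix "\<sim>\<^sub>J" 50) where
  "X \<sim>\<^sub>J Y \<longleftrightarrow> X - Y \<in> J"

lemma cong_refl [simp]: "X \<sim>\<^sub>J X"
  by (simp add: cong_def J_0)

lemma cong_sym: "X \<sim>\<^sub>J Y \<Longrightarrow> Y \<sim>\<^sub>J X"
  unfolding cong_def using J_minus[OF J_0, of "X - Y"] by simp

lemma cong_trans [trans]: "X \<sim>\<^sub>J Y \<Longrightarrow> Y \<sim>\<^sub>J Z \<Longrightarrow> X \<sim>\<^sub>J Z"
  unfolding cong_def using J_add[of "X - Y" "Y - Z"] by simp

lemma cong_left: "X \<sim>\<^sub>J Y \<Longrightarrow> Z * X \<sim>\<^sub>J Z * Y"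
  unfolding cong_def using J_left[of "X - Y" Z] by (simp add: algebra_simps)

lemma cong_right: "X \<sim>\<^sub>J Y \<Longrightarrow> X * Z \<sim>\<^sub>J Y * Z"
  unfolding cong_def using J_right[of "X - Y" Z] by (simp add: algebra_simps)

lemma cong_tr: "X \<sim>\<^sub>J Y \<Longrightarrow> tr k X \<sim>\<^sub>J tr k Y"
  unfolding cong_def by (simp add: J_tr flip: tr_diff)

text \<open>Left non-zero-divisors modulo \<open>J\<close>. The factors to be cancelled are not
  invertible series, so this takes the place of dividing by them; all of them are central, so one
  side suffices.\<close>

definition regular :: "'b \<Rightarrow> bool" where
  "regular z \<longleftrightarrow> (\<forall>X. z * X \<in> J \<longrightarrow> X \<in> J)"

lemma regular_mult: "regular a \<Longrightarrow> regular b \<Longrightarrow> regular (a * b)"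
  unfolding regular_def by (metis mult.assoc)

lemma regular_sc: "a \<noteq> 0 \<Longrightarrow> regular (sc a)"
  unfolding regular_def by (metis J_left left_inverse mult.assoc mult_1 sc_1 sc_mult)

lemma regular_cong: "regular z \<Longrightarrow> z * X \<sim>\<^sub>J z * Y \<Longrightarrow> X \<sim>\<^sub>J Y"
  unfolding regular_def cong_def by (metis right_diff_distrib)

lemma sc_0: "sc 0 = 0" using sc_add[of 0 0] by simp
lemma sc_minus: "sc (a - b) = sc a - sc b" using sc_add[of "a - b" b] by simp

lemma loc_monoD: "X \<in> loc i \<Longrightarrow> i \<le> j \<Longrightarrow> X \<in> loc j"
  using loc_mono by blast

lemma loc_one: "1 \<in> loc i"
  using loc_sc[of 1] loc_monoD sc_1 by force

lemma R_loc: "i + 2 \<le> k \<Longrightarrow> R i \<in> loc k"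
  using loc_R loc_monoD by blast

lemma sc_loc: "sc a \<in> loc k" using loc_sc loc_monoD by blast
lemma x_loc: "x l \<in> loc k" using loc_x loc_monoD by blast

lemma qq_nonzero: "q - inverse q \<noteq> 0"
proof
  assume "q - inverse q = 0"
  then have "q ^ 2 = 1" using q0 by (simp add: power2_eq_square field_simps)
  then show False using generic unfolding generic_def by (metis one_le_numeral)
qed

definition Ri :: "nat \<Rightarrow> 'b" where "Ri i = R i - sc (q - inverse q)"

text \<open>Up to a scalar, the q-symmetrizer of two neighbouring positions. By the Hecke relation
  \<open>R i - sc q\<close> kills it, and annihilating it is how skew-symmetry is expressed
  throughout.\<close>

definition S :: "nat \<Rightarrow> 'b" where "S i = R i + sc (inverse q)"

lemma R_Ri [simp]: "R i * Ri i = 1" "Ri i * R i = 1"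
  using hecke[of i] centralD[OF sc_central, of "R i" "q - inverse q"]
  by (simp_all add: Ri_def algebra_simps)

lemma R_Ri_assoc [simp]: "R i * (Ri i * X) = X" "Ri i * (R i * X) = X"
  by (simp_all flip: mult.assoc)

lemma Ri_loc: "i + 2 \<le> k \<Longrightarrow> Ri i \<in> loc k"
  unfolding Ri_def by (intro loc_minus R_loc sc_loc)

lemma Ri_commute: "R i * X = X * R i \<Longrightarrow> Ri i * X = X * Ri i"
  using centralD[OF sc_central, of X "q - inverse q"] by (simp add: Ri_def algebra_simps)

lemma S_commute: "R i * X = X * R i \<Longrightarrow> S i * X = X * S i"
  using centralD[OF sc_central, of X "inverse q"] by (simp add: S_def algebra_simps)

lemma R_far: "i + 2 \<le> j \<or> j + 2 \<le> i \<Longrightarrow> R i * R j = R j * R i"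
  using R_commute_loc R_loc by metis

lemma R_S_zero: "(R i - sc q) * S i = 0"
proof -
  have "sc q * sc (inverse q) = 1" using q0 by (simp add: sc_1 flip: sc_mult)
  then show ?thesis
    using hecke[of i] centralD[OF sc_central, of "R i" "inverse q"]
    by (simp add: S_def algebra_simps sc_minus)
qed


lemma commute_mult: "X * Y = Y * X \<Longrightarrow> X * Z = Z * X \<Longrightarrow> X * (Y * Z) = Y * Z * X"
  for X Y Z :: 'b
  by (metis mult.assoc)

section \<open>Overlined generating matrices and current braidings\<close>

primrec Lb :: "nat \<Rightarrow> 'l \<Rightarrow> 'b" where
  "Lb 0 l = L l"
| "Lb (Suc i) l = R i * Lb i l * Ri i"

primrec Lprod :: "nat \<Rightarrow> 'l list \<Rightarrow> 'b" where
  "Lprod i [] = 1"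
| "Lprod i (l # ls) = Lb i l * Lprod (Suc i) ls"

text \<open>The current R-matrix multiplied by its denominator \<open>x m - x l\<close>;
  \<open>l\<close> plays the part of u and \<open>m\<close> that of v.\<close>

definition Rx :: "nat \<Rightarrow> 'l \<Rightarrow> 'l \<Rightarrow> 'b" where
  "Rx i l m = (x m - x l) * R i - sc (q - inverse q) * x m"

text \<open>
  \<open>pass l ms i\<close> carries the parameter \<open>l\<close> from position \<open>i\<close> to the right through the
  parameters \<open>ms\<close>, and \<open>block_pass ls ms i\<close> does so for a block; the factors of \<open>pass_rev\<close> and
  \<open>block_pass_rev\<close> undo this one by one, up to a central factor.
\<close>

primrec pass :: "'l \<Rightarrow> 'l list \<Rightarrow> nat \<Rightarrow> 'b" where
  "pass l [] i = 1"
| "pass l (m # ms) i = pass l ms (Suc i) * Rx i l m"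

primrec block_pass :: "'l list \<Rightarrow> 'l list \<Rightarrow> nat \<Rightarrow> 'b" where
  "block_pass [] ms i = 1"
| "block_pass (l # ls) ms i = pass l ms i * block_pass ls ms (Suc i)"

primrec pass_rev :: "'l \<Rightarrow> 'l list \<Rightarrow> nat \<Rightarrow> 'b" where
  "pass_rev l [] i = 1"
| "pass_rev l (m # ms) i = Rx i m l * pass_rev l ms (Suc i)"

primrec block_pass_rev :: "'l list \<Rightarrow> 'l list \<Rightarrow> nat \<Rightarrow> 'b" where
  "block_pass_rev [] ms i = 1"
| "block_pass_rev (l # ls) ms i = block_pass_rev ls ms (Suc i) * pass_rev l ms i"

definition RE :: "'l \<Rightarrow> 'l \<Rightarrow> bool" where
  "RE l m \<longleftrightarrow> Rx 0 l m * Lb 0 l * Lb (Suc 0) m \<sim>\<^sub>J Lb 0 m * Lb (Suc 0) l * Rx 0 l m"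

text \<open>Since \<open>x\<close> is the inverse of the spectral parameter, passing from u to q^-2
  u multiplies it by q^2.\<close>

definition qstep :: "'l \<Rightarrow> 'l \<Rightarrow> bool" where
  "qstep l m \<longleftrightarrow> x m = sc (q ^ 2) * x l"

lemma Rx_commute: "R i * X = X * R i \<Longrightarrow> Rx i l m * X = X * Rx i l m"
proof -
  assume h: "R i * X = X * R i"
  have c: "central (x m - x l)" "central (sc (q - inverse q) * x m)"
    by (simp_all add: x_central sc_central)
  show ?thesis
    unfolding Rx_def left_diff_distrib right_diff_distrib
    using centralD[OF c(2), of X] central_left_commute[OF c(1), of X "R i"] h
    by (simp add: algebra_simps)
qed

lemma Lb_loc: "i < k \<Longrightarrow> Lb i l \<in> loc k"
proof (induction i arbitrary: k)
  case 0
  then show ?case using loc_L loc_monoD by (metis Lb.simps(1) One_nat_def Suc_leI)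
next
  case (Suc i)
  then show ?case by (auto intro!: loc_mult R_loc Ri_loc)
qed

lemma R_Lb_less: "j < i \<Longrightarrow> R i * Lb j l = Lb j l * R i"
  by (simp add: Lb_loc R_commute_loc)

text \<open>\<open>Lb i\<close> acts in all positions up to \<open>i\<close>, so this is not a
  matter of disjoint supports. For \<open>i = j + 2\<close> the braid relation moves
  \<open>R j\<close> through the conjugating braidings, turning it into \<open>R (Suc j)\<close>,
  which does commute with \<open>Lb j\<close>; further conjugations only involve braidings far from
  \<open>R j\<close>.\<close>

lemma R_Lb_greater: "j + 2 \<le> i \<Longrightarrow> R j * Lb i l = Lb i l * R j"
proof (induction i rule: dec_induct)
  case base
  have 1: "R (Suc j) * Ri j * Ri (Suc j) = Ri j * Ri (Suc j) * R j"
  proof -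
    have "Ri j * Ri (Suc j) * R j = Ri j * (Ri (Suc j) * (R j * (R (Suc j) * (R j * (Ri j * Ri (Suc j))))))"
      by (simp add: mult.assoc)
    also have "\<dots> = Ri j * (Ri (Suc j) * ((R j * R (Suc j) * R j) * (Ri j * Ri (Suc j))))"
      by (simp only: mult.assoc)
    also have "\<dots> = R (Suc j) * Ri j * Ri (Suc j)"
      unfolding braid by (simp add: mult.assoc)
    finally show ?thesis by simp
  qed
  have "R j * Lb (Suc (Suc j)) l = (R j * R (Suc j) * R j) * Lb j l * Ri j * Ri (Suc j)"
    by (simp add: mult.assoc)
  also have "\<dots> = R (Suc j) * R j * (R (Suc j) * Lb j l) * Ri j * Ri (Suc j)"
    unfolding braid by (simp add: mult.assoc)
  also have "\<dots> = R (Suc j) * R j * Lb j l * (R (Suc j) * Ri j * Ri (Suc j))"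
    by (simp add: R_Lb_less mult.assoc)
  also have "\<dots> = Lb (Suc (Suc j)) l * R j"
    unfolding 1 by (simp add: mult.assoc)
  finally show ?case by simp
next
  case (step n)
  have "R j * R n = R n * R j" "R j * Ri n = Ri n * R j"
    using R_far[of n j] Ri_commute[of n "R j"] step by auto
  then show ?case using step.IH by (auto intro!: commute_mult)
qed

lemma Lprod_loc: "i + length ls \<le> k \<Longrightarrow> Lprod i ls \<in> loc k"
  by (induction ls arbitrary: i) (auto intro!: loc_mult Lb_loc loc_one)

lemma Lprod_append: "Lprod i (ls @ ms) = Lprod i ls * Lprod (i + length ls) ms"
  by (induction ls arbitrary: i) (simp_all add: mult.assoc)

lemma R_Lprod_greater: "j + 2 \<le> i \<Longrightarrow> R j * Lprod i ls = Lprod i ls * R j"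
proof (induction ls arbitrary: i)
  case (Cons a ls)
  then show ?case by (auto intro!: commute_mult R_Lb_greater)
qed simp

section \<open>Carrying blocks of parameters through each other\<close>

lemma pass_R_far: "j + 2 \<le> i \<or> i + length ms < j \<Longrightarrow> R j * pass l ms i = pass l ms i * R j"
proof (induction ms arbitrary: i)
  case (Cons a ms)
  have "Rx i l a * R j = R j * Rx i l a"
    using Cons.prems by (intro Rx_commute R_far) auto
  with Cons.IH[of "Suc i"] Cons.prems show ?case by (auto intro!: commute_mult)
qed simp

lemma block_pass_R_greater: "j + 2 \<le> i \<Longrightarrow> R j * block_pass ls ms i = block_pass ls ms i * R j"
proof (induction ls arbitrary: i)
  case (Cons a ls)
  with pass_R_far[of j i ms a] Cons.IH[of "Suc i"] Cons.prems
  show ?case by (auto intro!: commute_mult)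
qed simp

lemma pass_rev_R_far: "j + 2 \<le> i \<or> i + length ms < j \<Longrightarrow> R j * pass_rev l ms i = pass_rev l ms i * R j"
proof (induction ms arbitrary: i)
  case (Cons a ms)
  have "Rx i a l * R j = R j * Rx i a l"
    using Cons.prems by (intro Rx_commute R_far) auto
  with Cons.IH[of "Suc i"] Cons.prems show ?case by (auto intro!: commute_mult)
qed simp

lemma block_pass_rev_R_greater: "j + 2 \<le> i \<Longrightarrow> R j * block_pass_rev ls ms i = block_pass_rev ls ms i * R j"
proof (induction ls arbitrary: i)
  case (Cons a ls)
  with pass_rev_R_far[of j i ms a] Cons.IH[of "Suc i"] Cons.prems
  show ?case by (auto intro!: commute_mult)
qed simp

text \<open>For \<open>qstep l l'\<close> one has
  \<open>Rx i l' l = - sc (q^2 - 1) * x l * S i\<close>. The identity is therefore the Yang-Baxter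
  equation for \<open>l'\<close>, \<open>l\<close>, \<open>m\<close> with this central factor
  removed, and the two parameters change places across \<open>S\<close>.\<close>

lemma Rx_exchange_left:
  assumes "qstep l l'"
  shows "Rx i l m * Rx (Suc i) l' m * S i = S (Suc i) * Rx i l' m * Rx (Suc i) l m"
proof -
  define Q where "Q = sc q"
  define c where "c = sc (inverse q)"
  have c1: "c * Q = 1" "Q * c = 1" using q0 by (simp_all add: Q_def c_def sc_1 flip: sc_mult)
  then have c2: "c * (Q * Y) = Y" "Q * (c * Y) = Y" for Y by (simp_all flip: mult.assoc)
  have l: "sc (q - inverse q) = Q - c" by (simp add: Q_def c_def sc_minus)
  have x': "x l' = Q * Q * x l"
    using assms by (simp add: qstep_def Q_def power2_eq_square sc_mult)
  have cen: "central Q" "central c" "central (x l)" "central (x m)"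
    by (simp_all add: Q_def c_def sc_central x_central)
  show ?thesis
    unfolding Rx_def S_def c_def[symmetric]
  proof (rule exchange_aux[OF braid hecke hecke])
    let ?X = "x l" and ?Y = "x m"
    let ?t = "sc (q - inverse q) * x m"
    \<comment> \<open>Both subtracted terms in the condition of \<open>exchange_aux\<close> equal
      \<open>?t\<close>, so it is \<open>?t\<close> times this linear identity, whose two sides are
      q times \<open>x m - x l\<close>.\<close>
    have "?t + (x m - x l') * c = (x m - x l) * (sc (q - inverse q)) + (x m - x l) * c"
      unfolding l x' using centralD[OF cen(1), of ?X] centralD[OF cen(1), of ?Y] centralD[OF cen(2), of ?X] centralD[OF cen(2), of ?Y]
        c1 c2
        central_left_commute[OF cen(1), of ?X]
      by (simp add: algebra_simps)
    then have "?t * (?t + (x m - x l') * c) = ?t * ((x m - x l) * (sc (q - inverse q)) + (x m - x l) * c)" by simp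
    moreover have ct: "central ?t" by (simp add: sc_central x_central)
    ultimately show "?t * ?t + (x m - x l') * ?t * c = (x m - x l) * ?t * sc (q - inverse q) + (x m - x l) * ?t * c"
      using centralD[OF ct] central_left_commute[OF ct]
      by (metis (no_types, lifting) distrib_left mult.assoc)
  qed (simp_all add: sc_central x_central cen)
qed


text \<open>Yang-Baxter for \<open>l\<close>, \<open>m'\<close>, \<open>m\<close>, where
  \<open>S i\<close> is a multiple of \<open>Rx i m' m\<close>; \<open>exchange_aux\<close> is
  applied with the two braidings interchanged.\<close>

lemma Rx_exchange_right:
  assumes "qstep m m'"
  shows "Rx (Suc i) l m' * Rx i l m * S (Suc i) = S i * Rx (Suc i) l m * Rx i l m'"
proof -
  define Q where "Q = sc q"
  define c where "c = sc (inverse q)"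
  have c1: "c * Q = 1" "Q * c = 1" using q0 by (simp_all add: Q_def c_def sc_1 flip: sc_mult)
  then have c2: "c * (Q * Y) = Y" "Q * (c * Y) = Y" for Y by (simp_all flip: mult.assoc)
  have l: "sc (q - inverse q) = Q - c" by (simp add: Q_def c_def sc_minus)
  have x': "x m' = Q * Q * x m"
    using assms by (simp add: qstep_def Q_def power2_eq_square sc_mult)
  have cen: "central Q" "central c" "central (x l)" "central (x m)"
    by (simp_all add: Q_def c_def sc_central x_central)
  show ?thesis
    unfolding Rx_def S_def c_def[symmetric]
  proof (rule exchange_aux[OF _ hecke hecke])
    let ?X = "x l" and ?Y = "x m"
    show "R (Suc i) * R i * R (Suc i) = R i * R (Suc i) * R i" by (simp add: braid)
    show "sc (q - inverse q) * x m' * (sc (q - inverse q) * x m) + (x m - x l) * (sc (q - inverse q) * x m') * c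
      = (x m' - x l) * (sc (q - inverse q) * x m) * sc (q - inverse q) + (x m' - x l) * (sc (q - inverse q) * x m) * c"
      unfolding l x' using centralD[OF cen(1), of ?X] centralD[OF cen(1), of ?Y] centralD[OF cen(2), of ?X] centralD[OF cen(2), of ?Y]
        central_left_commute[OF cen(1), of ?X] central_left_commute[OF cen(2), of ?X] 
        central_left_commute[OF cen(1), of ?Y] central_left_commute[OF cen(2), of ?Y] 
        centralD[OF cen(3), of ?Y] central_left_commute[OF cen(3), of ?Y]
        c1 c2
      by (simp add: algebra_simps)
  qed (simp_all add: sc_central x_central cen)
qed

text \<open>Only the two factors that meet \<open>m\<close> and \<open>m'\<close> fail to commute
  with \<open>S\<close>, and for them \<open>Rx_exchange_right\<close> applies. What matters is that
  some \<open>S\<close> emerges on the left; the remaining product, with \<open>m\<close> and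
  \<open>m'\<close> interchanged, is of no further interest. The same holds for all the following
  variants.\<close>

lemma pass_S_right:
  assumes "qstep m m'"
  shows "pass l (ms @ m # m' # ms') i * S (Suc (i + length ms)) = S (i + length ms) * pass l (ms @ m' # m # ms') i"
proof (induction ms arbitrary: i)
  case Nil
  have "pass l (m # m' # ms') i * S (Suc i) = pass l ms' (Suc (Suc i)) * (Rx (Suc i) l m' * Rx i l m * S (Suc i))"
    by (simp add: mult.assoc)
  also have "\<dots> = (pass l ms' (Suc (Suc i)) * S i) * (Rx (Suc i) l m * Rx i l m')"
    unfolding Rx_exchange_right[OF assms] by (simp add: mult.assoc)
  also have "\<dots> = S i * pass l (m' # m # ms') i"
    by (simp add: S_commute[OF pass_R_far] flip: mult.assoc) 
  finally show ?case by simp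
next
  case (Cons a ms)
  have "Rx i l a * S (Suc (Suc (i + length ms))) = S (Suc (Suc (i + length ms))) * Rx i l a"
    by (intro S_commute[symmetric] Rx_commute[symmetric] R_far) auto
  then show ?case
    using Cons.IH[of "Suc i"] by (simp add: mult.assoc) (simp flip: mult.assoc)
qed

lemma pass_rev_S_right:
  assumes "qstep m m'"
  shows "pass_rev l (ms @ m # m' # ms') i * S (i + length ms) = S (Suc (i + length ms)) * pass_rev l (ms @ m' # m # ms') i"
proof (induction ms arbitrary: i)
  case Nil
  have "pass_rev l (m # m' # ms') i * S i = Rx i m l * Rx (Suc i) m' l * (pass_rev l ms' (Suc (Suc i)) * S i)"
    by (simp add: mult.assoc)
  also have "\<dots> = (Rx i m l * Rx (Suc i) m' l * S i) * pass_rev l ms' (Suc (Suc i))"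
    by (simp add: S_commute[OF pass_rev_R_far] mult.assoc)
  also have "\<dots> = S (Suc i) * pass_rev l (m' # m # ms') i"
    unfolding Rx_exchange_left[OF assms] by (simp add: mult.assoc)
  finally show ?case by simp
next
  case (Cons a ms)
  have "Rx i a l * S (Suc (Suc (i + length ms))) = S (Suc (Suc (i + length ms))) * Rx i a l"
    by (intro S_commute[symmetric] Rx_commute[symmetric] R_far) auto
  then show ?case
    using Cons.IH[of "Suc i"] by (simp add: mult.assoc) (simp flip: mult.assoc)
qed

text \<open>Every parameter of \<open>ms\<close> crosses \<open>l\<close> and \<open>l'\<close> in
  neighbouring places, and each such double crossing moves \<open>S\<close> by one place. To make
  the double crossings adjacent, \<open>Rx i\<close> is commuted past the part of the other pass
  that starts at \<open>i + 2\<close>.\<close>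

lemma pass_pass_S:
  assumes "qstep l l'"
  shows "pass l ms i * pass l' ms (Suc i) * S i = S (i + length ms) * pass l' ms i * pass l ms (Suc i)"
proof (induction ms arbitrary: i)
  case (Cons m ms)
  have 1: "Rx i a b * pass c ms (Suc (Suc i)) = pass c ms (Suc (Suc i)) * Rx i a b" for a b c
    by (intro Rx_commute pass_R_far) simp
  have "pass l (m # ms) i * pass l' (m # ms) (Suc i) * S i
      = pass l ms (Suc i) * (Rx i l m * pass l' ms (Suc (Suc i))) * Rx (Suc i) l' m * S i"
    by (simp add: mult.assoc)
  also have "\<dots> = pass l ms (Suc i) * pass l' ms (Suc (Suc i)) * (Rx i l m * Rx (Suc i) l' m * S i)"
    unfolding 1 by (simp add: mult.assoc)
  also have "\<dots> = pass l ms (Suc i) * pass l' ms (Suc (Suc i)) * S (Suc i) * (Rx i l' m * Rx (Suc i) l m)"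
    unfolding Rx_exchange_left[OF assms] by (simp add: mult.assoc)
  also have "\<dots> = S (i + length (m # ms)) * pass l' ms (Suc i) * (pass l ms (Suc (Suc i)) * Rx i l' m) * Rx (Suc i) l m"
    unfolding Cons.IH by (simp add: mult.assoc)
  also have "\<dots> = S (i + length (m # ms)) * pass l' (m # ms) i * pass l (m # ms) (Suc i)"
    unfolding 1[symmetric] by (simp add: mult.assoc)
  finally show ?case .
qed simp

lemma pass_rev_pass_rev_S:
  assumes "qstep l l'"
  shows "pass_rev l' ms (Suc i) * pass_rev l ms i * S (i + length ms) = S i * pass_rev l ms (Suc i) * pass_rev l' ms i"
proof (induction ms arbitrary: i)
  case (Cons m ms)
  have 1: "Rx i a b * pass_rev c ms (Suc (Suc i)) = pass_rev c ms (Suc (Suc i)) * Rx i a b" for a b c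
    by (intro Rx_commute pass_rev_R_far) simp
  have "pass_rev l' (m # ms) (Suc i) * pass_rev l (m # ms) i * S (i + length (m # ms))
      = Rx (Suc i) m l' * (pass_rev l' ms (Suc (Suc i)) * Rx i m l) * pass_rev l ms (Suc i) * S (Suc i + length ms)"
    by (simp add: mult.assoc)
  also have "\<dots> = Rx (Suc i) m l' * Rx i m l * (pass_rev l' ms (Suc (Suc i)) * pass_rev l ms (Suc i) * S (Suc i + length ms))"
    unfolding 1[symmetric] by (simp add: mult.assoc)
  also have "\<dots> = (Rx (Suc i) m l' * Rx i m l * S (Suc i)) * pass_rev l ms (Suc (Suc i)) * pass_rev l' ms (Suc i)"
    unfolding Cons.IH by (simp add: mult.assoc)
  also have "\<dots> = S i * Rx (Suc i) m l * (Rx i m l' * pass_rev l ms (Suc (Suc i))) * pass_rev l' ms (Suc i)"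
    unfolding Rx_exchange_right[OF assms] by (simp add: mult.assoc)
  also have "\<dots> = S i * pass_rev l (m # ms) (Suc i) * pass_rev l' (m # ms) i"
    unfolding 1 by (simp add: mult.assoc)
  finally show ?case .
qed simp

text \<open>On the right of the exchange the \<open>ms\<close> sit behind the \<open>ls\<close>, on
  the left in front of them; hence the two positions of \<open>S\<close>.\<close>

lemma block_pass_S_right:
  assumes "qstep m m'"
  shows "block_pass ls (ms @ m # m' # ms') i * S (i + length ls + length ms) = S (i + length ms) * block_pass ls (ms @ m' # m # ms') i"
proof (induction ls arbitrary: i)
  case Nil
  then show ?case by simp
next
  case (Cons l ls)
  have "block_pass (l # ls) (ms @ m # m' # ms') i * S (i + length (l # ls) + length ms)
     = pass l (ms @ m # m' # ms') i * (block_pass ls (ms @ m # m' # ms') (Suc i) * S (Suc i + length ls + length ms))"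
    by (simp add: mult.assoc)
  also have "\<dots> = (pass l (ms @ m # m' # ms') i * S (Suc (i + length ms))) * block_pass ls (ms @ m' # m # ms') (Suc i)"
    unfolding Cons.IH by (simp add: mult.assoc)
  also have "\<dots> = S (i + length ms) * block_pass (l # ls) (ms @ m' # m # ms') i"
    unfolding pass_S_right[OF assms] by (simp add: mult.assoc)
  finally show ?case .
qed

lemma block_pass_rev_S_right:
  assumes "qstep m m'"
  shows "block_pass_rev ls (ms @ m # m' # ms') i * S (i + length ms) = S (i + length ls + length ms) * block_pass_rev ls (ms @ m' # m # ms') i"
proof (induction ls arbitrary: i)
  case Nil
  then show ?case by simp
next
  case (Cons l ls)
  have "block_pass_rev (l # ls) (ms @ m # m' # ms') i * S (i + length ms)
     = block_pass_rev ls (ms @ m # m' # ms') (Suc i) * (pass_rev l (ms @ m # m' # ms') i * S (i + length ms))"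
    by (simp add: mult.assoc)
  also have "\<dots> = (block_pass_rev ls (ms @ m # m' # ms') (Suc i) * S (Suc i + length ms)) * pass_rev l (ms @ m' # m # ms') i"
    unfolding pass_rev_S_right[OF assms] by (simp add: mult.assoc)
  also have "\<dots> = S (i + length (l # ls) + length ms) * block_pass_rev (l # ls) (ms @ m' # m # ms') i"
    unfolding Cons.IH by (simp add: mult.assoc)
  finally show ?case .
qed

text \<open>Only the passes of \<open>l\<close> and \<open>l'\<close> interact with
  \<open>S\<close>: the later ones act further right than \<open>S\<close>, and the earlier ones end
  just before the place where it has arrived.\<close>

lemma block_pass_S_left:
  assumes "qstep l l'"
  shows "block_pass (ls @ l # l' # ls') ms i * S (i + length ls) = S (i + length ms + length ls) * block_pass (ls @ l' # l # ls') ms i"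
proof (induction ls arbitrary: i)
  case Nil
  have "block_pass (l # l' # ls') ms i * S i = pass l ms i * pass l' ms (Suc i) * (block_pass ls' ms (Suc (Suc i)) * S i)"
    by (simp add: mult.assoc)
  also have "\<dots> = (pass l ms i * pass l' ms (Suc i) * S i) * block_pass ls' ms (Suc (Suc i))"
    by (simp add: S_commute[OF block_pass_R_greater] mult.assoc)
  also have "\<dots> = S (i + length ms) * block_pass (l' # l # ls') ms i"
    unfolding pass_pass_S[OF assms] by (simp add: mult.assoc)
  finally show ?case by simp
next
  case (Cons a ls)
  have "block_pass ((a # ls) @ l # l' # ls') ms i * S (i + length (a # ls))
    = pass a ms i * (block_pass (ls @ l # l' # ls') ms (Suc i) * S (Suc i + length ls))"
    by (simp add: mult.assoc)
  also have "\<dots> = (pass a ms i * S (Suc i + length ms + length ls)) * block_pass (ls @ l' # l # ls') ms (Suc i)"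
    unfolding Cons.IH by (simp add: mult.assoc)
  also have "pass a ms i * S (Suc i + length ms + length ls) = S (Suc i + length ms + length ls) * pass a ms i"
    by (intro S_commute[symmetric] pass_R_far) simp
  finally show ?case by (simp add: mult.assoc)
qed

lemma block_pass_rev_S_left:
  assumes "qstep l l'"
  shows "block_pass_rev (ls @ l # l' # ls') ms i * S (i + length ms + length ls) = S (i + length ls) * block_pass_rev (ls @ l' # l # ls') ms i"
proof (induction ls arbitrary: i)
  case Nil
  have "block_pass_rev (l # l' # ls') ms i * S (i + length ms)
    = block_pass_rev ls' ms (Suc (Suc i)) * (pass_rev l' ms (Suc i) * pass_rev l ms i * S (i + length ms))"
    by (simp add: mult.assoc)
  also have "\<dots> = (block_pass_rev ls' ms (Suc (Suc i)) * S i) * pass_rev l ms (Suc i) * pass_rev l' ms i"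
    unfolding pass_rev_pass_rev_S[OF assms] by (simp add: mult.assoc)
  also have "\<dots> = S i * block_pass_rev (l' # l # ls') ms i"
    by (simp add: S_commute[OF block_pass_rev_R_greater, symmetric] mult.assoc)
  finally show ?case by simp
next
  case (Cons a ls)
  have "pass_rev a ms i * S (Suc i + length ms + length ls) = S (Suc i + length ms + length ls) * pass_rev a ms i"
    by (intro S_commute[symmetric] pass_rev_R_far) simp
  then have "block_pass_rev ((a # ls) @ l # l' # ls') ms i * S (i + length ms + length (a # ls))
    = (block_pass_rev (ls @ l # l' # ls') ms (Suc i) * S (Suc i + length ms + length ls)) * pass_rev a ms i"
    by (simp add: mult.assoc)
  also have "\<dots> = S (i + length (a # ls)) * block_pass_rev ((a # ls) @ l' # l # ls') ms i"
    unfolding Cons.IH by (simp add: mult.assoc)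
  finally show ?case .
qed

text \<open>The scalar in the unitarity relation of the current R-matrix, R(u,v) R(v,u), after both
  denominators are cleared.\<close>

definition pass_factor :: "'l \<Rightarrow> 'l \<Rightarrow> 'b" where
  "pass_factor l m = sc ((q - inverse q)\<^sup>2) * (x l * x m) - (x m - x l) * (x m - x l)"

lemma pass_factor_central: "central (pass_factor l m)"
  by (simp add: pass_factor_def sc_central x_central)

lemma pass_factor_loc: "pass_factor l m \<in> loc 0"
  unfolding pass_factor_def by (intro loc_minus loc_mult sc_loc x_loc)

lemma Rx_Rx: "Rx i l m * Rx i m l = pass_factor l m"
proof -
  have c: "central (x l)" "central (x m)" "central (sc (q - inverse q))" by (simp_all add: x_central sc_central)
  define w where "w = sc (q - inverse q)"
  have "central w" by (simp add: w_def sc_central)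
  note com = centralD[OF c(1), of "R i"] central_left_commute[OF c(1), of "R i"]
    centralD[OF c(2), of "R i"] central_left_commute[OF c(2), of "R i"]
    centralD[OF c(1), of "x m"] central_left_commute[OF c(1), of "x m"]
    centralD[OF \<open>central w\<close>, of "R i"] central_left_commute[OF \<open>central w\<close>, of "R i"]
    centralD[OF \<open>central w\<close>, of "x l"] central_left_commute[OF \<open>central w\<close>, of "x l"]
    centralD[OF \<open>central w\<close>, of "x m"] central_left_commute[OF \<open>central w\<close>, of "x m"]
  have "Rx i l m * Rx i m l = (x m - x l) * ((x l - x m) * (R i * R i)) 
     - (x m - x l) * (w * (x l * R i)) - w * (x m * ((x l - x m) * R i)) + w * (w * (x l * x m))"
    unfolding Rx_def w_def[symmetric] by (simp add: algebra_simps com)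
  also have "\<dots> = w * (w * (x l * x m)) - (x m - x l) * (x m - x l)"
    unfolding hecke w_def[symmetric] by (simp add: algebra_simps com)
  finally show ?thesis unfolding pass_factor_def power2_eq_square sc_mult w_def by (simp add: mult.assoc)
qed

text \<open>The product telescopes from the inside by unitarity. One \<open>z\<close> serves all
  starting positions, since \<open>pass_factor\<close> does not depend on the position; membership
  in \<open>loc 0\<close> lets \<open>z\<close> leave every trace, and both orders are recorded
  because the commutation argument uses both.\<close>

lemma pass_pass_rev:
  assumes "\<And>m. m \<in> set ms \<Longrightarrow> regular (pass_factor l m)"
  shows "\<exists>z. central z \<and> regular z \<and> z \<in> loc 0 \<and> (\<forall>i. pass l ms i * pass_rev l ms i = z \<and> pass_rev l ms i * pass l ms i = z)"
  using assms
proof (induction ms)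
  case Nil
  then show ?case by (intro exI[of _ 1]) (auto simp: regular_def loc_one)
next
  case (Cons m ms)
  then obtain z where z: "central z" "regular z" "z \<in> loc 0" "\<And>i. pass l ms i * pass_rev l ms i = z" "\<And>i. pass_rev l ms i * pass l ms i = z"
    by auto
  have gs: "pass_factor m l = pass_factor l m"
    using centralD[OF x_central[of l], of "x m"] by (simp add: pass_factor_def algebra_simps)
  have 1: "pass l (m # ms) i * pass_rev l (m # ms) i = pass_factor l m * z" for i
  proof -
    have "pass l (m # ms) i * pass_rev l (m # ms) i = pass l ms (Suc i) * (Rx i l m * Rx i m l) * pass_rev l ms (Suc i)"
      by (simp add: mult.assoc)
    then show ?thesis
      unfolding Rx_Rx using centralD[OF pass_factor_central, of "pass l ms (Suc i)" l m] z(4)[of "Suc i"] by (simp add: mult.assoc)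
  qed
  have 2: "pass_rev l (m # ms) i * pass l (m # ms) i = pass_factor l m * z" for i
  proof -
    have "pass_rev l (m # ms) i * pass l (m # ms) i = Rx i m l * (pass_rev l ms (Suc i) * pass l ms (Suc i)) * Rx i l m"
      by (simp add: mult.assoc)
    also have "\<dots> = z * (Rx i m l * Rx i l m)"
      unfolding z(5) centralD[OF z(1)] by (simp add: mult.assoc)
    finally show ?thesis
      unfolding Rx_Rx gs by (simp add: centralD[OF z(1)])
  qed
  have "central (pass_factor l m * z)" "regular (pass_factor l m * z)" "pass_factor l m * z \<in> loc 0"
    using z Cons.prems by (auto simp: pass_factor_central intro!: regular_mult loc_mult pass_factor_loc)
  with 1 2 show ?case by metis
qed

lemma block_pass_block_pass_rev:
  assumes "\<And>l m. l \<in> set ls \<Longrightarrow> m \<in> set ms \<Longrightarrow> regular (pass_factor l m)"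
  shows "\<exists>z. central z \<and> regular z \<and> z \<in> loc 0 \<and> (\<forall>i. block_pass ls ms i * block_pass_rev ls ms i = z \<and> block_pass_rev ls ms i * block_pass ls ms i = z)"
  using assms
proof (induction ls)
  case Nil
  then show ?case by (intro exI[of _ 1]) (auto simp: regular_def loc_one)
next
  case (Cons l ls)
  then obtain z where z: "central z" "regular z" "z \<in> loc 0" "\<And>i. block_pass ls ms i * block_pass_rev ls ms i = z" "\<And>i. block_pass_rev ls ms i * block_pass ls ms i = z"
    by auto
  from Cons.prems pass_pass_rev[of ms l] obtain w where w: "central w" "regular w" "w \<in> loc 0"
    "\<And>i. pass l ms i * pass_rev l ms i = w" "\<And>i. pass_rev l ms i * pass l ms i = w"
    by auto
  have 1: "block_pass (l # ls) ms i * block_pass_rev (l # ls) ms i = z * w" for i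
  proof -
    have "block_pass (l # ls) ms i * block_pass_rev (l # ls) ms i = pass l ms i * (block_pass ls ms (Suc i) * block_pass_rev ls ms (Suc i)) * pass_rev l ms i"
      by (simp add: mult.assoc)
    then show ?thesis unfolding z(4) centralD[OF z(1)] by (simp add: w mult.assoc)
  qed
  have 2: "block_pass_rev (l # ls) ms i * block_pass (l # ls) ms i = z * w" for i
  proof -
    have "block_pass_rev (l # ls) ms i * block_pass (l # ls) ms i = block_pass_rev ls ms (Suc i) * (pass_rev l ms i * pass l ms i) * block_pass ls ms (Suc i)"
      by (simp add: mult.assoc)
    then show ?thesis unfolding w(5) centralD[OF w(1)] by (simp add: z mult.assoc centralD[OF z(1), of w])
  qed
  have "central (z * w)" "regular (z * w)" "z * w \<in> loc 0"
    using z w by (auto intro!: regular_mult loc_mult)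
  with 1 2 show ?case by metis
qed


section \<open>Skew-symmetrizers and their absorption\<close>

primrec skew :: "nat \<Rightarrow> nat \<Rightarrow> 'b" where
  "skew i 0 = 1"
| "skew i (Suc n) = (if n = 0 then 1 else sc (qnum q n / qnum q (n + 1)) *
     (skew i n * (sc (q ^ n / qnum q n) - R (i + n - 1)) * skew i n))"

lemma skew_loc: "i + n \<le> k \<Longrightarrow> skew i n \<in> loc k"
  by (induction n) (auto intro!: loc_mult loc_one loc_minus R_loc sc_loc)

lemma sc_commute: "X * sc a = sc a * X"
  by (rule centralD[OF sc_central])

lemma sc_left_commute: "X * (sc a * Y) = sc a * (X * Y)"
  by (rule central_left_commute[OF sc_central])

lemma skew_commute:
  assumes "\<And>j. i \<le> j \<Longrightarrow> j + 2 \<le> i + n \<Longrightarrow> X * R j = R j * X"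
  shows "X * skew i n = skew i n * X"
  using assms
proof (induction n)
  case (Suc n)
  show ?case
  proof (cases "n = 0")
    case False
    have "X * skew i n = skew i n * X" using Suc by auto
    moreover have "X * (sc (q ^ n / qnum q n) - R (i + n - 1)) = (sc (q ^ n / qnum q n) - R (i + n - 1)) * X"
      using Suc.prems[of "i + n - 1"] False by (simp add: algebra_simps sc_commute)
    ultimately show ?thesis using False sc_commute[of X]
      by (auto intro!: commute_mult)
  qed simp
qed simp

lemma skew_commute_loc: "X \<in> loc i \<Longrightarrow> X * skew i n = skew i n * X"
  by (rule skew_commute) (metis R_commute_loc loc_monoD)

text \<open>Where \<open>R\<close> acts as -q^-1, the middle factor of the recursion for
  \<open>skew\<close> becomes this number; the normalization is chosen to make it 1.\<close>

lemma qnum_coeff: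
  assumes "n \<ge> 1"
  shows "qnum q n / qnum q (n + 1) * (q ^ n / qnum q n + inverse q) = 1"
proof -
  have "qnum q n \<noteq> 0" "qnum q (Suc n) \<noteq> 0" using qnum_nonzero[OF generic q0] assms by auto
  moreover have "qnum q n / qnum q (n + 1) * (q ^ n / qnum q n + inverse q) = (q ^ n + inverse q * qnum q n) / qnum q (n + 1)"
    using calculation q0 by (simp add: distrib_left add_divide_distrib)
  ultimately show ?thesis
    by (simp flip: qnum_Suc[OF q0 qq_nonzero])
qed

text \<open>Modulo \<open>I\<close> the assumption reads X R_j = -q^-1 X, so each step of the
  recursion multiplies \<open>X\<close> by 1. Only a right ideal is needed, which allows
  \<open>{0}\<close> as well as \<open>J\<close>: the first gives exact identities, the second
  identities modulo the relations.\<close>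

lemma skew_absorb:
  assumes I: "0 \<in> I" "\<And>X Y. X \<in> I \<Longrightarrow> Y \<in> I \<Longrightarrow> X + Y \<in> I" "\<And>X Y. X \<in> I \<Longrightarrow> X * Y \<in> I"
    and "\<And>j. i \<le> j \<Longrightarrow> j + 2 \<le> i + n \<Longrightarrow> X * S j \<in> I"
  shows "X * skew i n - X \<in> I"
  using assms(4)
proof (induction n)
  case 0
  then show ?case using I by simp
next
  case (Suc n)
  show ?case
  proof (cases "n = 0")
    case True
    then show ?thesis using I by simp
  next
    case False
    define A where "A = skew i n"
    define c where "c = qnum q n / qnum q (n + 1)"
    define b where "b = q ^ n / qnum q n"
    define r where "r = R (i + n - 1)"
    define y where "y = X * A - X"
    have y: "y \<in> I" unfolding y_def A_def using Suc by auto
    have XS: "X * S (i + n - 1) \<in> I" using Suc.prems False by auto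
    have r: "r = S (i + n - 1) - sc (inverse q)" by (simp add: S_def r_def)
    have "sc c * sc (b + inverse q) = 1"
      using qnum_coeff[of n] False by (simp add: c_def b_def sc_1 flip: sc_mult)
    then have cb: "sc c * (sc (b + inverse q) * Z) = Z" for Z by (simp flip: mult.assoc)
    have "X * skew i (Suc n) = sc c * ((X * A) * (sc b - r) * A)"
      using False by (simp add: A_def c_def b_def r_def sc_left_commute mult.assoc)
    also have "\<dots> = sc c * ((X * (sc (b + inverse q)) * A) - X * S (i + n - 1) * A + y * (sc b - r) * A)"
    proof -
      have "X * A = X + y" by (simp add: y_def)
      then have "(X * A) * (sc b - r) * A = X * (sc b - r) * A + y * (sc b - r) * A"
        by (simp only: distrib_right)
      also have "X * (sc b - r) * A = X * sc (b + inverse q) * A - X * S (i + n - 1) * A"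
        unfolding r sc_add by (simp add: algebra_simps)
      finally show ?thesis by simp
    qed
    also have "\<dots> = X * A - sc c * (X * S (i + n - 1) * A) + sc c * (y * (sc b - r) * A)"
      using sc_commute[of X "b + inverse q"] cb[of "X * A"]
      by (simp add: distrib_left right_diff_distrib mult.assoc)
    finally have eq: "X * skew i (Suc n) - X = y + X * S (i + n - 1) * (- A * sc c) + y * ((sc b - r) * A * sc c)"
      using sc_commute[of "X * S (i + n - 1) * A" c] sc_commute[of "y * (sc b - r) * A" c]
      by (simp add: y_def mult.assoc)
    show ?thesis unfolding eq by (intro I(2) I(3) y XS)
  qed
qed

text \<open>Only the newest braiding \<open>T = R j\<close> is in question. The right-hand copy of
  \<open>A = skew i n\<close> is unfolded once more into \<open>B\<close> and \<open>G\<close>, the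
  previous skew-symmetrizer and braiding. As \<open>B\<close> commutes with \<open>T\<close> and is
  absorbed by \<open>A\<close>, everything reduces to a product of \<open>A\<close> with three
  factors in the two braidings \<open>T\<close> and \<open>G\<close>.\<close>

lemma skew_S_zero: "i \<le> j \<Longrightarrow> j + 2 \<le> i + n \<Longrightarrow> skew i n * S j = 0"
proof (induction n arbitrary: j)
  case (Suc n)
  then have n: "n \<noteq> 0" by auto
  define A where "A = skew i n"
  define ci where "ci = sc (inverse q)"
  show ?case
  proof (cases "j + 2 \<le> i + n")
    case True
    then have "A * S j = 0" using Suc by (simp add: A_def)
    then show ?thesis using n by (simp add: A_def mult.assoc)
  next
    case False
    then have j: "j = i + n - 1" using Suc.prems by simp
    show ?thesis
    proof (cases "n = 1")
      case True
      then have "qnum q n = 1" using qq_nonzero by (simp add: qnum_def)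
      then show ?thesis using True j R_S_zero[of i] by (simp add: mult.assoc algebra_simps)
    next
      case n1: False
      then obtain k where k: "n = Suc k" "k \<ge> 1" using n by (cases n) auto
      define B where "B = skew i k"
      define T where "T = R j"
      define G where "G = R (i + k - 1)"
      define a where "a = sc (q ^ n / qnum q n)"
      define b where "b = sc (q ^ k / qnum q k)"
      have jk: "j = Suc (i + k - 1)" using j k by simp
      have A: "A = sc (qnum q k / qnum q n) * (B * (b - G) * B)"
        using k by (simp add: A_def B_def b_def G_def)
      have AG: "A * G = - (ci * A)"
        using Suc.IH[of "i + k - 1"] k by (simp add: A_def G_def ci_def S_def algebra_simps sc_commute eq_neg_iff_add_eq_0)
      have "A * B - A \<in> {0}"
        unfolding B_def by (rule skew_absorb) (use Suc.IH k in \<open>auto simp: A_def\<close>)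
      then have AB: "A * B = A" by simp
      have TB: "B * T = T * B"
        unfolding B_def T_def jk by (rule R_commute_loc[symmetric], rule skew_loc) (use k in simp)
      have TGT: "T * G * T = G * T * G" unfolding T_def G_def jk using braid by simp
      have TT: "T * (T + ci) = sc q * (T + ci)"
        using R_S_zero[of j] by (simp add: T_def ci_def S_def left_diff_distrib)
      have S: "S j = T + ci" by (simp add: T_def ci_def S_def)
      \<comment> \<open>With n = k + 1 this is n_q = q^k + q^-1 k_q multiplied by q^n / (n_q
        k_q).\<close>
      have co: "a * b + a * ci - b * sc q = 0"
      proof -
        have "qnum q k \<noteq> 0" "qnum q (Suc k) \<noteq> 0" using qnum_nonzero[OF generic q0] k by auto
        then have "(q ^ n / qnum q n) * (q ^ k / qnum q k) + (q ^ n / qnum q n) * inverse q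
            = q ^ n * (q ^ k + inverse q * qnum q k) / (qnum q n * qnum q k)"
          using k q0 by (simp add: distrib_left add_divide_distrib)
        also have "\<dots> = (q ^ k / qnum q k) * q"
          unfolding qnum_Suc[OF q0 qq_nonzero, symmetric] using k \<open>qnum q (Suc k) \<noteq> 0\<close> by simp
        finally have "(q ^ n / qnum q n) * (q ^ k / qnum q k) + (q ^ n / qnum q n) * inverse q - (q ^ k / qnum q k) * q = 0"
          by simp
        then show ?thesis unfolding a_def b_def ci_def by (metis sc_0 sc_add sc_minus sc_mult)
      qed
      have bc: "central a" "central b" "central ci" by (simp_all add: a_def b_def ci_def sc_central)
      have 0: "A * (a - T) * (b - G) * (T + ci) = 0"
      proof -
        have "A * (a - T) * (b - G) * (T + ci) = A * (a * b) * (T + ci) - A * a * G * (T + ci) - A * T * b * (T + ci)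
           + A * T * G * (T + ci)"
          by (simp add: algebra_simps)
        also have "A * (a * b) * (T + ci) = (a * b) * (A * (T + ci))"
          using centralD[of "a * b" A] bc by (simp add: mult.assoc)
        also have "A * a * G * (T + ci) = - ((a * ci) * (A * (T + ci)))"
          using centralD[OF bc(1), of A] AG by (metis mult.assoc mult_minus_left mult_minus_right)
        also have "A * T * b * (T + ci) = b * sc q * (A * (T + ci))"
        proof -
          have "A * T * b * (T + ci) = b * (A * (T * (T + ci)))"
            using centralD[OF bc(2), of "A * T"] by (simp add: mult.assoc)
          then show ?thesis unfolding TT by (simp add: sc_left_commute mult.assoc)
        qed
        also have "A * T * G * (T + ci) = 0"
        \<comment> \<open>The braid relation turns T G T into G T G, and G next to \<open>A\<close>
          becomes -q^-1, which cancels the other term.\<close>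
        proof -
          have "A * T * G * (T + ci) = A * (T * G * T) + A * T * G * ci" by (simp add: algebra_simps)
          also have "\<dots> = (A * G) * T * G + ci * (A * T * G)"
            unfolding TGT using centralD[OF bc(3), of "A * T * G"] by (simp add: mult.assoc)
          also have "\<dots> = 0" unfolding AG by (simp add: mult.assoc)
          finally show ?thesis .
        qed
        finally have "A * (a - T) * (b - G) * (T + ci) = (a * b + a * ci - b * sc q) * (A * (T + ci))"
          by (simp add: algebra_simps)
        then show ?thesis unfolding co by simp
      qed
      have "A * (a - T) * A * (T + ci) = sc (qnum q k / qnum q n) * (A * ((a - T) * B) * (b - G) * (B * (T + ci)))"
        by (subst (2) A) (simp add: sc_left_commute mult.assoc)
      also have "(a - T) * B = B * (a - T)"
        using centralD[OF bc(1), of B] TB by (simp add: algebra_simps)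
      also have "B * (T + ci) = (T + ci) * B"
        using centralD[OF bc(3), of B] TB by (simp add: algebra_simps)
      also have "A * (B * (a - T)) * (b - G) * ((T + ci) * B) = (A * B) * (a - T) * (b - G) * (T + ci) * B"
        by (simp add: mult.assoc)
      also have "\<dots> = 0" unfolding AB 0 by simp
      finally have "A * (a - T) * A * (T + ci) = 0" by simp
      then show ?thesis
        using n by (simp add: S mult.assoc) (simp add: A_def T_def j a_def mult.assoc)
    qed
  qed
qed simp


lemma cong_eq_trans [trans]: "X \<sim>\<^sub>J Y \<Longrightarrow> Y = Z \<Longrightarrow> X \<sim>\<^sub>J Z"
  and eq_cong_trans [trans]: "X = Y \<Longrightarrow> Y \<sim>\<^sub>J Z \<Longrightarrow> X \<sim>\<^sub>J Z"
  by simp_all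

text \<open>The braid R_k R_(k+1) ... R_(k+p-1), which takes one strand across \<open>p\<close>
  others: conjugation by it moves braidings and overlined matrices one position to the
  right.\<close>

primrec shift :: "nat \<Rightarrow> nat \<Rightarrow> 'b" where
  "shift k 0 = 1"
| "shift k (Suc p) = shift k p * R (k + p)"

primrec shift_inv :: "nat \<Rightarrow> nat \<Rightarrow> 'b" where
  "shift_inv k 0 = 1"
| "shift_inv k (Suc p) = Ri (k + p) * shift_inv k p"

lemma shift_shift_inv: "shift k p * shift_inv k p = 1" "shift_inv k p * shift k p = 1"
proof (induction p)
  case (Suc p)
  have "shift k (Suc p) * shift_inv k (Suc p) = shift k p * (R (k + p) * Ri (k + p)) * shift_inv k p" 
    by (simp only: shift.simps shift_inv.simps mult.assoc)
  then show "shift k (Suc p) * shift_inv k (Suc p) = 1" using Suc by simp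
  have "shift_inv k (Suc p) * shift k (Suc p) = Ri (k + p) * (shift_inv k p * shift k p) * R (k + p)" 
    by (simp only: shift.simps shift_inv.simps mult.assoc)
  then show "shift_inv k (Suc p) * shift k (Suc p) = 1" using Suc by simp
qed simp_all

lemma shift_loc: "k + p < n \<Longrightarrow> shift k p \<in> loc n" "k + p < n \<Longrightarrow> shift_inv k p \<in> loc n"
  by (induction p) (auto intro!: loc_mult R_loc Ri_loc loc_one)

lemma shift_commute_greater: "(\<And>j. k \<le> j \<Longrightarrow> j < k + p \<Longrightarrow> X * R j = R j * X) \<Longrightarrow> X * shift k p = shift k p * X"
  by (induction p) (auto intro!: commute_mult)

lemma shift_R: "k \<le> i \<Longrightarrow> Suc i < k + p \<Longrightarrow> shift k p * R i = R (Suc i) * shift k p"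
proof (induction p)
  case (Suc p)
  show ?case
  proof (cases "Suc i < k + p")
    case True
    have "shift k (Suc p) * R i = shift k p * R i * R (k + p)"
      using R_far[of "k + p" i] True by (simp add: mult.assoc)
    then show ?thesis using Suc True by (simp add: mult.assoc)
  next
    case False
    then obtain p' where p': "p = Suc p'"
      using Suc.prems by (cases p) auto
    with False Suc.prems have p: "p = Suc p'" "i = k + p'" by simp_all
    have "shift k (Suc p) * R i = shift k p' * (R i * R (Suc i) * R i)"
      by (simp add: p mult.assoc)
    also have "\<dots> = shift k p' * R (Suc i) * R i * R (Suc i)"
      unfolding braid by (simp add: mult.assoc)
    also have "shift k p' * R (Suc i) = R (Suc i) * shift k p'"
      by (rule shift_commute_greater[symmetric], rule R_far) (use p in auto)
    finally show ?thesis by (simp add: p mult.assoc)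
  qed
qed simp

text \<open>Exactly one braiding of the product, \<open>R i\<close>, changes \<open>Lb i\<close>,
  and it does so by the definition of overlining; those to its right commute with
  \<open>Lb i\<close>, those to its left with \<open>Lb (Suc i)\<close>. For plain lower indices
  this would fail.\<close>

lemma shift_Lb: "k \<le> i \<Longrightarrow> i < k + p \<Longrightarrow> shift k p * Lb i l = Lb (Suc i) l * shift k p"
proof (induction p)
  case (Suc p)
  show ?case
  proof (cases "i < k + p")
    case True
    then show ?thesis using Suc R_Lb_less[of i "k + p" l]
      by (simp add: mult.assoc) (simp flip: mult.assoc)
  next
    case False
    then have i: "i = k + p" using Suc.prems by simp
    have "Lb (Suc i) l * shift k p = shift k p * Lb (Suc i) l"
      by (rule shift_commute_greater, rule R_Lb_greater[symmetric]) (use i in auto)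
    then have "Lb (Suc i) l * shift k (Suc p) = shift k p * (Lb (Suc i) l * R i)"
      by (simp only: i shift.simps flip: mult.assoc)
    also have "Lb (Suc i) l * R i = R i * Lb i l"
      by (simp add: mult.assoc)
    finally show ?thesis by (simp add: i mult.assoc)
  qed
qed simp

lemma shift_skew: "i + n \<le> k + p \<Longrightarrow> k \<le> i \<Longrightarrow> shift k p * skew i n = skew (Suc i) n * shift k p"
proof (induction n)
  case (Suc n)
  show ?case
  proof (cases "n = 0")
    case False
    define A where "A = skew i n"
    define A' where "A' = skew (Suc i) n"
    define s where "s = sc (q ^ n / qnum q n)"
    define c where "c = qnum q n / qnum q (Suc n)"
    have 1: "shift k p * A = A' * shift k p" using Suc by (simp add: A_def A'_def)
    have 2: "shift k p * (s - R (i + n - 1)) = (s - R (Suc (i + n - 1))) * shift k p"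
      using shift_R[of k "i + n - 1" p] False Suc.prems by (simp add: s_def algebra_simps sc_commute)
    have "shift k p * skew i (Suc n) = sc c * (shift k p * A * (s - R (i + n - 1)) * A)"
      using False by (simp add: A_def s_def c_def mult.assoc sc_left_commute)
    also have "\<dots> = sc c * (A' * (shift k p * (s - R (i + n - 1))) * A)"
      unfolding 1 by (simp add: mult.assoc)
    also have "\<dots> = sc c * (A' * (s - R (Suc (i + n - 1))) * (shift k p * A))"
      unfolding 2 by (simp add: mult.assoc)
    also have "\<dots> = skew (Suc i) (Suc n) * shift k p"
      unfolding 1 using False by (simp add: A'_def s_def c_def mult.assoc)
    finally show ?thesis .
  qed simp
qed simp

lemma shift_Lprod: "k \<le> i \<Longrightarrow> i + length ls \<le> k + p \<Longrightarrow> shift k p * Lprod i ls = Lprod (Suc i) ls * shift k p"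
proof (induction ls arbitrary: i)
  case (Cons l ls)
  have "shift k p * Lprod i (l # ls) = (shift k p * Lb i l) * Lprod (Suc i) ls" by (simp add: mult.assoc)
  also have "\<dots> = Lb (Suc i) l * (shift k p * Lprod (Suc i) ls)"
    using Cons.prems by (simp only: shift_Lb mult.assoc length_Cons)
  also have "\<dots> = Lprod (Suc i) (l # ls) * shift k p"
    using Cons by (simp only: Lprod.simps mult.assoc length_Cons)
  finally show ?case .
qed simp

section \<open>Iterated R-traces and products of elementary symmetric polynomials\<close>

primrec traces :: "nat \<Rightarrow> nat \<Rightarrow> 'b \<Rightarrow> 'b" where
  "traces k 0 X = X"
| "traces k (Suc p) X = traces k p (tr (k + p) X)"

lemma traces_add: "traces k (m + n) X = traces k m (traces (k + m) n X)"
  by (induction n arbitrary: X) (simp_all add: add.assoc)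

lemma traces_left: "X \<in> loc k \<Longrightarrow> traces k p (X * Y) = X * traces k p Y"
  by (induction p arbitrary: Y) (simp_all add: tr_left loc_monoD[of X k])

lemma traces_right: "X \<in> loc k \<Longrightarrow> traces k p (Y * X) = traces k p Y * X"
  by (induction p arbitrary: Y) (simp_all add: tr_right loc_monoD[of X k])

lemma traces_loc: "X \<in> loc (k + p) \<Longrightarrow> traces k p X \<in> loc k"
  by (induction p arbitrary: X) (simp_all add: tr_loc)

lemma traces_cong: "X \<sim>\<^sub>J Y \<Longrightarrow> traces k p X \<sim>\<^sub>J traces k p Y"
  by (induction p arbitrary: X Y) (simp_all add: cong_tr)

text \<open>The outermost trace sees only the last braiding of \<open>shift\<close>, and
  \<open>tr_R\<close> removes it while lowering the traced position by one; the next trace then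
  meets the next braiding.\<close>

lemma traces_shift:
  "X \<in> loc (k + p) \<Longrightarrow> traces (Suc k) p (shift k p * X * shift_inv k p) = traces k p X"
proof (induction p arbitrary: X)
  case (Suc p)
  have "traces (Suc k) (Suc p) (shift k (Suc p) * X * shift_inv k (Suc p))
     = traces (Suc k) p (tr (Suc (k + p)) (shift k p * (R (k + p) * X * Ri (k + p)) * shift_inv k p))"
    by (simp add: mult.assoc)
  also have "\<dots> = traces (Suc k) p (shift k p * tr (Suc (k + p)) (R (k + p) * X * Ri (k + p)) * shift_inv k p)"
    by (simp add: tr_left tr_right shift_loc)
  also have "\<dots> = traces (Suc k) p (shift k p * tr (k + p) X * shift_inv k p)"
    using Suc.prems by (simp add: Ri_def tr_R)
  also have "\<dots> = traces k (Suc p) X"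
    using Suc.prems by (simp add: Suc.IH tr_loc)
  finally show ?case .
qed simp

definition esym :: "'l list \<Rightarrow> 'b" where
  "esym ls = traces 0 (length ls) (skew 0 (length ls) * Lprod 0 ls)"

text \<open>An elementary symmetric polynomial may be computed in any block of consecutive
  positions. This puts the second factor of a product behind the first.\<close>

lemma esym_shifted: "traces k (length ls) (skew k (length ls) * Lprod k ls) = esym ls"
proof (induction k)
  case (Suc k)
  let ?n = "length ls"
  have "shift k ?n * (skew k ?n * Lprod k ls) * shift_inv k ?n = (shift k ?n * skew k ?n) * Lprod k ls * shift_inv k ?n"
    by (simp add: mult.assoc)
  also have "\<dots> = skew (Suc k) ?n * (shift k ?n * Lprod k ls) * shift_inv k ?n"
    by (simp add: shift_skew mult.assoc)
  also have "\<dots> = skew (Suc k) ?n * Lprod (Suc k) ls"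
    by (simp add: shift_Lprod shift_shift_inv mult.assoc)
  finally have "traces (Suc k) ?n (skew (Suc k) ?n * Lprod (Suc k) ls) = traces (Suc k) ?n (shift k ?n * (skew k ?n * Lprod k ls) * shift_inv k ?n)"
    by simp
  also have "\<dots> = traces k ?n (skew k ?n * Lprod k ls)"
    by (intro traces_shift loc_mult skew_loc Lprod_loc) auto
  finally show ?case by (simp add: Suc)
qed (simp add: esym_def)

definition skew_pair :: "nat \<Rightarrow> nat \<Rightarrow> 'b" where
  "skew_pair k p = skew 0 k * skew k p"

text \<open>The second skew-symmetrizer commutes with the first block of generating matrices, which
  lives in the first \<open>length ls\<close> positions. The inner traces then produce
  \<open>esym ms\<close>, and being in \<open>loc 0\<close> it leaves the outer ones.\<close>

lemma esym_mult:
  "traces 0 (length ls + length ms) (skew_pair (length ls) (length ms) * Lprod 0 (ls @ ms)) = esym ls * esym ms"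
proof -
  let ?k = "length ls" and ?p = "length ms"
  have "Lprod 0 ls \<in> loc ?k" by (simp add: Lprod_loc)
  then have "skew ?k ?p * Lprod 0 ls = Lprod 0 ls * skew ?k ?p" by (simp add: skew_commute_loc)
  then have "skew_pair ?k ?p * Lprod 0 (ls @ ms) = (skew 0 ?k * Lprod 0 ls) * (skew ?k ?p * Lprod ?k ms)"
    by (simp add: skew_pair_def Lprod_append mult.assoc) (simp flip: mult.assoc)
  moreover have "skew 0 ?k * Lprod 0 ls \<in> loc ?k" by (intro loc_mult skew_loc Lprod_loc) auto
  ultimately have "traces 0 (?k + ?p) (skew_pair ?k ?p * Lprod 0 (ls @ ms)) = traces 0 ?k ((skew 0 ?k * Lprod 0 ls) * esym ms)"
    by (simp add: traces_add traces_left esym_shifted)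
  moreover have "esym ms \<in> loc 0"
    unfolding esym_def by (intro traces_loc loc_mult skew_loc Lprod_loc) auto
  ultimately show ?thesis by (simp add: traces_right esym_def)
qed

lemma skew_pair_S_zero:
  assumes "j + 2 \<le> k \<or> k \<le> j \<and> j + 2 \<le> k + p"
  shows "skew_pair k p * S j = 0"
proof (cases "j + 2 \<le> k")
  case True
  then have "S j * skew k p = skew k p * S j"
    \<comment> \<open>\<open>loc\<close> is assumed closed under differences only, so
      \<open>S j\<close> is treated as \<open>R j\<close> minus a negative scalar.\<close>
    by (intro skew_commute_loc) (auto simp: S_def intro!: loc_minus[of _ _ "- sc (inverse q)", simplified] R_loc sc_loc
       simp flip: sc_minus[of 0, simplified sc_0 diff_0])
  then have "skew_pair k p * S j = (skew 0 k * S j) * skew k p" by (simp add: skew_pair_def mult.assoc)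
  then show ?thesis using True skew_S_zero[of 0 j k] by simp
next
  case False
  then show ?thesis using assms skew_S_zero[of k j p] by (simp add: skew_pair_def mult.assoc)
qed

text \<open>The test behind every absorption identity below. A pair straddling the boundary,
  \<open>Suc j = k\<close>, is not among those to be checked.\<close>

lemma J_absorb:
  assumes "\<And>j. j + 2 \<le> k \<or> k \<le> j \<and> j + 2 \<le> k + p \<Longrightarrow> X * S j \<in> J"
  shows "X * skew_pair k p \<sim>\<^sub>J X"
proof -
  have "X * skew 0 k \<sim>\<^sub>J X" "X * skew k p \<sim>\<^sub>J X"
    unfolding cong_def by (rule skew_absorb[OF J_0 J_add J_right]; use assms in simp)+
  then show ?thesis unfolding skew_pair_def by (metis cong_right cong_trans mult.assoc)
qed

section \<open>The defining relation for single parameters and for blocks\<close>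

lemma RE_shift:
  assumes "RE l m"
  shows "Rx i l m * Lb i l * Lb (Suc i) m \<sim>\<^sub>J Lb i m * Lb (Suc i) l * Rx i l m"
proof (induction i)
  case 0
  then show ?case using assms by (simp only: RE_def)
next
  case (Suc i)
  \<comment> \<open>Conjugation by this braid moves both overlined matrices and the braiding between
    them at once.\<close>
  define V where "V = shift i 2"
  define V' where "V' = shift_inv i 2"
  have V: "V * V' = 1" by (simp add: V_def V'_def shift_shift_inv)
  have L: "V * Lb i a = Lb (Suc i) a * V" "V * Lb (Suc i) a = Lb (Suc (Suc i)) a * V" for a
    unfolding V_def by (rule shift_Lb; simp)+
  have X: "V * Rx i l m = Rx (Suc i) l m * V"
  proof -
    have "V * R i = R (Suc i) * V" unfolding V_def by (rule shift_R) auto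
    then show ?thesis
      using central_left_commute[of "x m - x l" V "R i"] centralD[of "sc (q - inverse q) * x m" V]
      by (simp add: Rx_def left_diff_distrib right_diff_distrib x_central sc_central mult.assoc)
  qed
  have "V * (Rx i l m * Lb i l * Lb (Suc i) m) * V' \<sim>\<^sub>J V * (Lb i m * Lb (Suc i) l * Rx i l m) * V'"
    by (intro cong_left cong_right Suc)
  also have "V * (Rx i l m * Lb i l * Lb (Suc i) m) * V' = (V * Rx i l m) * Lb i l * Lb (Suc i) m * V'"
    by (simp only: mult.assoc)
  also have "\<dots> = Rx (Suc i) l m * (V * Lb i l) * Lb (Suc i) m * V'"
    unfolding X by (simp only: mult.assoc)
  also have "\<dots> = Rx (Suc i) l m * Lb (Suc i) l * (V * Lb (Suc i) m) * V'"
    unfolding L(1) by (simp only: mult.assoc)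
  also have "\<dots> = Rx (Suc i) l m * Lb (Suc i) l * Lb (Suc (Suc i)) m * (V * V')"
    unfolding L(2) by (simp only: mult.assoc)
  also have "V * (Lb i m * Lb (Suc i) l * Rx i l m) * V' = (V * Lb i m) * Lb (Suc i) l * Rx i l m * V'"
    by (simp only: mult.assoc)
  also have "\<dots> = Lb (Suc i) m * (V * Lb (Suc i) l) * Rx i l m * V'"
    unfolding L(1) by (simp only: mult.assoc)
  also have "\<dots> = Lb (Suc i) m * Lb (Suc (Suc i)) l * (V * Rx i l m) * V'"
    unfolding L(2) by (simp only: mult.assoc)
  also have "\<dots> = Lb (Suc i) m * Lb (Suc (Suc i)) l * Rx (Suc i) l m * (V * V')"
    unfolding X by (simp only: mult.assoc)
  finally show ?case unfolding V by simp
qed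

lemma pass_commute_loc: "X \<in> loc i \<Longrightarrow> pass l ms i * X = X * pass l ms i"
proof (induction ms arbitrary: i)
  case (Cons m ms)
  have "X * pass l ms (Suc i) = pass l ms (Suc i) * X" using Cons loc_monoD[of X i "Suc i"] by simp
  moreover have "X * Rx i l m = Rx i l m * X" by (rule Rx_commute[OF R_commute_loc, symmetric]) fact
  ultimately show ?case by (simp add: commute_mult)
qed simp

lemma block_pass_commute_loc: "X \<in> loc i \<Longrightarrow> block_pass ls ms i * X = X * block_pass ls ms i"
proof (induction ls arbitrary: i)
  case (Cons l ls)
  have "X * block_pass ls ms (Suc i) = block_pass ls ms (Suc i) * X" using Cons loc_monoD[of X i "Suc i"] by simp
  moreover have "X * pass l ms i = pass l ms i * X" by (rule pass_commute_loc[symmetric]) fact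
  ultimately show ?case by (simp add: commute_mult)
qed simp

lemma pass_Lprod_greater: "i + length ms < k \<Longrightarrow> pass l ms i * Lprod k ls = Lprod k ls * pass l ms i"
proof (induction ms arbitrary: i)
  case (Cons m ms)
  have "Lprod k ls * pass l ms (Suc i) = pass l ms (Suc i) * Lprod k ls" using Cons by simp
  moreover have "Lprod k ls * Rx i l m = Rx i l m * Lprod k ls"
    by (rule Rx_commute[OF R_Lprod_greater, symmetric]) (use Cons.prems in simp)
  ultimately show ?case by (simp add: commute_mult)
qed simp

text \<open>One use of the relation moves \<open>l\<close> past the head \<open>m\<close>. The new
  head at position \<open>i\<close> commutes with the rest of the pass, and the used current
  braiding commutes with the matrices from \<open>i + 2\<close> on, so the induction hypothesis
  applies in between.\<close>

lemma pass_Lprod: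
  assumes "\<And>m. m \<in> set ms \<Longrightarrow> RE l m"
  shows "pass l ms i * (Lb i l * Lprod (Suc i) ms) \<sim>\<^sub>J Lprod i ms * Lb (i + length ms) l * pass l ms i"
  using assms
proof (induction ms arbitrary: i)
  case (Cons m ms)
  have "pass l (m # ms) i * (Lb i l * Lprod (Suc i) (m # ms))
      = pass l ms (Suc i) * (Rx i l m * Lb i l * Lb (Suc i) m) * Lprod (Suc (Suc i)) ms"
    by (simp only: pass.simps Lprod.simps mult.assoc)
  also have "\<dots> \<sim>\<^sub>J pass l ms (Suc i) * (Lb i m * Lb (Suc i) l * Rx i l m) * Lprod (Suc (Suc i)) ms"
    using Cons.prems by (intro cong_left cong_right RE_shift) simp
  also have "\<dots> = (pass l ms (Suc i) * Lb i m) * Lb (Suc i) l * (Rx i l m * Lprod (Suc (Suc i)) ms)"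
    by (simp only: mult.assoc)
  also have "pass l ms (Suc i) * Lb i m = Lb i m * pass l ms (Suc i)"
    by (rule pass_commute_loc) (simp add: Lb_loc)
  also have "Rx i l m * Lprod (Suc (Suc i)) ms = Lprod (Suc (Suc i)) ms * Rx i l m"
    by (rule Rx_commute[OF R_Lprod_greater]) simp
  also have "Lb i m * pass l ms (Suc i) * Lb (Suc i) l * (Lprod (Suc (Suc i)) ms * Rx i l m)
      = Lb i m * (pass l ms (Suc i) * (Lb (Suc i) l * Lprod (Suc (Suc i)) ms)) * Rx i l m"
    by (simp only: mult.assoc)
  also have "\<dots> \<sim>\<^sub>J Lb i m * (Lprod (Suc i) ms * Lb (Suc i + length ms) l * pass l ms (Suc i)) * Rx i l m"
    using Cons by (intro cong_left cong_right Cons.IH) simp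
  also have "\<dots> = Lprod i (m # ms) * Lb (i + length (m # ms)) l * pass l (m # ms) i"
    by (simp only: pass.simps Lprod.simps mult.assoc length_Cons add_Suc_right add_Suc)
  finally show ?case .
qed simp

lemma block_pass_Lprod:
  assumes "\<And>l m. l \<in> set ls \<Longrightarrow> m \<in> set ms \<Longrightarrow> RE l m"
  shows "block_pass ls ms i * (Lprod i ls * Lprod (i + length ls) ms) \<sim>\<^sub>J Lprod i ms * Lprod (i + length ms) ls * block_pass ls ms i"
  using assms
proof (induction ls arbitrary: i)
  case (Cons l ls)
  let ?n = "length ms"
  have "block_pass (l # ls) ms i * (Lprod i (l # ls) * Lprod (i + length (l # ls)) ms)
     = pass l ms i * (block_pass ls ms (Suc i) * Lb i l) * (Lprod (Suc i) ls * Lprod (Suc i + length ls) ms)"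
    by (simp only: block_pass.simps Lprod.simps mult.assoc length_Cons add_Suc_right add_Suc)
  also have "block_pass ls ms (Suc i) * Lb i l = Lb i l * block_pass ls ms (Suc i)"
    by (rule block_pass_commute_loc) (simp add: Lb_loc)
  also have "pass l ms i * (Lb i l * block_pass ls ms (Suc i)) * (Lprod (Suc i) ls * Lprod (Suc i + length ls) ms)
     = pass l ms i * Lb i l * (block_pass ls ms (Suc i) * (Lprod (Suc i) ls * Lprod (Suc i + length ls) ms))"
    by (simp only: mult.assoc)
  also have "\<dots> \<sim>\<^sub>J pass l ms i * Lb i l * (Lprod (Suc i) ms * Lprod (Suc i + ?n) ls * block_pass ls ms (Suc i))"
    using Cons by (intro cong_left Cons.IH) simp
  also have "\<dots> = pass l ms i * (Lb i l * Lprod (Suc i) ms) * (Lprod (Suc i + ?n) ls * block_pass ls ms (Suc i))"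
    by (simp only: mult.assoc)
  also have "\<dots> \<sim>\<^sub>J (Lprod i ms * Lb (i + ?n) l * pass l ms i) * (Lprod (Suc i + ?n) ls * block_pass ls ms (Suc i))"
    by (rule cong_right, rule pass_Lprod, rule Cons.prems) simp_all
  also have "\<dots> = Lprod i ms * Lb (i + ?n) l * (pass l ms i * Lprod (Suc i + ?n) ls) * block_pass ls ms (Suc i)"
    by (simp only: mult.assoc)
  also have "pass l ms i * Lprod (Suc i + ?n) ls = Lprod (Suc i + ?n) ls * pass l ms i"
    by (rule pass_Lprod_greater) simp
  also have "Lprod i ms * Lb (i + ?n) l * (Lprod (Suc i + ?n) ls * pass l ms i) * block_pass ls ms (Suc i)
     = Lprod i ms * Lprod (i + ?n) (l # ls) * block_pass (l # ls) ms i"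
    by (simp only: block_pass.simps Lprod.simps mult.assoc add_Suc)
  finally show ?case .
qed simp

text \<open>Regularity is included because at this ratio both sides of the relation carry the common
  factor \<open>x l\<close>, which must be cancelled.\<close>

definition fusible :: "'l \<Rightarrow> 'l \<Rightarrow> bool" where
  "fusible l m \<longleftrightarrow> qstep l m \<and> RE l m \<and> regular (x l)"

definition chain :: "'l list \<Rightarrow> bool" where
  "chain ls \<longleftrightarrow> (\<forall>j. Suc j < length ls \<longrightarrow> fusible (ls ! j) (ls ! Suc j))"

lemma chain_split:
  assumes "chain ls" "j + 2 \<le> length ls"
  obtains ls1 l m ls2 where "ls = ls1 @ l # m # ls2" "length ls1 = j" "fusible l m"
proof
  show "ls = take j ls @ ls ! j # ls ! Suc j # drop (j + 2) ls"
    using assms(2) id_take_nth_drop[of j ls] Cons_nth_drop_Suc[of "Suc j" ls] by simp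
qed (use assms in \<open>auto simp: chain_def\<close>)

lemma Lb_swap:
  assumes "fusible l m"
  shows "(R j - sc q) * (Lb j l * Lb (Suc j) m) \<sim>\<^sub>J Lb j m * Lb (Suc j) l * (R j - sc q)"
proof -
  define z where "z = sc (q ^ 2 - 1) * x l"
  have xm: "x m = sc (q ^ 2) * x l" using assms by (simp add: fusible_def qstep_def)
  have "q ^ 2 \<noteq> 1" using generic unfolding generic_def by simp
  then have "regular z" using assms unfolding z_def fusible_def by (auto intro!: regular_mult regular_sc)
  have zc: "central z" unfolding z_def by (simp add: sc_central x_central)
  \<comment> \<open>The degeneration of the current R-matrix at the special ratio: the constant term
    satisfies (q - q^-1) q^2 = (q^2 - 1) q.\<close>
  have "Rx j l m = z * (R j - sc q)"
  proof -
    have "(q - inverse q) * q ^ 2 = (q ^ 2 - 1) * q"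
      using q0 by (simp add: power2_eq_square field_simps)
    then have "sc (q - inverse q) * sc (q ^ 2) = sc (q ^ 2 - 1) * sc q"
      by (simp flip: sc_mult)
    then have "sc (q - inverse q) * x m = z * sc q"
      unfolding xm z_def using sc_commute[of "x l" q] by (simp flip: mult.assoc) (simp add: mult.assoc)
    moreover have "x m - x l = z"
      unfolding xm z_def sc_minus sc_1 by (simp add: algebra_simps)
    ultimately show ?thesis by (simp add: Rx_def right_diff_distrib)
  qed
  then have "z * ((R j - sc q) * (Lb j l * Lb (Suc j) m)) \<sim>\<^sub>J Lb j m * Lb (Suc j) l * (z * (R j - sc q))"
    using RE_shift[of l m j] assms by (simp add: fusible_def mult.assoc)
  also have "Lb j m * Lb (Suc j) l * (z * (R j - sc q)) = z * (Lb j m * Lb (Suc j) l * (R j - sc q))"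
    using central_left_commute[OF zc] by blast
  finally show ?thesis using regular_cong[OF \<open>regular z\<close>] by blast
qed

text \<open>On the image of \<open>A\<close> the operator \<open>T = R j - q\<close> is the scalar
  -(q + q^-1), nonzero by genericity. So a \<open>T\<close> can be created next to \<open>A\<close>,
  moved through the product by \<open>Lb_swap\<close>, and it annihilates \<open>S j\<close> on the
  other side.\<close>

lemma Lprod_absorb:
  assumes "A * S j = 0" "fusible l m" "length ls1 = j"
  shows "A * Lprod 0 (ls1 @ l # m # ls2) * S j \<in> J"
proof -
  define T where "T = R j - sc q"
  define k where "k = - (q + inverse q)"
  have k: "k \<noteq> 0"
  proof
    assume "k = 0"
    then have "q * q = -1" using q0 by (simp add: k_def field_simps eq_neg_iff_add_eq_0)
    then have "q ^ 4 = 1" by (simp add: numeral_eq_Suc)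
    then show False using generic unfolding generic_def by (metis one_le_numeral)
  qed
  have AT: "A * T = sc k * A"
  proof -
    have "T = S j + sc k"
      unfolding k_def using sc_add[of q "inverse q"] sc_minus[of 0 "q + inverse q"] by (simp add: T_def S_def sc_0)
    then show ?thesis using assms(1) by (simp add: distrib_left sc_commute)
  qed
  have TS: "T * S j = 0" unfolding T_def by (rule R_S_zero)
  have T1: "T * Lprod 0 ls1 = Lprod 0 ls1 * T"
    using R_commute_loc[OF Lprod_loc[of 0 ls1 j]] assms(3) sc_commute[of "Lprod 0 ls1" q]
    by (simp add: T_def algebra_simps)
  have T2: "T * Lprod (Suc (Suc j)) ls2 = Lprod (Suc (Suc j)) ls2 * T"
    using R_Lprod_greater[of j "Suc (Suc j)" ls2] sc_commute[of "Lprod (Suc (Suc j)) ls2" q]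
    by (simp add: T_def algebra_simps)
  have eq: "Lprod 0 (ls1 @ a # b # ls2) = Lprod 0 ls1 * (Lb j a * Lb (Suc j) b) * Lprod (Suc (Suc j)) ls2" for a b
    using assms(3) by (simp add: Lprod_append mult.assoc)
  have "sc k * (A * Lprod 0 (ls1 @ l # m # ls2) * S j) = A * T * Lprod 0 (ls1 @ l # m # ls2) * S j"
    unfolding AT by (simp add: mult.assoc)
  also have "\<dots> = A * (T * Lprod 0 ls1) * (Lb j l * Lb (Suc j) m) * Lprod (Suc (Suc j)) ls2 * S j"
    unfolding eq by (simp only: mult.assoc)
  also have "\<dots> = A * Lprod 0 ls1 * (T * (Lb j l * Lb (Suc j) m)) * (Lprod (Suc (Suc j)) ls2 * S j)"
    unfolding T1 by (simp only: mult.assoc)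
  also have "\<dots> \<sim>\<^sub>J A * Lprod 0 ls1 * (Lb j m * Lb (Suc j) l * T) * (Lprod (Suc (Suc j)) ls2 * S j)"
    unfolding T_def by (intro cong_left cong_right Lb_swap assms)
  also have "\<dots> = A * Lprod 0 ls1 * (Lb j m * Lb (Suc j) l) * (T * Lprod (Suc (Suc j)) ls2) * S j"
    by (simp only: mult.assoc)
  also have "\<dots> = A * Lprod 0 ls1 * (Lb j m * Lb (Suc j) l) * Lprod (Suc (Suc j)) ls2 * (T * S j)"
    unfolding T2 by (simp only: mult.assoc)
  also have "\<dots> = 0" unfolding TS by simp
  finally have "sc k * (A * Lprod 0 (ls1 @ l # m # ls2) * S j) \<in> J" by (simp add: cong_def)
  then show ?thesis using regular_sc[OF k] unfolding regular_def by blast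
qed

text \<open>Cyclicity is a property of single elements here, since the whole ring does not have it:
  matrices with noncommuting entries cannot be moved around the trace.\<close>

definition cyc :: "nat \<Rightarrow> 'b \<Rightarrow> bool" where
  "cyc n Y \<longleftrightarrow> (\<forall>X. traces 0 n (Y * X) = traces 0 n (X * Y))"

lemma cyc_mult: "cyc n Y \<Longrightarrow> cyc n Z \<Longrightarrow> cyc n (Y * Z)"
  unfolding cyc_def by (metis mult.assoc)

lemma cyc_one: "cyc n 1"
  by (simp add: cyc_def)

lemma traces_diff: "traces k n (X - Y) = traces k n X - traces k n Y"
  by (induction n arbitrary: X Y) (simp_all add: tr_diff)

text \<open>The traces right of the two positions of \<open>R i\<close> let it pass as a local
  operator; the two traces over these positions make it cyclic by \<open>tr_cyclic\<close>, and the
  others see only the result.\<close>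

lemma cyc_R:
  assumes "i + 2 \<le> n"
  shows "cyc n (R i)"
  unfolding cyc_def
proof
  fix X
  obtain p where n: "n = i + (2 + p)" using assms by (metis add.assoc le_add_diff_inverse)
  have "R i \<in> loc (i + 2)" by (rule loc_R)
  then show "traces 0 n (R i * X) = traces 0 n (X * R i)"
    unfolding n traces_add[of 0 i] traces_add[of "0 + i" 2]
    by (simp add: traces_left traces_right numeral_2_eq_2 tr_cyclic)
qed

lemma cyc_Rx:
  assumes "i + 2 \<le> n"
  shows "cyc n (Rx i l m)"
  unfolding cyc_def
proof
  fix X
  have c: "central (x m - x l)" "central (sc (q - inverse q) * x m)"
    by (simp_all add: x_central sc_central)
  have "x m - x l \<in> loc 0" by (intro loc_minus x_loc)
  then have "traces 0 n ((x m - x l) * (R i * X)) = traces 0 n ((x m - x l) * (X * R i))"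
    using cyc_R[OF assms] by (simp add: traces_left cyc_def)
  then show "traces 0 n (Rx i l m * X) = traces 0 n (X * Rx i l m)"
    using centralD[OF c(2), of X] central_left_commute[OF c(1), of X "R i"]
    by (simp add: Rx_def left_diff_distrib right_diff_distrib traces_diff mult.assoc)
qed

lemma cyc_pass_rev: "i + length ms < n \<Longrightarrow> cyc n (pass_rev l ms i)"
  by (induction ms arbitrary: i) (auto intro!: cyc_mult cyc_Rx cyc_one)

lemma cyc_block_pass_rev: "i + length ls + length ms \<le> n \<Longrightarrow> cyc n (block_pass_rev ls ms i)"
  by (induction ls arbitrary: i) (auto intro!: cyc_mult cyc_pass_rev cyc_one)

lemma cyc_sc: "cyc n (sc a)"
  by (simp add: cyc_def centralD[OF sc_central])

lemma cyc_diff: "cyc n X \<Longrightarrow> cyc n Y \<Longrightarrow> cyc n (X - Y)"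
  by (simp add: cyc_def left_diff_distrib right_diff_distrib traces_diff)

lemma cyc_skew: "i + m \<le> n \<Longrightarrow> cyc n (skew i m)"
  by (induction m) (auto intro!: cyc_mult cyc_R cyc_sc cyc_diff cyc_one)

theorem esym_commute:
  assumes "chain ls" "chain ms"
    and cross: "\<And>l m. l \<in> set ls \<Longrightarrow> m \<in> set ms \<Longrightarrow> RE l m \<and> regular (pass_factor l m)"
  shows "esym ls * esym ms \<sim>\<^sub>J esym ms * esym ls"
proof -
  define k where "k = length ls"
  define p where "p = length ms"
  define n where "n = k + p"
  define E where "E = skew_pair k p"
  define E' where "E' = skew_pair p k"
  define F0 where "F0 = block_pass ls ms 0"
  define F1 where "F1 = block_pass_rev ls ms 0"
  obtain z where z: "central z" "regular z" "F0 * F1 = z" "F1 * F0 = z" "z \<in> loc 0"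
    using block_pass_block_pass_rev[of ls ms] cross unfolding F0_def F1_def by blast
  \<comment> \<open>An admissible pair of neighbouring positions lies inside the block of
    \<open>ls\<close> or inside that of \<open>ms\<close>, and its parameters are then
    fusible.\<close>
  have fusible_pos: thesis if "j + 2 \<le> k \<or> k \<le> j \<and> j + 2 \<le> k + p"
      and "\<And>ls1 l m ls2. ls = ls1 @ l # m # ls2 \<Longrightarrow> length ls1 = j \<Longrightarrow> fusible l m \<Longrightarrow> thesis"
      and "\<And>ms1 l m ms2. ms = ms1 @ l # m # ms2 \<Longrightarrow> k + length ms1 = j \<Longrightarrow> fusible l m \<Longrightarrow> thesis" for j thesis
  proof (cases "j + 2 \<le> k")
    case True
    then show ?thesis using chain_split[OF assms(1), of j] that(2) k_def by metis
  next
    case False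
    with that(1) have "k \<le> j" "(j - k) + 2 \<le> length ms" by (auto simp: p_def)
    then show ?thesis using chain_split[OF assms(2), of "j - k"] that(3) by (metis le_add_diff_inverse)
  qed
  have ELL: "E * Lprod 0 (ls @ ms) * E \<sim>\<^sub>J E * Lprod 0 (ls @ ms)"
    unfolding E_def
  proof (rule J_absorb)
    fix j assume j: "j + 2 \<le> k \<or> k \<le> j \<and> j + 2 \<le> k + p"
    from skew_pair_S_zero[OF j] have 0: "skew_pair k p * S j = 0" .
    from j show "skew_pair k p * Lprod 0 (ls @ ms) * S j \<in> J"
    proof (rule fusible_pos)
      fix ls1 l m ls2 assume "ls = ls1 @ l # m # ls2" "length ls1 = j" "fusible l m"
      then show ?thesis using Lprod_absorb[OF 0, of l m ls1 "ls2 @ ms"] by simp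
    next
      fix ms1 l m ms2 assume "ms = ms1 @ l # m # ms2" "k + length ms1 = j" "fusible l m"
      then show ?thesis using Lprod_absorb[OF 0, of l m "ls @ ms1" ms2] by (simp add: k_def)
    qed
  qed
  \<comment> \<open>\<open>F0\<close> reverses the order of the blocks, so \<open>S j\<close> comes
    out at the place of the same pair in the arrangement of \<open>E'\<close>, which annihilates it
    there.\<close>
  have EF: "E' * F0 * E \<sim>\<^sub>J E' * F0"
    unfolding E_def
  proof (rule J_absorb)
    fix j assume j: "j + 2 \<le> k \<or> k \<le> j \<and> j + 2 \<le> k + p"
    then show "E' * F0 * S j \<in> J"
    proof (rule fusible_pos)
      fix ls1 l m ls2 assume *: "ls = ls1 @ l # m # ls2" "length ls1 = j" "fusible l m"
      then have "F0 * S j = S (p + j) * block_pass (ls1 @ m # l # ls2) ms 0"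
        using block_pass_S_left[of l m ls1 ls2 ms 0] by (simp add: F0_def p_def fusible_def)
      moreover have "E' * S (p + j) = 0"
        unfolding E'_def by (rule skew_pair_S_zero) (use * k_def in auto)
      ultimately show ?thesis by (metis J_0 mult.assoc mult_zero_left)
    next
      fix ms1 l m ms2 assume *: "ms = ms1 @ l # m # ms2" "k + length ms1 = j" "fusible l m"
      then have "F0 * S j = S (length ms1) * block_pass ls (ms1 @ m # l # ms2) 0"
        using block_pass_S_right[of l m ls ms1 ms2 0] by (simp add: F0_def k_def fusible_def)
      moreover have "E' * S (length ms1) = 0"
        unfolding E'_def by (rule skew_pair_S_zero) (use * p_def in auto)
      ultimately show ?thesis by (metis J_0 mult.assoc mult_zero_left)
    qed
  qed
  have EF': "E * F1 * E' \<sim>\<^sub>J E * F1"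
    unfolding E'_def
  proof (rule J_absorb)
    fix j assume j: "j + 2 \<le> p \<or> p \<le> j \<and> j + 2 \<le> p + k"
    show "E * F1 * S j \<in> J"
    proof (cases "j + 2 \<le> p")
      case True
      then obtain ms1 l m ms2 where *: "ms = ms1 @ l # m # ms2" "length ms1 = j" "fusible l m"
        using chain_split[OF assms(2)] p_def by metis
      then have "F1 * S j = S (k + j) * block_pass_rev ls (ms1 @ m # l # ms2) 0"
        using block_pass_rev_S_right[of l m ls ms1 ms2 0] by (simp add: F1_def k_def fusible_def)
      moreover have "E * S (k + j) = 0"
        unfolding E_def by (rule skew_pair_S_zero) (use * p_def in auto)
      ultimately show ?thesis by (metis J_0 mult.assoc mult_zero_left)
    next
      case False
      with j obtain ls1 l m ls2 where *: "ls = ls1 @ l # m # ls2" "length ls1 = j - p" "fusible l m"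
        using chain_split[OF assms(1), of "j - p"] k_def by (metis Nat.add_diff_assoc2 add.commute le_diff_conv)
      then have "F1 * S j = S (j - p) * block_pass_rev (ls1 @ m # l # ls2) ms 0"
        using block_pass_rev_S_left[of l m ls1 ls2 ms 0] False j by (simp add: F1_def p_def fusible_def)
      moreover have "E * S (j - p) = 0"
        unfolding E_def by (rule skew_pair_S_zero) (use * k_def in auto)
      ultimately show ?thesis by (metis J_0 mult.assoc mult_zero_left)
    qed
  qed
  have EE: "E * E \<sim>\<^sub>J E"
    unfolding E_def by (rule J_absorb) (simp add: skew_pair_S_zero J_0)
  have key: "E * F1 * E' * F0 * E \<sim>\<^sub>J z * E"
  proof -
    have "E * F1 * E' * (F0 * E) \<sim>\<^sub>J E * F1 * (F0 * E)" by (intro cong_right EF')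
    also have "\<dots> = E * (F1 * F0) * E" by (simp only: mult.assoc)
    also have "\<dots> = z * (E * E)" unfolding z using centralD[OF z(1), of E] by (simp add: mult.assoc)
    also have "\<dots> \<sim>\<^sub>J z * E" by (intro cong_left EE)
    finally show ?thesis by (simp only: mult.assoc)
  qed
  \<comment> \<open>\<open>E * F1\<close> contains no generating matrix, so it is the factor that
    may be moved around the trace.\<close>
  have cycEF: "cyc n (E * F1)" "cyc n E"
    unfolding E_def skew_pair_def F1_def n_def k_def p_def by (intro cyc_mult cyc_skew cyc_block_pass_rev; simp)+
  let ?L = "Lprod 0 (ls @ ms)" and ?L' = "Lprod 0 (ms @ ls)"
  have FL: "F0 * ?L \<sim>\<^sub>J ?L' * F0"
    using block_pass_Lprod[of ls ms 0] cross by (simp add: F0_def Lprod_append)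
  have "z * traces 0 n (E' * ?L') = traces 0 n (E' * (?L' * F0) * F1)"
  proof -
    have "z * traces 0 n (E' * ?L') = traces 0 n (E' * ?L' * z)"
      using z(5) by (simp add: centralD[OF z(1)] traces_left)
    then show ?thesis unfolding z(3)[symmetric] by (simp only: mult.assoc)
  qed
  also have "\<dots> \<sim>\<^sub>J traces 0 n (E' * (F0 * ?L) * F1)"
    by (intro traces_cong cong_left cong_right cong_sym[OF FL])
  also have "E' * (F0 * ?L) * F1 = (E' * F0) * (?L * F1)" by (simp only: mult.assoc)
  also have "traces 0 n ((E' * F0) * (?L * F1)) \<sim>\<^sub>J traces 0 n ((E' * F0 * E) * (?L * F1))"
    by (intro traces_cong cong_right cong_sym[OF EF])
  also have "(E' * F0 * E) * (?L * F1) = E' * F0 * (E * ?L) * F1" by (simp only: mult.assoc)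
  also have "traces 0 n (E' * F0 * (E * ?L) * F1) \<sim>\<^sub>J traces 0 n (E' * F0 * (E * ?L * E) * F1)"
    by (intro traces_cong cong_right cong_left cong_sym[OF ELL])
  also have "E' * F0 * (E * ?L * E) * F1 = (E' * F0 * E * ?L) * (E * F1)" by (simp only: mult.assoc)
  also have "traces 0 n ((E' * F0 * E * ?L) * (E * F1)) = traces 0 n ((E * F1) * (E' * F0 * E * ?L))"
    using cycEF(1) unfolding cyc_def by simp
  also have "(E * F1) * (E' * F0 * E * ?L) = (E * F1 * E' * F0 * E) * ?L" by (simp only: mult.assoc)
  also have "traces 0 n ((E * F1 * E' * F0 * E) * ?L) \<sim>\<^sub>J traces 0 n (z * E * ?L)"
    by (intro traces_cong cong_right key)
  also have "traces 0 n (z * E * ?L) = z * traces 0 n (E * ?L)"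
    using z(5) by (simp add: traces_left mult.assoc)
  finally have "traces 0 n (E' * ?L') \<sim>\<^sub>J traces 0 n (E * ?L)"
    by (rule regular_cong[OF z(2)])
  moreover have "traces 0 n (E * ?L) = esym ls * esym ms"
    unfolding E_def n_def k_def p_def by (rule esym_mult)
  moreover have "traces 0 n (E' * ?L') = esym ms * esym ls"
    using esym_mult[of ms ls] by (simp add: E'_def n_def k_def p_def add.commute)
  ultimately show ?thesis by (metis cong_sym)
qed

end

section \<open>Operators on the infinite tensor power\<close>

text \<open>
  Row-finite matrices over the index set \<open>nat \<Rightarrow> 'n\<close> contain the operators on all tensor powers of
  \<open>V\<close> at once, and unlike the functions of type \<open>tmat\<close> they form a \<open>ring_1\<close>.
\<close>

typedef (overloaded) ('i, 'a) rfmat = "{X :: 'i \<Rightarrow> 'i \<Rightarrow> 'a::zero. \<forall>i. finite {j. X i j \<noteq> 0}}"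
  morphisms entry Rfmat
  by (rule exI[of _ "\<lambda>_ _. 0"]) simp

lemma finite_row: "finite {j. entry X i j \<noteq> 0}"
  using entry[of X] by simp

lemma entry_Rfmat: "(\<And>i. finite {j. X i j \<noteq> 0}) \<Longrightarrow> entry (Rfmat X) = X"
  by (simp add: Rfmat_inverse)

lemma rfmat_eqI: "(\<And>i j. entry X i j = entry Y i j) \<Longrightarrow> X = Y"
  by (simp add: entry_inject[symmetric] fun_eq_iff)

instantiation rfmat :: (type, ring_1) ring_1
begin

definition "0 = Rfmat (\<lambda>_ _. 0)"
definition "1 = Rfmat (\<lambda>i j. if i = j then 1 else 0)"
definition "X + Y = Rfmat (\<lambda>i j. entry X i j + entry Y i j)"
definition "- X = Rfmat (\<lambda>i j. - entry X i j)"
definition "X - Y = Rfmat (\<lambda>i j. entry X i j - entry Y i j)"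
definition "X * Y = Rfmat (\<lambda>i j. \<Sum>l | entry X i l \<noteq> 0. entry X i l * entry Y l j)"

lemma entry_zero [simp]: "entry 0 i j = 0"
  by (simp add: zero_rfmat_def entry_Rfmat)

lemma entry_one: "entry 1 i j = (if i = j then 1 else 0)"
  by (simp add: one_rfmat_def entry_Rfmat)

lemma entry_add [simp]: "entry (X + Y) i j = entry X i j + entry Y i j"
proof -
  have "finite {j. entry X i j + entry Y i j \<noteq> 0}" for i
    by (rule finite_subset[OF _ finite_UnI[OF finite_row[of X i] finite_row[of Y i]]]) auto
  then show ?thesis by (simp add: plus_rfmat_def entry_Rfmat)
qed

lemma entry_uminus [simp]: "entry (- X) i j = - entry X i j"
  by (simp add: uminus_rfmat_def entry_Rfmat finite_row)

lemma entry_diff [simp]: "entry (X - Y) i j = entry X i j - entry Y i j"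
proof -
  have "finite {j. entry X i j - entry Y i j \<noteq> 0}" for i
    by (rule finite_subset[OF _ finite_UnI[OF finite_row[of X i] finite_row[of Y i]]]) auto
  then show ?thesis by (simp add: minus_rfmat_def entry_Rfmat)
qed

lemma entry_mult: "entry (X * Y) i j = (\<Sum>l | entry X i l \<noteq> 0. entry X i l * entry Y l j)"
proof -
  have "finite {j. (\<Sum>l | entry X i l \<noteq> 0. entry X i l * entry Y l j) \<noteq> 0}" for i
  proof (rule finite_subset)
    show "finite (\<Union>l\<in>{l. entry X i l \<noteq> 0}. {j. entry Y l j \<noteq> 0})"
      by (simp add: finite_row)
    show "{j. (\<Sum>l | entry X i l \<noteq> 0. entry X i l * entry Y l j) \<noteq> 0}
        \<subseteq> (\<Union>l\<in>{l. entry X i l \<noteq> 0}. {j. entry Y l j \<noteq> 0})"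
    proof
      fix j assume "j \<in> {j. (\<Sum>l | entry X i l \<noteq> 0. entry X i l * entry Y l j) \<noteq> 0}"
      then obtain l where "entry X i l \<noteq> 0" "entry X i l * entry Y l j \<noteq> 0"
        by (metis (mono_tags, lifting) mem_Collect_eq sum.neutral)
      then show "j \<in> (\<Union>l\<in>{l. entry X i l \<noteq> 0}. {j. entry Y l j \<noteq> 0})" by auto
    qed
  qed
  then show ?thesis by (simp add: times_rfmat_def entry_Rfmat)
qed

text \<open>The range of summation in a product is the support of a row, which varies with the
  factor. Any finite set containing the nonzero terms may replace it.\<close>

lemma entry_mult_superset:
  assumes "finite T" "\<And>l. entry X i l * entry Y l j \<noteq> 0 \<Longrightarrow> l \<in> T"
  shows "entry (X * Y) i j = (\<Sum>l\<in>T. entry X i l * entry Y l j)"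
proof -
  have "entry (X * Y) i j = (\<Sum>l | entry X i l * entry Y l j \<noteq> 0. entry X i l * entry Y l j)"
    unfolding entry_mult by (rule sum.mono_neutral_right) (auto simp: finite_row)
  also have "\<dots> = (\<Sum>l\<in>T. entry X i l * entry Y l j)"
    by (rule sum.mono_neutral_left) (use assms in auto)
  finally show ?thesis .
qed

instance
proof
  fix X Y Z :: "('a, 'b) rfmat"
  show "X * Y * Z = X * (Y * Z)"
  proof (rule rfmat_eqI)
    fix i j
    let ?A = "{l. entry X i l \<noteq> 0}" and ?T = "\<Union>l\<in>{l. entry X i l \<noteq> 0}. {m. entry Y l m \<noteq> 0}"
    have T: "finite ?T" by (simp add: finite_row)
    have in_T: "m \<in> ?T" if nz: "entry (X * Y) i m \<noteq> 0" for m
    proof -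
      obtain l where "entry X i l \<noteq> 0" "entry X i l * entry Y l m \<noteq> 0"
        using nz unfolding entry_mult by (metis (mono_tags, lifting) mem_Collect_eq sum.neutral)
      then show ?thesis by auto
    qed
    have "entry (X * Y * Z) i j = (\<Sum>m\<in>?T. entry (X * Y) i m * entry Z m j)"
      by (rule entry_mult_superset[OF T], rule in_T) auto
    also have "\<dots> = (\<Sum>m\<in>?T. \<Sum>l\<in>?A. entry X i l * (entry Y l m * entry Z m j))"
      by (simp add: entry_mult sum_distrib_right mult.assoc)
    also have "\<dots> = (\<Sum>l\<in>?A. \<Sum>m\<in>?T. entry X i l * (entry Y l m * entry Z m j))"
      by (rule sum.swap)
    also have "\<dots> = (\<Sum>l\<in>?A. entry X i l * entry (Y * Z) l j)"
    proof (rule sum.cong[OF refl])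
      fix l assume l: "l \<in> ?A"
      have "entry (Y * Z) l j = (\<Sum>m\<in>?T. entry Y l m * entry Z m j)"
        by (rule entry_mult_superset[OF T]) (use l in auto)
      then show "(\<Sum>m\<in>?T. entry X i l * (entry Y l m * entry Z m j)) = entry X i l * entry (Y * Z) l j"
        by (simp add: sum_distrib_left)
    qed
    finally show "entry (X * Y * Z) i j = entry (X * (Y * Z)) i j"
      by (simp only: entry_mult[of X "Y * Z"])
  qed
  show "1 * X = X"
    by (rule rfmat_eqI, subst entry_mult_superset[of "{i}" for i]) (auto simp: entry_one split: if_splits)
  show "X * 1 = X"
  proof (rule rfmat_eqI)
    fix i j
    show "entry (X * 1) i j = entry X i j"
      by (subst entry_mult_superset[of "{j}"]) (auto simp: entry_one split: if_splits)
  qed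
  show "(X + Y) * Z = X * Z + Y * Z"
  proof (rule rfmat_eqI)
    fix i j
    let ?T = "{l. entry X i l \<noteq> 0} \<union> {l. entry Y i l \<noteq> 0}"
    have T: "finite ?T" by (simp add: finite_row)
    show "entry ((X + Y) * Z) i j = entry (X * Z + Y * Z) i j"
      unfolding entry_add
      by (subst (1 2 3) entry_mult_superset[OF T]) (auto simp: sum.distrib distrib_right)
  qed
  show "X * (Y + Z) = X * Y + X * Z"
    by (rule rfmat_eqI) (simp add: entry_mult distrib_left sum.distrib)
  show "(0::('a, 'b) rfmat) \<noteq> 1"
  proof
    assume "(0::('a, 'b) rfmat) = 1"
    then have "entry (0::('a, 'b) rfmat) i i = entry 1 i i" for i by simp
    then show False by (simp add: entry_one)
  qed
qed (rule rfmat_eqI, simp add: algebra_simps)+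

end

section \<open>Operators acting in a window of positions\<close>

definition replace :: "nat \<Rightarrow> (nat \<Rightarrow> 'n) \<Rightarrow> 'n list \<Rightarrow> nat \<Rightarrow> 'n" where
  "replace i r l = (\<lambda>s. if i \<le> s \<and> s < i + length l then l ! (s - i) else r s)"

abbreviation window :: "nat \<Rightarrow> nat \<Rightarrow> (nat \<Rightarrow> 'n) \<Rightarrow> 'n list" where
  "window i K r \<equiv> map r [i..<i + K]"

definition agree_off :: "nat \<Rightarrow> nat \<Rightarrow> (nat \<Rightarrow> 'n) \<Rightarrow> (nat \<Rightarrow> 'n) \<Rightarrow> bool" where
  "agree_off i K r c \<longleftrightarrow> (\<forall>s. i \<le> s \<and> s < i + K \<or> r s = c s)"

lemma window_replace [simp]: "length l = K \<Longrightarrow> window i K (replace i r l) = l"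
  by (rule nth_equalityI) (simp_all add: replace_def)

lemma agree_off_iff: "agree_off i K r c \<longleftrightarrow> c = replace i r (window i K c)"
proof
  assume h: "c = replace i r (window i K c)"
  show "agree_off i K r c"
    unfolding agree_off_def
  proof
    fix s
    show "i \<le> s \<and> s < i + K \<or> r s = c s"
      using fun_cong[OF h, of s] by (auto simp: replace_def)
  qed
qed (auto simp: agree_off_def replace_def fun_eq_iff)

lemma agree_off_sym: "agree_off i K r c \<longleftrightarrow> agree_off i K c r"
  unfolding agree_off_def by metis

lemma agree_off_iff2: "agree_off i K r c \<longleftrightarrow> r = replace i c (window i K r)"
  using agree_off_iff agree_off_sym by metis

lemma agree_off_replace [simp]: 
  "length l = K \<Longrightarrow> agree_off i K (replace i r l) c \<longleftrightarrow> agree_off i K r c"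
  "length l = K \<Longrightarrow> agree_off i K r (replace i c l) \<longleftrightarrow> agree_off i K r c"
  by (auto simp: agree_off_def replace_def)

lemma agree_off_refl [simp]: "agree_off i K r r"
  by (simp add: agree_off_def)

lemma agree_off_replace_self [simp]:
  "length l = K \<Longrightarrow> agree_off i K r (replace i r l)"
  "length l = K \<Longrightarrow> agree_off i K (replace i r l) r"
  by (auto simp: agree_off_def replace_def)

lemma finite_lists [simp]: "finite {l :: 'n::finite list. length l = K}"
  using finite_lists_length_eq[of "UNIV :: 'n set" K] by simp

lemma inj_replace: "inj_on (replace i r) {l. length l = K}"
  by (rule inj_onI) (metis (mono_tags, lifting) mem_Collect_eq window_replace)

lemma finite_agree_off: "finite {c :: nat \<Rightarrow> 'n::finite. agree_off i K r c}"
proof (rule finite_subset)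
  show "{c. agree_off i K r c} \<subseteq> replace i r ` {l. length l = K}"
    using agree_off_iff[of i K r] by (auto intro!: image_eqI[of _ _ "window i K x" for x])
qed simp

text \<open>The operator \<open>f\<close> in the positions \<open>i, ..., i + K - 1\<close> and the
  identity in all others. Each row then has finitely many nonzero entries, since only the window can
  change.\<close>

definition embed :: "nat \<Rightarrow> nat \<Rightarrow> ('n::finite, 'a::zero) tmat \<Rightarrow> (nat \<Rightarrow> 'n, 'a) rfmat" where
  "embed i K f = Rfmat (\<lambda>r c. if agree_off i K r c then f (window i K r) (window i K c) else 0)"

lemma entry_embed: "entry (embed i K f) r c = (if agree_off i K r c then f (window i K r) (window i K c) else 0)"
  unfolding embed_def
  by (subst entry_Rfmat) (auto intro: finite_subset[OF _ finite_agree_off])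

lemma entry_embed_mult:
  fixes X :: "(nat \<Rightarrow> 'n::finite, 'a::ring_1) rfmat"
  shows "entry (embed i K f * X) r c = (\<Sum>l | length l = K. f (window i K r) l * entry X (replace i r l) c)"
proof -
  have "entry (embed i K f * X) r c = (\<Sum>m\<in>replace i r ` {l. length l = K}. entry (embed i K f) r m * entry X m c)"
  proof (rule entry_mult_superset)
    fix m assume "entry (embed i K f) r m * entry X m c \<noteq> 0"
    then have "agree_off i K r m" by (auto simp: entry_embed split: if_splits)
    then show "m \<in> replace i r ` {l. length l = K}"
      using agree_off_iff[of i K r m] by (auto intro!: image_eqI[of _ _ "window i K m"])
  qed simp
  also have "\<dots> = (\<Sum>l | length l = K. entry (embed i K f) r (replace i r l) * entry X (replace i r l) c)"
    by (simp add: sum.reindex[OF inj_replace])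
  also have "\<dots> = (\<Sum>l | length l = K. f (window i K r) l * entry X (replace i r l) c)"
    by (rule sum.cong) (auto simp: entry_embed)
  finally show ?thesis .
qed

lemma entry_mult_embed:
  fixes X :: "(nat \<Rightarrow> 'n::finite, 'a::ring_1) rfmat"
  shows "entry (X * embed i K f) r c = (\<Sum>l | length l = K. entry X r (replace i c l) * f l (window i K c))"
proof -
  have "entry (X * embed i K f) r c = (\<Sum>m\<in>replace i c ` {l. length l = K}. entry X r m * entry (embed i K f) m c)"
  proof (rule entry_mult_superset)
    fix m assume "entry X r m * entry (embed i K f) m c \<noteq> 0"
    then have "agree_off i K m c" by (auto simp: entry_embed split: if_splits)
    then show "m \<in> replace i c ` {l. length l = K}"
      using agree_off_iff2[of i K m c] by (auto intro!: image_eqI[of _ _ "window i K m"])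
  qed simp
  also have "\<dots> = (\<Sum>l | length l = K. entry X r (replace i c l) * entry (embed i K f) (replace i c l) c)"
    by (simp add: sum.reindex[OF inj_replace])
  also have "\<dots> = (\<Sum>l | length l = K. entry X r (replace i c l) * f l (window i K c))"
    by (rule sum.cong) (auto simp: entry_embed)
  finally show ?thesis .
qed

lemma embed_eqI:
  assumes "\<And>r c. length r = K \<Longrightarrow> length c = K \<Longrightarrow> f r c = g r c"
  shows "embed i K f = embed i K g"
  by (rule rfmat_eqI) (simp add: entry_embed assms)

lemma embed_tmul: "embed i K (tmul K f g) = embed i K f * embed i K (g :: ('n::finite, 'a::ring_1) tmat)"
  by (rule rfmat_eqI) (simp add: entry_embed_mult entry_embed tmul_def sum_distrib_left)

lemma embed_tone: "embed i K (tone K) = (1 :: (nat \<Rightarrow> 'n::finite, 'a::ring_1) rfmat)"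
proof (rule rfmat_eqI)
  fix r c :: "nat \<Rightarrow> 'n"
  have "agree_off i K r c \<and> window i K r = window i K c \<longleftrightarrow> r = c"
    by (simp add: agree_off_def fun_eq_iff) (metis atLeastLessThan_iff)
  then show "entry (embed i K (tone K) :: (nat \<Rightarrow> 'n, 'a) rfmat) r c = entry 1 r c"
    by (auto simp: entry_embed tone_def entry_one)
qed

lemma embed_tdiff: "embed i K (tdiff f g) = embed i K f - embed i K (g :: ('n::finite, 'a::ring_1) tmat)"
  by (rule rfmat_eqI) (simp add: entry_embed tdiff_def)

text \<open>A scalar is an operator on the empty window; it is named \<open>smat\<close>
  below.\<close>

lemma embed_tscale: "embed i K (tscale a f) = embed 0 0 (\<lambda>_ _. a) * embed i K (f :: ('n::finite, 'a::ring_1) tmat)"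
  by (rule rfmat_eqI) (simp add: entry_embed_mult, simp add: entry_embed tscale_def replace_def)


text \<open>Tensoring with identities on either side does not change the operator on the infinite
  power. This identifies one operator seen in different finite tensor powers.\<close>

lemma embed_extend:
  fixes f :: "('n::finite, 'a::ring_1) tmat"
  assumes "s + K \<le> K'"
    and "\<And>r c. length r = K' \<Longrightarrow> length c = K' \<Longrightarrow> g r c =
      (if \<forall>t<K'. s \<le> t \<and> t < s + K \<or> r ! t = c ! t then f (take K (drop s r)) (take K (drop s c)) else 0)"
  shows "embed i K' g = embed (i + s) K f"
proof (rule rfmat_eqI)
  fix r c :: "nat \<Rightarrow> 'n"
  have 1: "take K (drop s (window i K' x)) = window (i + s) K x" for x :: "nat \<Rightarrow> 'n"
    by (rule nth_equalityI) (use assms(1) in \<open>auto simp: add.assoc\<close>)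
  have 2: "agree_off i K' r c \<and> (\<forall>t<K'. s \<le> t \<and> t < s + K \<or> r (i + t) = c (i + t)) \<longleftrightarrow> agree_off (i + s) K r c"
    (is "?A \<longleftrightarrow> ?B")
  proof
    assume A: ?A
    show ?B unfolding agree_off_def
    proof
      fix u
      show "i + s \<le> u \<and> u < i + s + K \<or> r u = c u"
      proof (cases "i \<le> u \<and> u < i + K'")
        case True
        then obtain t where "u = i + t" using le_Suc_ex by blast
        then show ?thesis using A[THEN conjunct2, rule_format, of t] True by auto
      next
        case False
        then show ?thesis using A by (auto simp: agree_off_def)
      qed
    qed
  next
    assume B: ?B
    show ?A
    proof
      show "agree_off i K' r c"
        unfolding agree_off_def
      proof
        fix u
        show "i \<le> u \<and> u < i + K' \<or> r u = c u"
          using B[unfolded agree_off_def, rule_format, of u] assms(1) by auto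
      qed
      show "\<forall>t<K'. s \<le> t \<and> t < s + K \<or> r (i + t) = c (i + t)"
      proof (intro allI impI)
        fix t
        show "s \<le> t \<and> t < s + K \<or> r (i + t) = c (i + t)"
          using B[unfolded agree_off_def, rule_format, of "i + t"] by auto
      qed
    qed
  qed
  show "entry (embed i K' g) r c = entry (embed (i + s) K f) r c"
    unfolding entry_embed 2[symmetric] by (auto simp: assms(2) 1 simp del: drop_map take_map)
qed

lemma at2_pair: "at2 2 1 S [a, b] [c, d] = S $ (a, b) $ (c, d)"
  by (auto simp: at2_def dest!: less_2_cases)

lemma at1_single: "at1 1 1 M [a] [b] = M $ a $ b"
  by (auto simp: at1_def)

lemma embed_at2:
  fixes S :: "'a::ring_1 ^ ('n::finite \<times> 'n) ^ ('n \<times> 'n)"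
  assumes "s + 2 \<le> K"
  shows "embed i K (at2 K (Suc s) S) = embed (i + s) 2 (at2 2 1 S)"
proof (rule embed_extend[OF assms])
  fix r c :: "'n list" assume l: "length r = K" "length c = K"
  have *: "take 2 (drop s x) = [x ! s, x ! Suc s]" if "length x = K" for x :: "'n list"
    by (rule nth_equalityI) (use assms that in \<open>auto simp: less_Suc_eq numeral_2_eq_2\<close>)
  have pos: "s \<le> t \<and> t < s + 2 \<longleftrightarrow> t = s \<or> t = Suc s" for t by auto
  have "(\<forall>t<K. t \<noteq> s \<and> t \<noteq> Suc s \<longrightarrow> r ! t = c ! t) \<longleftrightarrow> (\<forall>t<K. s \<le> t \<and> t < s + 2 \<or> r ! t = c ! t)"
    unfolding pos by blast
  then show "at2 K (Suc s) S r c = (if \<forall>t<K. s \<le> t \<and> t < s + 2 \<or> r ! t = c ! t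
         then at2 2 1 S (take 2 (drop s r)) (take 2 (drop s c)) else 0)"
    unfolding *[OF l(1)] *[OF l(2)] at2_pair by (simp add: at2_def l) auto
qed

lemma embed_at1:
  fixes M :: "'a::ring_1 ^ 'n::finite ^ 'n"
  assumes "s + 1 \<le> K"
  shows "embed i K (at1 K (Suc s) M) = embed (i + s) 1 (at1 1 1 M)"
proof (rule embed_extend[OF assms])
  fix r c :: "'n list" assume l: "length r = K" "length c = K"
  have *: "take 1 (drop s x) = [x ! s]" if "length x = K" for x :: "'n list"
    by (rule nth_equalityI) (use assms that in auto)
  have pos: "s \<le> t \<and> t < s + 1 \<longleftrightarrow> t = s" for t by auto
  have "(\<forall>t<K. t \<noteq> s \<longrightarrow> r ! t = c ! t) \<longleftrightarrow> (\<forall>t<K. s \<le> t \<and> t < s + 1 \<or> r ! t = c ! t)"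
    unfolding pos by blast
  then show "at1 K (Suc s) M r c = (if \<forall>t<K. s \<le> t \<and> t < s + 1 \<or> r ! t = c ! t
         then at1 1 1 M (take 1 (drop s r)) (take 1 (drop s c)) else 0)"
    unfolding *[OF l(1)] *[OF l(2)] at1_single by (simp add: at1_def l) auto
qed

text \<open>The windows are disjoint, so in either product a single intermediate index contributes,
  and the two contributions differ only in the order of the entries. Hence the centrality of those
  of \<open>f\<close>.\<close>

lemma embed_commute:
  fixes f g :: "('n::finite, 'a::ring_1) tmat"
  assumes "\<And>r c z. f r c * z = z * f r c"
  shows "embed i K f * embed 0 i g = embed 0 i g * embed i K f"
proof (rule rfmat_eqI)
  fix r c :: "nat \<Rightarrow> 'n"
  let ?v = "if agree_off 0 (i + K) r c then f (window i K r) (window i K c) * g (window 0 i r) (window 0 i c) else 0"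
  have 0: "map (replace i r l) [0..<i] = map r [0..<i]" for r :: "nat \<Rightarrow> 'n" and l
    by (simp add: replace_def)
  have 1: "agree_off 0 i (replace i r l) c \<longleftrightarrow> agree_off 0 (i + K) r c \<and> l = window i K c" if "length l = K"
    for r c :: "nat \<Rightarrow> 'n" and l
  proof
    assume h: "agree_off 0 i (replace i r l) c"
    have "l ! t = c (i + t)" if "t < K" for t
      using h[unfolded agree_off_def, rule_format, of "i + t"] that \<open>length l = K\<close> by (simp add: replace_def)
    then have "l = window i K c"
      using that by (intro nth_equalityI) auto
    moreover have "agree_off 0 (i + K) r c"
      unfolding agree_off_def
    proof
      fix u
      show "0 \<le> u \<and> u < 0 + (i + K) \<or> r u = c u"
        using h[unfolded agree_off_def, rule_format, of u] that by (auto simp: replace_def split: if_splits)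
    qed
    ultimately show "agree_off 0 (i + K) r c \<and> l = window i K c" by simp
  next
    assume "agree_off 0 (i + K) r c \<and> l = window i K c"
    then show "agree_off 0 i (replace i r l) c" by (auto simp: agree_off_def replace_def)
  qed
  have 2: "agree_off 0 i r (replace i c l) \<longleftrightarrow> agree_off 0 (i + K) r c \<and> l = window i K r" if "length l = K" for l
    using 1[OF that, of c r] agree_off_sym by metis
  have "entry (embed i K f * embed 0 i g) r c = (\<Sum>l | length l = K. if l = window i K c then ?v else 0)"
    unfolding entry_embed_mult entry_embed by (rule sum.cong) (auto simp: 0 1)
  moreover have "entry (embed 0 i g * embed i K f) r c = (\<Sum>l | length l = K. if l = window i K r then ?v else 0)"
    unfolding entry_mult_embed entry_embed by (rule sum.cong) (auto simp: 0 2 assms)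
  ultimately show "entry (embed i K f * embed 0 i g) r c = entry (embed 0 i g * embed i K f) r c"
    by (simp add: sum.delta)
qed

lemma sum_lists_2: "(\<Sum>l | length l = 2. f l) = (\<Sum>p\<in>UNIV. f [fst p, snd p])"
  for f :: "'n::finite list \<Rightarrow> 'a::comm_monoid_add"
  by (rule sum.reindex_bij_witness[of _ "\<lambda>p. [fst p, snd p]" "\<lambda>l. (l ! 0, l ! 1)"])
    (auto simp: length_Suc_conv numeral_2_eq_2)

lemma sum_lists_1: "(\<Sum>l | length l = 1. f l) = (\<Sum>b\<in>UNIV. f [b])"
  for f :: "'n::finite list \<Rightarrow> 'a::comm_monoid_add"
  by (rule sum.reindex_bij_witness[of _ "\<lambda>b. [b]" "\<lambda>l. l ! 0"]) (auto simp: length_Suc_conv)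

lemma sum_UNIV_prod: "(\<Sum>p\<in>UNIV. f p) = (\<Sum>a\<in>UNIV. \<Sum>b\<in>UNIV. f (a, b))"
  for f :: "'m::finite \<times> 'n::finite \<Rightarrow> 'a::comm_monoid_add"
  by (simp add: sum.cartesian_product UNIV_Times_UNIV[symmetric] del: UNIV_Times_UNIV)

definition op2 :: "nat \<Rightarrow> 'a::ring_1 ^ ('n::finite \<times> 'n) ^ ('n \<times> 'n) \<Rightarrow> (nat \<Rightarrow> 'n, 'a) rfmat" where
  "op2 i S = embed i 2 (at2 2 1 S)"

definition op1 :: "nat \<Rightarrow> 'a::ring_1 ^ 'n::finite ^ 'n \<Rightarrow> (nat \<Rightarrow> 'n, 'a) rfmat" where
  "op1 i M = embed i 1 (at1 1 1 M)"

definition smat :: "'a::ring_1 \<Rightarrow> (nat \<Rightarrow> 'n::finite, 'a) rfmat" where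
  "smat t = embed 0 0 (\<lambda>_ _. t)"

lemma replace_2: "replace i r [a, b] = r(i := a, Suc i := b)"
  by (auto simp: replace_def fun_eq_iff nth_Cons split: nat.splits)

lemma replace_1: "replace i r [a] = r(i := a)"
  by (auto simp: replace_def fun_eq_iff)

lemma window_2: "window i 2 r = [r i, r (Suc i)]"
  by (simp add: numeral_2_eq_2)

lemma window_1: "window i 1 r = [r i]"
  by simp

lemma entry_op2_mult: "entry (op2 i S * X) r c = (\<Sum>p\<in>UNIV. S $ (r i, r (Suc i)) $ p * entry X (r(i := fst p, Suc i := snd p)) c)"
  unfolding op2_def entry_embed_mult sum_lists_2 window_2 replace_2 at2_pair by simp

lemma entry_mult_op2: "entry (X * op2 i S) r c = (\<Sum>p\<in>UNIV. entry X r (c(i := fst p, Suc i := snd p)) * S $ p $ (c i, c (Suc i)))"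
  unfolding op2_def entry_mult_embed sum_lists_2 window_2 replace_2 at2_pair by simp

lemma entry_op1_mult: "entry (op1 i M * X) r c = (\<Sum>b\<in>UNIV. M $ (r i) $ b * entry X (r(i := b)) c)"
  unfolding op1_def entry_embed_mult sum_lists_1 window_1 replace_1 at1_single by simp

lemma entry_op2: "entry (op2 i S) r c = (if agree_off i 2 r c then S $ (r i, r (Suc i)) $ (c i, c (Suc i)) else 0)"
  unfolding op2_def entry_embed window_2 at2_pair by simp

lemma entry_smat_mult [simp]: "entry (smat t * X) r c = t * entry X r c"
  unfolding smat_def entry_embed_mult by (simp add: replace_def)

lemma entry_mult_smat [simp]: "entry (X * smat t) r c = entry X r c * t"
  unfolding smat_def entry_mult_embed by (simp add: replace_def)

lemma entry_smat: "entry (smat t) r c = (if r = c then t else 0)"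
  by (auto simp: smat_def entry_embed agree_off_def fun_eq_iff)

lemma op2_mult: "op2 i (S ** T) = (op2 i S * op2 i T :: (nat \<Rightarrow> 'n::finite, 'a::ring_1) rfmat)"
proof (rule rfmat_eqI)
  fix r c :: "nat \<Rightarrow> 'n"
  have *: "agree_off i 2 (r(i := a, Suc i := b)) c \<longleftrightarrow> agree_off i 2 r c" for a b
    using agree_off_replace(1)[of "[a, b]" 2 i r c] by (simp add: replace_2)
  show "entry (op2 i (S ** T)) r c = entry (op2 i S * op2 i T) r c"
    unfolding entry_op2_mult by (simp add: entry_op2 * matrix_matrix_mult_def)
qed

lemma op2_diff: "op2 i (S - T) = op2 i S - op2 i T"
  by (rule rfmat_eqI) (simp add: entry_op2)

lemma op2_mat: "op2 i (mat a) = (smat a :: (nat \<Rightarrow> 'n::finite, 'a::ring_1) rfmat)"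
proof (rule rfmat_eqI)
  fix r c :: "nat \<Rightarrow> 'n"
  have "i \<le> s \<and> s < i + 2 \<longleftrightarrow> s = i \<or> s = Suc i" for s by auto
  then have "agree_off i 2 r c \<and> r i = c i \<and> r (Suc i) = c (Suc i) \<longleftrightarrow> r = c"
    unfolding agree_off_def fun_eq_iff by metis
  then show "entry (op2 i (mat a)) r c = entry (smat a) r c"
    by (auto simp: entry_op2 entry_smat mat_def)
qed

section \<open>Operators on the first positions and partial traces\<close>

definition loc :: "nat \<Rightarrow> (nat \<Rightarrow> 'n::finite, 'a::ring_1) rfmat set" where
  "loc K = range (embed 0 K)"

lemma loc_mono: "i \<le> j \<Longrightarrow> loc i \<subseteq> loc j"
proof
  fix X :: "(nat \<Rightarrow> 'a, 'b) rfmat"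
  assume "i \<le> j" "X \<in> loc i"
  then obtain f where X: "X = embed 0 i f" by (auto simp: loc_def)
  have eq: "embed 0 j (\<lambda>r c. if \<forall>t<j. 0 \<le> t \<and> t < 0 + i \<or> r ! t = c ! t then f (take i (drop 0 r)) (take i (drop 0 c)) else 0) = embed (0 + 0) i f"
    by (rule embed_extend) (use \<open>i \<le> j\<close> in auto)
  show "X \<in> loc j" unfolding X loc_def eq[symmetric, unfolded add_0] by (rule rangeI)
qed

lemma loc_mult: "X \<in> loc i \<Longrightarrow> Y \<in> loc i \<Longrightarrow> X * Y \<in> loc i"
  unfolding loc_def by (auto simp flip: embed_tmul)

lemma loc_minus: "X \<in> loc i \<Longrightarrow> Y \<in> loc i \<Longrightarrow> X - Y \<in> loc i"
  unfolding loc_def by (auto simp flip: embed_tdiff)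

lemma smat_loc: "smat t \<in> loc 0"
  by (simp add: smat_def loc_def)

lemma op2_loc: "op2 i S \<in> loc (i + 2)"
  using embed_at2[of i "i + 2" 0 S] by (simp add: loc_def op2_def) (metis rangeI)

lemma op1_loc: "op1 i M \<in> loc (i + 1)"
  using embed_at1[of i "i + 1" 0 M] by (simp add: loc_def op1_def) (metis rangeI)

lemma op2_commute_loc:
  assumes "X \<in> loc i" "\<And>p p' z. S $ p $ p' * z = z * S $ p $ p'"
  shows "op2 i S * X = X * op2 i S"
proof -
  obtain f where X: "X = embed 0 i f" using assms(1) by (auto simp: loc_def)
  show ?thesis unfolding X op2_def by (rule embed_commute) (simp add: at2_def assms(2))
qed

lemma op1_commute_loc:
  assumes "X \<in> loc i" "\<And>p p' z. M $ p $ p' * z = z * M $ p $ p'"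
  shows "op1 i M * X = X * op1 i M"
proof -
  obtain f where X: "X = embed 0 i f" using assms(1) by (auto simp: loc_def)
  show ?thesis unfolding X op1_def by (rule embed_commute) (simp add: at1_def assms(2))
qed

text \<open>The traced position is kept, with the identity acting there, so that partial traces are
  maps of one fixed ring into itself.\<close>

definition ptr :: "nat \<Rightarrow> (nat \<Rightarrow> 'n::finite, 'a::ring_1) rfmat \<Rightarrow> (nat \<Rightarrow> 'n, 'a) rfmat" where
  "ptr K X = Rfmat (\<lambda>r c. if r K = c K then \<Sum>b\<in>UNIV. entry X (r(K := b)) (c(K := b)) else 0)"

lemma entry_ptr: "entry (ptr K X) r c = (if r K = c K then \<Sum>b\<in>UNIV. entry X (r(K := b)) (c(K := b)) else 0)"
proof -
  have "finite {c. (if r K = c K then \<Sum>b\<in>UNIV. entry X (r(K := b)) (c(K := b)) else 0) \<noteq> 0}" for r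
  proof (rule finite_subset)
    show "finite (\<Union>b. (\<lambda>c. c(K := r K)) ` {c. entry X (r(K := b)) c \<noteq> 0})"
      by (simp add: finite_row)
    show "{c. (if r K = c K then \<Sum>b\<in>UNIV. entry X (r(K := b)) (c(K := b)) else 0) \<noteq> 0}
       \<subseteq> (\<Union>b. (\<lambda>c. c(K := r K)) ` {c. entry X (r(K := b)) c \<noteq> 0})"
    proof
      fix c assume "c \<in> {c. (if r K = c K then \<Sum>b\<in>UNIV. entry X (r(K := b)) (c(K := b)) else 0) \<noteq> 0}"
      then have *: "r K = c K" "(\<Sum>b\<in>UNIV. entry X (r(K := b)) (c(K := b))) \<noteq> 0" by (auto split: if_splits)
      then obtain b where "entry X (r(K := b)) (c(K := b)) \<noteq> 0" by (meson sum.neutral)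
      moreover have "c = (c(K := b))(K := r K)" using * by auto
      ultimately show "c \<in> (\<Union>b. (\<lambda>c. c(K := r K)) ` {c. entry X (r(K := b)) c \<noteq> 0})" by blast
    qed
  qed
  then show ?thesis unfolding ptr_def by (subst entry_Rfmat) auto
qed

lemma replace_upd: "length l = K \<Longrightarrow> replace 0 (r(K := b)) l = (replace 0 r l)(K := b)"
  by (auto simp: replace_def fun_eq_iff)

lemma ptr_left:
  fixes X Y :: "(nat \<Rightarrow> 'n::finite, 'a::ring_1) rfmat"
  assumes "X \<in> loc K"
  shows "ptr K (X * Y) = X * ptr K Y"
proof (rule rfmat_eqI)
  fix r c :: "nat \<Rightarrow> 'n"
  from assms
  obtain f where X: "X = embed 0 K f" by (auto simp: loc_def)
  have "replace 0 r l K = r K" if "length l = K" for l using that by (simp add: replace_def)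
  then show "entry (ptr K (X * Y)) r c = entry (X * ptr K Y) r c"
    unfolding X by (auto simp: entry_ptr entry_embed_mult replace_upd sum_distrib_left intro!: sum.swap[THEN trans] sum.cong)
qed

lemma ptr_right:
  fixes X Y :: "(nat \<Rightarrow> 'n::finite, 'a::ring_1) rfmat"
  assumes "X \<in> loc K"
  shows "ptr K (Y * X) = ptr K Y * X"
proof (rule rfmat_eqI)
  fix r c :: "nat \<Rightarrow> 'n"
  from assms
  obtain f where X: "X = embed 0 K f" by (auto simp: loc_def)
  have "replace 0 c l K = c K" if "length l = K" for l using that by (simp add: replace_def)
  then show "entry (ptr K (Y * X)) r c = entry (ptr K Y * X) r c"
    unfolding X by (auto simp: entry_ptr entry_mult_embed replace_upd sum_distrib_right intro!: sum.swap[THEN trans] sum.cong)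
qed

lemma ptr_embed: "ptr K (embed 0 (Suc K) f) = embed 0 K (\<lambda>r c. \<Sum>b\<in>UNIV. f (r @ [b]) (c @ [b]))"
proof (rule rfmat_eqI)
  fix r c :: "nat \<Rightarrow> 'a"
  have 1: "agree_off 0 (Suc K) (r(K := b)) (c(K := b)) \<and> r K = c K \<longleftrightarrow> agree_off 0 K r c" for b
    by (auto simp: agree_off_def less_Suc_eq)
  have 2: "window 0 (Suc K) (r(K := b)) = window 0 K r @ [b]" for r :: "nat \<Rightarrow> 'a" and b
    by simp
  show "entry (ptr K (embed 0 (Suc K) f)) r c = entry (embed 0 K (\<lambda>r c. \<Sum>b\<in>UNIV. f (r @ [b]) (c @ [b]))) r c"
  proof (cases "r K = c K")
    case True
    then have "agree_off 0 (Suc K) (r(K := b)) (c(K := b)) \<longleftrightarrow> agree_off 0 K r c" for b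
      using 1 by simp
    then show ?thesis unfolding entry_ptr entry_embed 2 using True by simp
  next
    case False
    then have "\<not> agree_off 0 K r c" by (auto simp: agree_off_def)
    then show ?thesis using False by (simp add: entry_ptr entry_embed)
  qed
qed

lemma ptr_loc: "X \<in> loc (Suc K) \<Longrightarrow> ptr K X \<in> loc K"
  by (auto simp: loc_def ptr_embed)

lemma loc_entry_upd:
  assumes "Z \<in> loc (Suc K)" "r (Suc K) = c (Suc K)"
  shows "entry Z (r(K := u, Suc K := d)) (c(K := v, Suc K := d')) =
    (if d = d' then entry Z (r(K := u)) (c(K := v)) else 0)"
proof -
  obtain f where Z: "Z = embed 0 (Suc K) f" using assms(1) by (auto simp: loc_def)
  have 1: "agree_off 0 (Suc K) (r(K := u, Suc K := d)) (c(K := v, Suc K := d')) \<longleftrightarrow>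
     d = d' \<and> agree_off 0 (Suc K) (r(K := u)) (c(K := v))"
    using assms(2) by (auto simp: agree_off_def all_conj_distrib split: if_splits)
  have 2: "window 0 (Suc K) (x(Suc K := y)) = window 0 (Suc K) x" for x :: "nat \<Rightarrow> 'a" and y
    by simp
  show ?thesis unfolding Z entry_embed 2 1 by simp
qed

section \<open>The R-trace of a Hecke symmetry\<close>

lemma smat_mult: "smat (a * b) = smat a * smat b"
  by (rule rfmat_eqI) (simp add: entry_smat)

lemma smat_diff: "smat (a - b) = smat a - smat b"
  by (rule rfmat_eqI) (simp add: entry_smat)

lemma smat_1: "smat 1 = 1"
  by (rule rfmat_eqI) (simp add: entry_smat entry_one)

lemma smat_central: "(\<And>z. z * a = a * z) \<Longrightarrow> central (smat a)"
  unfolding central_def by (auto intro!: rfmat_eqI)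

text \<open>Kept general for two uses: \<iota> is the embedding of the scalars into the series over
  the free algebra, and also the identity of the complex numbers when properties of \<open>C\<close>
  are derived.\<close>

locale trace_coefficients =
  fixes \<iota> :: "complex \<Rightarrow> 'a::ring_1"
    and C :: "complex ^ 'n::finite ^ 'n"
  assumes \<iota>_add: "\<iota> (a + b) = \<iota> a + \<iota> b"
    and \<iota>_mult: "\<iota> (a * b) = \<iota> a * \<iota> b"
    and \<iota>_1: "\<iota> 1 = 1"
    and \<iota>_central: "z * \<iota> a = \<iota> a * z"
begin

lemma \<iota>_0: "\<iota> 0 = 0" using \<iota>_add[of 0 0] by simp
lemma \<iota>_diff: "\<iota> (a - b) = \<iota> a - \<iota> b" using \<iota>_add[of "a - b" b] by simp
lemma \<iota>_sum: "\<iota> (sum f A) = (\<Sum>a\<in>A. \<iota> (f a))"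
  by (induction A rule: infinite_finite_induct) (simp_all add: \<iota>_0 \<iota>_add)

definition sc :: "complex \<Rightarrow> (nat \<Rightarrow> 'n, 'a) rfmat" where "sc a = smat (\<iota> a)"
definition Cop :: "nat \<Rightarrow> (nat \<Rightarrow> 'n, 'a) rfmat" where "Cop i = op1 i (map_matrix \<iota> C)"
definition tr :: "nat \<Rightarrow> (nat \<Rightarrow> 'n, 'a) rfmat \<Rightarrow> (nat \<Rightarrow> 'n, 'a) rfmat" where
  "tr K X = ptr K (Cop K * X)"
lemma map_matrix_\<iota>_mult: "map_matrix \<iota> (A ** B) = map_matrix \<iota> A ** map_matrix \<iota> B"
  by (simp add: vec_eq_iff map_matrix_def matrix_matrix_mult_def \<iota>_sum \<iota>_mult)

lemma entry_tr: "entry (tr K X) r c = (if r K = c K then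
   \<Sum>b\<in>UNIV. \<Sum>f\<in>UNIV. \<iota> (C $ b $ f) * entry X (r(K := f)) (c(K := b)) else 0)"
  unfolding tr_def entry_ptr Cop_def entry_op1_mult by (simp add: map_matrix_def)

lemma entry_tr_tr: "entry (tr K (tr (Suc K) X)) r c = (if r K = c K \<and> r (Suc K) = c (Suc K) then
   \<Sum>s\<in>UNIV. \<Sum>t\<in>UNIV. \<iota> (C $ fst s $ fst t * C $ snd s $ snd t) *
      entry X (r(K := fst t, Suc K := snd t)) (c(K := fst s, Suc K := snd s)) else 0)"
proof (cases "r K = c K \<and> r (Suc K) = c (Suc K)")
  case True
  have "entry (tr K (tr (Suc K) X)) r c = (\<Sum>b\<in>UNIV. \<Sum>f\<in>UNIV. \<Sum>b'\<in>UNIV. \<Sum>f'\<in>UNIV. \<iota> (C $ b $ f * C $ b' $ f') *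
      entry X (r(K := f, Suc K := f')) (c(K := b, Suc K := b')))"
    using True by (simp add: entry_tr sum_distrib_left \<iota>_mult mult.assoc)
  also have "\<dots> = (\<Sum>b\<in>UNIV. \<Sum>b'\<in>UNIV. \<Sum>f\<in>UNIV. \<Sum>f'\<in>UNIV. \<iota> (C $ b $ f * C $ b' $ f') *
      entry X (r(K := f, Suc K := f')) (c(K := b, Suc K := b')))"
    by (intro sum.cong refl sum.swap)
  finally show ?thesis using True by (simp add: sum_UNIV_prod)
qed (auto simp: entry_tr)

text \<open>As \<open>Z\<close> is the identity at position \<open>Suc K\<close>, the trace over
  that position only contracts \<open>A\<close>, \<open>B\<close> and \<open>C\<close>. The numbers
  in front of the entries of \<open>Z\<close> can therefore be computed over the complex
  numbers.\<close>

lemma entry_tr_conj: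
  assumes "Z \<in> loc (Suc K)"
  shows "entry (tr (Suc K) (op2 K (map_matrix \<iota> A) * Z * op2 K (map_matrix \<iota> B))) r c =
    (if r (Suc K) = c (Suc K) then \<Sum>u\<in>UNIV. \<Sum>v\<in>UNIV.
       \<iota> (\<Sum>b\<in>UNIV. \<Sum>f\<in>UNIV. \<Sum>d\<in>UNIV. C $ b $ f * A $ (r K, f) $ (u, d) * B $ (v, d) $ (c K, b))
         * entry Z (r(K := u)) (c(K := v)) else 0)"
proof (cases "r (Suc K) = c (Suc K)")
  case False
  then show ?thesis by (simp add: entry_tr)
next
  case True
    let ?Z = "\<lambda>u v. entry Z (r(K := u)) (c(K := v))"
    have 1: "entry (op2 K (map_matrix \<iota> A) * Z * op2 K (map_matrix \<iota> B)) (r(Suc K := f)) (c(Suc K := b))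
      = (\<Sum>u\<in>UNIV. \<Sum>v\<in>UNIV. \<Sum>d\<in>UNIV. \<iota> (A $ (r K, f) $ (u, d) * B $ (v, d) $ (c K, b)) * ?Z u v)" for f b
    proof -
      have "entry (op2 K (map_matrix \<iota> A) * Z * op2 K (map_matrix \<iota> B)) (r(Suc K := f)) (c(Suc K := b))
        = (\<Sum>p'\<in>UNIV. (\<Sum>p\<in>UNIV. \<iota> (A $ (r K, f) $ p) *
              entry Z (r(K := fst p, Suc K := snd p)) (c(K := fst p', Suc K := snd p'))) * \<iota> (B $ p' $ (c K, b)))"
        unfolding entry_mult_op2 entry_op2_mult by (simp add: map_matrix_def fun_upd_twist)
      also have "\<dots> = (\<Sum>p'\<in>UNIV. (\<Sum>u\<in>UNIV. \<iota> (A $ (r K, f) $ (u, snd p')) * ?Z u (fst p')) * \<iota> (B $ p' $ (c K, b)))"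
        unfolding loc_entry_upd[where Z = Z and r = r and c = c and K = K, OF assms True] by (simp add: sum_UNIV_prod if_distrib cong: if_cong)
      also have "\<dots> = (\<Sum>v\<in>UNIV. \<Sum>d\<in>UNIV. \<Sum>u\<in>UNIV. \<iota> (A $ (r K, f) $ (u, d) * B $ (v, d) $ (c K, b)) * ?Z u v)"
        unfolding sum_UNIV_prod by (simp add: sum_distrib_right mult.assoc \<iota>_central[of "?Z _ _"] \<iota>_mult)
      also have "\<dots> = (\<Sum>v\<in>UNIV. \<Sum>u\<in>UNIV. \<Sum>d\<in>UNIV. \<iota> (A $ (r K, f) $ (u, d) * B $ (v, d) $ (c K, b)) * ?Z u v)"
        by (intro sum.cong refl sum.swap)
      also have "\<dots> = (\<Sum>u\<in>UNIV. \<Sum>v\<in>UNIV. \<Sum>d\<in>UNIV. \<iota> (A $ (r K, f) $ (u, d) * B $ (v, d) $ (c K, b)) * ?Z u v)"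
        by (rule sum.swap)
      finally show ?thesis .
    qed
    have "entry (tr (Suc K) (op2 K (map_matrix \<iota> A) * Z * (op2 K (map_matrix \<iota> B)))) r c
      = (\<Sum>b\<in>UNIV. \<Sum>f\<in>UNIV. \<Sum>u\<in>UNIV. \<Sum>v\<in>UNIV. \<Sum>d\<in>UNIV.
           \<iota> (C $ b $ f * A $ (r K, f) $ (u, d) * B $ (v, d) $ (c K, b)) * ?Z u v)"
      unfolding entry_tr 1 using True by (simp add: sum_distrib_left \<iota>_mult mult.assoc)
    also have "\<dots> = (\<Sum>b\<in>UNIV. \<Sum>u\<in>UNIV. \<Sum>f\<in>UNIV. \<Sum>v\<in>UNIV. \<Sum>d\<in>UNIV.
           \<iota> (C $ b $ f * A $ (r K, f) $ (u, d) * B $ (v, d) $ (c K, b)) * ?Z u v)"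
      by (intro sum.cong refl sum.swap)
    also have "\<dots> = (\<Sum>u\<in>UNIV. \<Sum>b\<in>UNIV. \<Sum>f\<in>UNIV. \<Sum>v\<in>UNIV. \<Sum>d\<in>UNIV.
           \<iota> (C $ b $ f * A $ (r K, f) $ (u, d) * B $ (v, d) $ (c K, b)) * ?Z u v)"
      by (rule sum.swap)
    also have "\<dots> = (\<Sum>u\<in>UNIV. \<Sum>b\<in>UNIV. \<Sum>v\<in>UNIV. \<Sum>f\<in>UNIV. \<Sum>d\<in>UNIV.
           \<iota> (C $ b $ f * A $ (r K, f) $ (u, d) * B $ (v, d) $ (c K, b)) * ?Z u v)"
      by (intro sum.cong refl sum.swap)
    also have "\<dots> = (\<Sum>u\<in>UNIV. \<Sum>v\<in>UNIV. \<Sum>b\<in>UNIV. \<Sum>f\<in>UNIV. \<Sum>d\<in>UNIV.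
           \<iota> (C $ b $ f * A $ (r K, f) $ (u, d) * B $ (v, d) $ (c K, b)) * ?Z u v)"
      by (intro sum.cong refl sum.swap)
    finally show ?thesis using True by (simp add: \<iota>_sum sum_distrib_right)
qed

lemma Cop_commute: "X \<in> loc i \<Longrightarrow> Cop i * X = X * Cop i"
  unfolding Cop_def by (rule op1_commute_loc) (simp_all add: map_matrix_def \<iota>_central)

lemma at2_map: "tmap \<iota> (at2 K k A) = at2 K k (map_matrix \<iota> A)"
  by (auto simp: fun_eq_iff tmap_def at2_def map_matrix_def \<iota>_0)

lemma at1_map: "tmap \<iota> (at1 K k A) = at1 K k (map_matrix \<iota> A)"
  by (auto simp: fun_eq_iff tmap_def at1_def map_matrix_def \<iota>_0)

lemma tmap_\<iota>_tmul: "tmap \<iota> (tmul K f g) = tmul K (tmap \<iota> f) (tmap \<iota> g)"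
  by (simp add: fun_eq_iff tmap_def tmul_def \<iota>_sum \<iota>_mult)

end

text \<open>In coordinates, \<open>R_trace\<close> says that the R-trace over the second position of
  R X_1 R^-1 is the R-trace of X, and \<open>R_CC\<close> is R C_1 C_2 = C_1 C_2 R.\<close>

locale hecke_representation = trace_coefficients \<iota> C
  for \<iota> :: "complex \<Rightarrow> 'a::ring_1"
    and C :: "complex ^ 'n::finite ^ 'n" +
  fixes q :: complex
    and R R' :: "complex ^ ('n \<times> 'n) ^ ('n \<times> 'n)"
    and I :: "'a set"
    and \<xi> :: "'l \<Rightarrow> 'a"
    and M :: "'l \<Rightarrow> 'a ^ 'n ^ 'n"
  assumes q0: "q \<noteq> 0" and generic: "generic q"
    and \<xi>_central: "z * \<xi> l = \<xi> l * z"
    and braiding: "braiding R"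
    and R'_def: "R' = R - mat (q - inverse q)"
    and R_R': "R ** R' = mat 1"
    and R_trace: "\<And>i j u v. (\<Sum>b\<in>UNIV. \<Sum>f\<in>UNIV. \<Sum>d\<in>UNIV. C $ b $ f * R $ (i, f) $ (u, d) * R' $ (v, d) $ (j, b))
       = (if i = j then C $ v $ u else 0)"
    and R_CC: "\<And>s t. (\<Sum>p\<in>UNIV. R $ s $ p * (C $ fst p $ fst t * C $ snd p $ snd t))
       = (\<Sum>p\<in>UNIV. (C $ fst s $ fst p * C $ snd s $ snd p) * R $ p $ t)"
    and I_0: "0 \<in> I"
    and I_add: "y \<in> I \<Longrightarrow> z \<in> I \<Longrightarrow> y + z \<in> I"
    and I_left: "y \<in> I \<Longrightarrow> z * y \<in> I"
    and I_right: "y \<in> I \<Longrightarrow> y * z \<in> I"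
begin

definition Rop :: "nat \<Rightarrow> (nat \<Rightarrow> 'n, 'a) rfmat" where "Rop i = op2 i (map_matrix \<iota> R)"
definition Iop :: "(nat \<Rightarrow> 'n, 'a) rfmat set" where "Iop = {X. \<forall>r c. entry X r c \<in> I}"

lemma I_sum: "(\<And>a. a \<in> A \<Longrightarrow> f a \<in> I) \<Longrightarrow> sum f A \<in> I"
  by (induction A rule: infinite_finite_induct) (auto simp: I_0 I_add)

text \<open>The entries of \<open>R\<close> are central, so their order relative to those of
  \<open>X\<close> is irrelevant; cyclicity then amounts to \<open>R\<close> commuting with C_1
  C_2.\<close>

lemma tr_cyclic: "tr K (tr (Suc K) (Rop K * X)) = tr K (tr (Suc K) (X * Rop K))"
proof (rule rfmat_eqI)
  fix r c :: "nat \<Rightarrow> 'n"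
  let ?CC = "\<lambda>s t. C $ fst s $ fst t * C $ snd s $ snd t"
  let ?X = "\<lambda>p s. entry X (r(K := fst p, Suc K := snd p)) (c(K := fst s, Suc K := snd s))"
  have 1: "(\<Sum>s\<in>UNIV. \<Sum>t\<in>UNIV. \<iota> (?CC s t) * (\<Sum>p\<in>UNIV. \<iota> (R $ t $ p) * ?X p s))
     = (\<Sum>s\<in>UNIV. \<Sum>p\<in>UNIV. \<iota> (\<Sum>t\<in>UNIV. ?CC s t * R $ t $ p) * ?X p s)"
    by (rule sum.cong[OF refl])
      (simp add: sum_distrib_left sum_distrib_right \<iota>_sum \<iota>_mult mult.assoc, rule sum.swap)
  have 2: "(\<Sum>s\<in>UNIV. \<Sum>t\<in>UNIV. \<iota> (?CC s t) * (\<Sum>p\<in>UNIV. ?X t p * \<iota> (R $ p $ s)))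
     = (\<Sum>p\<in>UNIV. \<Sum>t\<in>UNIV. \<iota> (\<Sum>s\<in>UNIV. R $ p $ s * ?CC s t) * ?X t p)"
  proof -
    have "(\<Sum>s\<in>UNIV. \<Sum>t\<in>UNIV. \<iota> (?CC s t) * (\<Sum>p\<in>UNIV. ?X t p * \<iota> (R $ p $ s)))
       = (\<Sum>s\<in>UNIV. \<Sum>t\<in>UNIV. \<Sum>p\<in>UNIV. \<iota> (R $ p $ s * ?CC s t) * ?X t p)"
    proof (intro sum.cong refl)
      fix s t
      have "\<iota> (?CC s t) * (?X t p * \<iota> (R $ p $ s)) = \<iota> (R $ p $ s * ?CC s t) * ?X t p" for p
        unfolding \<iota>_central[of "?X t p"] by (simp add: mult.commute[of "R $ p $ s"] \<iota>_mult mult.assoc)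
      then show "\<iota> (?CC s t) * (\<Sum>p\<in>UNIV. ?X t p * \<iota> (R $ p $ s)) = (\<Sum>p\<in>UNIV. \<iota> (R $ p $ s * ?CC s t) * ?X t p)"
        by (simp add: sum_distrib_left)
    qed
    also have "\<dots> = (\<Sum>s\<in>UNIV. \<Sum>p\<in>UNIV. \<Sum>t\<in>UNIV. \<iota> (R $ p $ s * ?CC s t) * ?X t p)"
      by (intro sum.cong refl sum.swap)
    also have "\<dots> = (\<Sum>p\<in>UNIV. \<Sum>s\<in>UNIV. \<Sum>t\<in>UNIV. \<iota> (R $ p $ s * ?CC s t) * ?X t p)"
      by (rule sum.swap)
    also have "\<dots> = (\<Sum>p\<in>UNIV. \<Sum>t\<in>UNIV. \<Sum>s\<in>UNIV. \<iota> (R $ p $ s * ?CC s t) * ?X t p)"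
      by (intro sum.cong refl sum.swap)
    finally show ?thesis by (simp add: \<iota>_sum sum_distrib_right)
  qed
  show "entry (tr K (tr (Suc K) (Rop K * X))) r c = entry (tr K (tr (Suc K) (X * Rop K))) r c"
  proof (cases "r K = c K \<and> r (Suc K) = c (Suc K)")
    case True
    have "entry (tr K (tr (Suc K) (Rop K * X))) r c = (\<Sum>s\<in>UNIV. \<Sum>t\<in>UNIV. \<iota> (?CC s t) * (\<Sum>p\<in>UNIV. \<iota> (R $ t $ p) * ?X p s))"
      using True unfolding entry_tr_tr Rop_def entry_op2_mult by (simp add: map_matrix_def fun_upd_twist)
    also have "\<dots> = (\<Sum>s\<in>UNIV. \<Sum>t\<in>UNIV. \<iota> (?CC s t) * (\<Sum>p\<in>UNIV. ?X t p * \<iota> (R $ p $ s)))"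
      unfolding 1 2 R_CC ..
    also have "\<dots> = entry (tr K (tr (Suc K) (X * Rop K))) r c"
      using True unfolding entry_tr_tr Rop_def entry_mult_op2 by (simp add: map_matrix_def fun_upd_twist)
    finally show ?thesis .
  qed (auto simp: entry_tr_tr)
qed

lemma Rop_minus: "Rop K - sc (q - inverse q) = op2 K (map_matrix \<iota> R')"
proof -
  have "map_matrix \<iota> R' = map_matrix \<iota> R - mat (\<iota> (q - inverse q))"
    by (simp add: R'_def vec_eq_iff map_matrix_def mat_def \<iota>_diff \<iota>_0)
  then show ?thesis by (simp add: Rop_def sc_def op2_diff op2_mat)
qed

lemma tr_R:
  assumes "Z \<in> loc (Suc K)"
  shows "tr (Suc K) (Rop K * Z * (Rop K - sc (q - inverse q))) = tr K Z"
proof (rule rfmat_eqI)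
  fix r c :: "nat \<Rightarrow> 'n"
  show "entry (tr (Suc K) (Rop K * Z * (Rop K - sc (q - inverse q)))) r c = entry (tr K Z) r c"
  proof (cases "r (Suc K) = c (Suc K)")
    case False
    obtain f where Z: "Z = embed 0 (Suc K) f" using assms by (auto simp: loc_def)
    have "\<not> agree_off 0 (Suc K) (r(K := u)) (c(K := v))" for u v
      using False by (auto simp: agree_off_def intro!: exI[of _ "Suc K"])
    then have "entry Z (r(K := u)) (c(K := v)) = 0" for u v
      by (simp add: Z entry_embed)
    then show ?thesis using False by (simp add: entry_tr)
  next
    case True
    have "entry (tr (Suc K) (Rop K * Z * (Rop K - sc (q - inverse q)))) r c
      = (\<Sum>u\<in>UNIV. \<Sum>v\<in>UNIV. \<iota> (if r K = c K then C $ v $ u else 0) * entry Z (r(K := u)) (c(K := v)))"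
      unfolding Rop_minus unfolding Rop_def entry_tr_conj[OF assms] R_trace using True by simp
    also have "\<dots> = (\<Sum>v\<in>UNIV. \<Sum>u\<in>UNIV. \<iota> (if r K = c K then C $ v $ u else 0) * entry Z (r(K := u)) (c(K := v)))"
      by (rule sum.swap)
    also have "\<dots> = entry (tr K Z) r c"
      by (simp add: entry_tr \<iota>_0)
    finally show ?thesis .
  qed
qed

lemma Rop_braid: "Rop i * Rop (Suc i) * Rop i = Rop (Suc i) * Rop i * Rop (Suc i)"
proof -
  have 1: "embed i 3 (at2 3 1 (map_matrix \<iota> R)) = Rop i" "embed i 3 (at2 3 2 (map_matrix \<iota> R)) = Rop (Suc i)"
    using embed_at2[of 0 3 i "map_matrix \<iota> R"] embed_at2[of 1 3 i "map_matrix \<iota> R"]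
    by (simp_all add: Rop_def op2_def numeral_2_eq_2)
  have "embed i 3 (tmap \<iota> (tmul 3 (tmul 3 (at2 3 1 R) (at2 3 2 R)) (at2 3 1 R))) =
     embed i 3 (tmap \<iota> (tmul 3 (tmul 3 (at2 3 2 R) (at2 3 1 R)) (at2 3 2 R)))"
    using braiding unfolding braiding_def by simp
  then show ?thesis unfolding tmap_\<iota>_tmul at2_map embed_tmul 1 .
qed

lemma Rop_hecke: "Rop i * Rop i = 1 + sc (q - inverse q) * Rop i"
proof -
  have "map_matrix \<iota> (mat 1) = mat 1"
    by (simp add: vec_eq_iff map_matrix_def mat_def \<iota>_1 \<iota>_0)
  then have "Rop i * (Rop i - sc (q - inverse q)) = 1"
    unfolding Rop_minus unfolding Rop_def by (metis op2_mult op2_mat smat_1 map_matrix_\<iota>_mult R_R')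
  moreover have "central (sc (q - inverse q))" unfolding sc_def by (rule smat_central[OF \<iota>_central])
  ultimately show ?thesis using centralD by (metis diff_add_cancel right_diff_distrib)
qed

sublocale tower: trace_tower q sc Rop loc tr Iop "\<lambda>l. smat (\<xi> l)" "\<lambda>l. op1 0 (M l)"
proof
  fix i j k :: nat and X Y :: "(nat \<Rightarrow> 'n, 'a) rfmat" and a b :: complex and l
  show "q \<noteq> 0" "generic q" by (fact q0 generic)+
  show "sc (a + b) = sc a + sc b" by (rule rfmat_eqI) (simp add: sc_def entry_smat \<iota>_add)
  show "sc (a * b) = sc a * sc b" by (simp add: sc_def \<iota>_mult smat_mult)
  show "sc 1 = 1" by (simp add: sc_def \<iota>_1 smat_1)
  show "central (sc a)" unfolding sc_def by (rule smat_central[OF \<iota>_central])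
  show "central (smat (\<xi> l) :: (nat \<Rightarrow> 'n, 'a) rfmat)" by (rule smat_central[OF \<xi>_central])
  show "Rop i * Rop (Suc i) * Rop i = Rop (Suc i) * Rop i * Rop (Suc i)" by (rule Rop_braid)
  show "Rop i * Rop i = 1 + sc (q - inverse q) * Rop i" by (rule Rop_hecke)
  show "loc i \<subseteq> (loc j :: (nat \<Rightarrow> 'n, 'a) rfmat set)" if "i \<le> j" by (rule loc_mono[OF that])
  show "X - Y \<in> loc i" "X * Y \<in> loc i" if "X \<in> loc i" "Y \<in> loc i"
    using that by (auto intro: loc_minus loc_mult)
  show "sc a \<in> loc 0" "smat (\<xi> l) \<in> (loc 0 :: (nat \<Rightarrow> 'n, 'a) rfmat set)" by (auto simp: sc_def intro: smat_loc)
  show "Rop i \<in> loc (i + 2)" unfolding Rop_def by (rule op2_loc)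
  show "op1 0 (M l) \<in> loc 1" using op1_loc[of 0 "M l"] by simp
  show "Rop i * X = X * Rop i" if "X \<in> loc i"
    unfolding Rop_def by (rule op2_commute_loc[OF that]) (simp add: map_matrix_def \<iota>_central)
  show "tr k (X - Y) = tr k X - tr k Y"
    by (rule rfmat_eqI) (simp add: entry_tr right_diff_distrib sum_subtractf)
  show "tr k X \<in> loc k" if "X \<in> loc (Suc k)"
    unfolding tr_def Cop_def using op1_loc[of k] that by (intro ptr_loc loc_mult) auto
  show "tr k (X * Y) = X * tr k Y" if "X \<in> loc k"
    using that by (simp add: tr_def ptr_left Cop_commute flip: mult.assoc) (simp add: ptr_left mult.assoc)
  show "tr k (Y * X) = tr k Y * X" if "X \<in> loc k"
    using that by (simp add: tr_def ptr_right flip: mult.assoc)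
  show "tr (Suc k) (Rop k * X * (Rop k - sc (q - inverse q))) = tr k X" if "X \<in> loc (Suc k)"
    by (rule tr_R[OF that])
  show "tr k (tr (Suc k) (Rop k * X)) = tr k (tr (Suc k) (X * Rop k))" by (rule tr_cyclic)
  show "0 \<in> Iop" by (simp add: Iop_def I_0)
  show "X + Y \<in> Iop" if "X \<in> Iop" "Y \<in> Iop" using that by (simp add: Iop_def I_add)
  show "Y * X \<in> Iop" "tr k X \<in> Iop" if "X \<in> Iop"
    using that by (auto simp: Iop_def entry_mult entry_tr intro!: I_sum I_left I_0)
  show "X * Y \<in> Iop" if "X \<in> Iop"
    using that by (auto simp: Iop_def entry_mult intro!: I_sum I_right)
qed

end

section \<open>Consequences of skew-invertibility\<close>

locale skew_inverse =
  fixes R \<Psi> :: "complex ^ ('n::finite \<times> 'n) ^ ('n \<times> 'n)" and C :: "complex ^ 'n ^ 'n"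
  assumes skew_inverse: "skew_inverse_of R \<Psi>"
    and C_def: "C = (\<chi> a a'. \<Sum>b\<in>UNIV. \<Psi> $ (a, b) $ (a', b))"
begin

lemma ptrace_13_component:
  "ptrace_13 (tmul 3 (at2 3 1 A) (at2 3 2 B)) $ (a, e) $ (c, f)
    = (\<Sum>b\<in>UNIV. \<Sum>d\<in>UNIV. A $ (a, b) $ (c, d) * B $ (d, e) $ (b, f))"
  for A B :: "complex ^ ('n \<times> 'n) ^ ('n \<times> 'n)"
proof -
  have "tmul 3 (at2 3 1 A) (at2 3 2 B) [a, b, e] [c, b, f] = (\<Sum>d\<in>UNIV. A $ (a, b) $ (c, d) * B $ (d, e) $ (b, f))" for b
  proof -
    have "tmul 3 (at2 3 1 A) (at2 3 2 B) [a, b, e] [c, b, f] =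
       (\<Sum>l\<in>(\<lambda>d. [c, d, e]) ` UNIV. at2 3 1 A [a, b, e] l * at2 3 2 B l [c, b, f])"
      unfolding tmul_def
    proof (rule sum.mono_neutral_right)
      show "\<forall>l\<in>{l. length l = 3} - range (\<lambda>d. [c, d, e]). at2 3 1 A [a, b, e] l * at2 3 2 B l [c, b, f] = 0"
      proof
        fix l assume l: "l \<in> {l. length l = 3} - range (\<lambda>d. [c, d, e])"
        then obtain x y z where xyz: "l = [x, y, z]" by (auto simp: length_Suc_conv numeral_3_eq_3)
        with l have "x \<noteq> c \<or> z \<noteq> e" by auto
        then show "at2 3 1 A [a, b, e] l * at2 3 2 B l [c, b, f] = 0"
          by (auto simp: xyz at2_def numeral_3_eq_3 All_less_Suc)
      qed
    qed auto
    also have "\<dots> = (\<Sum>d\<in>UNIV. at2 3 1 A [a, b, e] [c, d, e] * at2 3 2 B [c, d, e] [c, b, f])"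
      by (subst sum.reindex) (auto simp: inj_on_def)
    also have "\<dots> = (\<Sum>d\<in>UNIV. A $ (a, b) $ (c, d) * B $ (d, e) $ (b, f))"
      by (rule sum.cong[OF refl]) (simp add: at2_def numeral_3_eq_3 All_less_Suc)
    finally show ?thesis .
  qed
  then show ?thesis by (simp add: ptrace_13_def)
qed

lemma R_\<Psi>: "(\<Sum>b\<in>UNIV. \<Sum>d\<in>UNIV. R $ (a, b) $ (c, d) * \<Psi> $ (d, e) $ (b, f)) = (if a = f \<and> e = c then 1 else 0)"
  using skew_inverse unfolding skew_inverse_of_def
  by (subst ptrace_13_component[symmetric]) (simp add: flip_def)

lemma \<Psi>_R: "(\<Sum>b\<in>UNIV. \<Sum>d\<in>UNIV. \<Psi> $ (a, b) $ (c, d) * R $ (d, e) $ (b, f)) = (if a = f \<and> e = c then 1 else 0)"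
  using skew_inverse unfolding skew_inverse_of_def
  by (subst ptrace_13_component[symmetric]) (simp add: flip_def)

text \<open>The trace of the defining identity of \<Psi> over its last position.\<close>

lemma R_C: "(\<Sum>b\<in>UNIV. \<Sum>d\<in>UNIV. C $ d $ b * R $ (a, b) $ (c, d)) = (if a = c then 1 else 0)"
proof -
  have "(\<Sum>b\<in>UNIV. \<Sum>d\<in>UNIV. C $ d $ b * R $ (a, b) $ (c, d))
     = (\<Sum>b\<in>UNIV. \<Sum>d\<in>UNIV. \<Sum>e\<in>UNIV. R $ (a, b) $ (c, d) * \<Psi> $ (d, e) $ (b, e))"
    by (simp add: C_def sum_distrib_left mult.commute)
  also have "\<dots> = (\<Sum>b\<in>UNIV. \<Sum>e\<in>UNIV. \<Sum>d\<in>UNIV. R $ (a, b) $ (c, d) * \<Psi> $ (d, e) $ (b, e))"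
    by (intro sum.cong refl sum.swap)
  also have "\<dots> = (\<Sum>e\<in>UNIV. \<Sum>b\<in>UNIV. \<Sum>d\<in>UNIV. R $ (a, b) $ (c, d) * \<Psi> $ (d, e) $ (b, e))"
    by (rule sum.swap)
  also have "\<dots> = (\<Sum>e\<in>UNIV. if e = a \<and> a = c then 1 else 0)"
    unfolding R_\<Psi> by (intro sum.cong refl) auto
  also have "\<dots> = (if a = c then 1 else 0)" by (cases "a = c") simp_all
  finally show ?thesis .
qed

interpretation trace_coefficients "\<lambda>z. z" C
  by unfold_locales (simp_all add: mult.commute)

lemma tr_R_one: "tr (Suc K) (op2 K R) = 1"
proof (rule rfmat_eqI)
  fix r c :: "nat \<Rightarrow> 'n"
  show "entry (tr (Suc K) (op2 K R)) r c = entry 1 r c"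
  proof (cases "agree_off K 1 r c")
    case True
    then have "r (Suc K) = c (Suc K)" unfolding agree_off_def by (metis add.commute less_irrefl plus_1_eq_Suc)
    moreover have "agree_off K 2 (r(Suc K := f)) (c(Suc K := b))" for f b
      unfolding agree_off_def
    proof
      fix s
      show "K \<le> s \<and> s < K + 2 \<or> (r(Suc K := f)) s = (c(Suc K := b)) s"
        using True[unfolded agree_off_def, rule_format, of s] by auto
    qed
    moreover have "r K = c K \<longleftrightarrow> r = c"
    proof
      assume eq: "r K = c K"
      show "r = c"
      proof
        fix s
        show "r s = c s"
          using True[unfolded agree_off_def, rule_format, of s] eq by (cases "s = K") auto
      qed
    qed simp
    moreover have "(\<Sum>b\<in>UNIV. \<Sum>f\<in>UNIV. C $ b $ f * R $ (r K, f) $ (c K, b)) = (if r K = c K then 1 else 0)"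
      unfolding R_C[symmetric] by (rule sum.swap)
    ultimately show ?thesis by (simp add: entry_tr entry_op2 entry_one)
  next
    case False
    then have "r \<noteq> c" by auto
    moreover have "r (Suc K) = c (Suc K) \<Longrightarrow> \<not> agree_off K 2 (r(Suc K := f)) (c(Suc K := b))" for f b
    proof
      assume h: "r (Suc K) = c (Suc K)" "agree_off K 2 (r(Suc K := f)) (c(Suc K := b))"
      have "agree_off K 1 r c"
        unfolding agree_off_def
      proof
        fix s
        show "K \<le> s \<and> s < K + 1 \<or> r s = c s"
          using h(1) h(2)[unfolded agree_off_def, rule_format, of s] by (cases "s = Suc K") auto
      qed
      with False show False by simp
    qed
    ultimately show ?thesis by (simp add: entry_tr entry_op2 entry_one)
  qed
qed

text \<open>The R-trace of the assumed identity over the third position is 1: on the right the outer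
  factors leave the trace, \<open>tr_R_one\<close> gives 1, and \<open>B ** A\<close> remains. So
  the contraction \<open>W\<close> of \<open>C\<close>, \<open>A\<close> and \<open>B\<close>,
  contracted with \<open>R\<close>, is the identity, and \<Psi> inverts this contraction.\<close>

lemma conj_component:
  fixes A B :: "complex ^ ('n \<times> 'n) ^ ('n \<times> 'n)"
  defines "W \<equiv> \<lambda>b g u v. \<Sum>k\<in>UNIV. \<Sum>f\<in>UNIV. \<Sum>d\<in>UNIV. C $ k $ f * A $ (b, f) $ (u, d) * B $ (v, d) $ (g, k)"
  assumes "op2 1 A * op2 0 R * op2 1 B = op2 0 B * op2 1 R * op2 0 A" and "B ** A = mat 1"
  shows "W b g u v = (if b = g then C $ v $ u else 0)"
proof -
  have loc0: "op2 0 X \<in> loc (Suc 1)" for X :: "complex ^ ('n \<times> 'n) ^ ('n \<times> 'n)"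
    using op2_loc[of 0 X] by (simp add: numeral_2_eq_2)
  have map_id: "map_matrix (\<lambda>z. z) X = X" for X :: "complex ^ ('n \<times> 'n) ^ ('n \<times> 'n)"
    by (simp add: map_matrix_def vec_eq_iff)
  have "tr (Suc 1) (op2 1 A * op2 0 R * op2 1 B) = op2 0 B * tr (Suc 1) (op2 1 R) * op2 0 A"
    unfolding assms(2) tr_def using loc0 Cop_commute[OF loc0]
    by (simp add: ptr_left ptr_right flip: mult.assoc) (simp add: ptr_left ptr_right mult.assoc)
  also have "\<dots> = 1"
    unfolding tr_R_one by (simp add: op2_mat smat_1 assms(3) flip: op2_mult)
  finally have tr1: "tr (Suc 1) (op2 1 A * op2 0 R * op2 1 B) = 1" .
  have star: "(\<Sum>u\<in>UNIV. \<Sum>v\<in>UNIV. W b g u v * R $ (a, u) $ (c, v)) = (if a = c \<and> b = g then 1 else 0)" for a c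
  proof -
    \<comment> \<open>Indices with \<open>(a, b)\<close> and \<open>(c, g)\<close> in the two
      untraced positions, equal from the third position on, so that the entry of 1 tests just
      \<open>a = c\<close> and \<open>b = g\<close>.\<close>
    define r where "r = (\<lambda>s::nat. if s = 0 then a else b)"
    define r' where "r' = (\<lambda>s::nat. if s = 0 then c else if s = 1 then g else b)"
    have "agree_off 0 2 (r(1 := u)) (r'(1 := v))" for u v
      by (auto simp: agree_off_def r_def r'_def)
    then have "(\<Sum>u\<in>UNIV. \<Sum>v\<in>UNIV. W b g u v * R $ (a, u) $ (c, v))
      = entry (tr (Suc 1) (op2 1 A * op2 0 R * op2 1 B)) r r'"
      using entry_tr_conj[OF loc0, of A R B r r', unfolded map_id] 
      by (simp add: r_def r'_def entry_op2 W_def)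
    also have "\<dots> = entry 1 r r'" unfolding tr1 ..
    also have "r = r' \<longleftrightarrow> a = c \<and> b = g"
    proof
      assume "r = r'"
      from fun_cong[OF this, of 0] fun_cong[OF this, of 1] show "a = c \<and> b = g" by (simp add: r_def r'_def)
    qed (simp add: r_def r'_def fun_eq_iff)
    then have "entry 1 r r' = (if a = c \<and> b = g then 1 else 0)" by (simp add: entry_one)
    finally show ?thesis .
  qed
  have "(\<Sum>c\<in>UNIV. \<Sum>a\<in>UNIV. \<Psi> $ (v, c) $ (u, a) * (\<Sum>u'\<in>UNIV. \<Sum>v'\<in>UNIV. W b g u' v' * R $ (a, u') $ (c, v'))) = W b g u v"
  proof -
    have "(\<Sum>c\<in>UNIV. \<Sum>a\<in>UNIV. \<Psi> $ (v, c) $ (u, a) * (\<Sum>u'\<in>UNIV. \<Sum>v'\<in>UNIV. W b g u' v' * R $ (a, u') $ (c, v')))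
      = (\<Sum>c\<in>UNIV. \<Sum>a\<in>UNIV. \<Sum>p\<in>UNIV. W b g (fst p) (snd p) * (\<Psi> $ (v, c) $ (u, a) * R $ (a, fst p) $ (c, snd p)))"
      by (simp add: sum_UNIV_prod sum_distrib_left mult_ac)
    also have "\<dots> = (\<Sum>c\<in>UNIV. \<Sum>p\<in>UNIV. \<Sum>a\<in>UNIV. W b g (fst p) (snd p) * (\<Psi> $ (v, c) $ (u, a) * R $ (a, fst p) $ (c, snd p)))"
      by (intro sum.cong refl sum.swap)
    also have "\<dots> = (\<Sum>p\<in>UNIV. \<Sum>c\<in>UNIV. \<Sum>a\<in>UNIV. W b g (fst p) (snd p) * (\<Psi> $ (v, c) $ (u, a) * R $ (a, fst p) $ (c, snd p)))"
      by (rule sum.swap)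
    also have "\<dots> = (\<Sum>p\<in>UNIV. W b g (fst p) (snd p) * (if v = snd p \<and> fst p = u then 1 else 0))"
      unfolding \<Psi>_R[symmetric] by (simp add: sum_distrib_left)
    also have "\<dots> = (\<Sum>p\<in>UNIV. if p = (u, v) then W b g u v else 0)"
      by (intro sum.cong refl) auto
    finally show ?thesis by simp
  qed
  then have "W b g u v = (\<Sum>c\<in>UNIV. \<Sum>a\<in>UNIV. \<Psi> $ (v, c) $ (u, a) * (if a = c \<and> b = g then 1 else 0))"
    unfolding star by simp
  also have "\<dots> = (if b = g then C $ v $ u else 0)"
    by (cases "b = g") (simp_all add: C_def if_distrib cong: if_cong)
  finally show ?thesis .
qed

end

locale hecke_skew_inverse = skew_inverse R \<Psi> C
  for R \<Psi> :: "complex ^ ('n::finite \<times> 'n) ^ ('n \<times> 'n)" and C :: "complex ^ 'n ^ 'n" +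
  fixes R' :: "complex ^ ('n \<times> 'n) ^ ('n \<times> 'n)" and a :: complex
  assumes R'_def: "R' = R - mat a" and R_R': "R ** R' = mat 1" and braiding: "braiding R"
begin

lemma R'_R: "R' ** R = mat 1"
  using R_R' matrix_left_right_inverse by metis

lemma op2_inverse [simp]: "op2 i R * op2 i R' = 1" "op2 i R' * op2 i R = 1"
  by (simp_all add: op2_mat smat_1 R_R' R'_R flip: op2_mult)

lemma op2_braid: "op2 0 R * op2 1 R * op2 0 R = op2 1 R * op2 0 R * op2 1 R"
proof -
  have 1: "embed 0 3 (at2 3 1 R) = op2 0 R" "embed 0 3 (at2 3 2 R) = op2 1 R"
    using embed_at2[of 0 3 0 R] embed_at2[of 1 3 0 R]
    by (simp_all add: op2_def numeral_2_eq_2)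
  have "embed 0 3 (tmul 3 (tmul 3 (at2 3 1 R) (at2 3 2 R)) (at2 3 1 R)) =
     embed 0 3 (tmul 3 (tmul 3 (at2 3 2 R) (at2 3 1 R)) (at2 3 2 R))"
    using braiding unfolding braiding_def by simp
  then show ?thesis unfolding embed_tmul 1 .
qed

lemma R_trace:
  "(\<Sum>k\<in>UNIV. \<Sum>f\<in>UNIV. \<Sum>d\<in>UNIV. C $ k $ f * R $ (b, f) $ (u, d) * R' $ (v, d) $ (g, k)) = (if b = g then C $ v $ u else 0)"
proof (rule conj_component[OF _ R'_R])
  \<comment> \<open>The braid relation in the form R_2 R_1 R_2^-1 = R_1^-1 R_2 R_1; the variant with
    inverses exchanged is used for \<open>R_trace'\<close>.\<close>
  have "op2 1 R * op2 0 R * op2 1 R' = (op2 0 R' * op2 0 R) * op2 1 R * op2 0 R * op2 1 R'" by simp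
  also have "\<dots> = op2 0 R' * (op2 0 R * op2 1 R * op2 0 R) * op2 1 R'" by (simp only: mult.assoc)
  also have "\<dots> = op2 0 R' * op2 1 R * op2 0 R * (op2 1 R * op2 1 R')" unfolding op2_braid by (simp only: mult.assoc)
  finally show "op2 1 R * op2 0 R * op2 1 R' = op2 0 R' * op2 1 R * op2 0 R" by simp
qed

lemma R_trace':
  "(\<Sum>k\<in>UNIV. \<Sum>f\<in>UNIV. \<Sum>d\<in>UNIV. C $ k $ f * R' $ (b, f) $ (u, d) * R $ (v, d) $ (g, k)) = (if b = g then C $ v $ u else 0)"
proof (rule conj_component[OF _ R_R'])
  have "op2 1 R' * op2 0 R * op2 1 R = op2 1 R' * op2 0 R * op2 1 R * (op2 0 R * op2 0 R')" by simp
  also have "\<dots> = op2 1 R' * (op2 0 R * op2 1 R * op2 0 R) * op2 0 R'" by (simp only: mult.assoc)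
  also have "\<dots> = (op2 1 R' * op2 1 R) * op2 0 R * op2 1 R * op2 0 R'" unfolding op2_braid by (simp only: mult.assoc)
  finally show "op2 1 R' * op2 0 R * op2 1 R = op2 0 R * op2 1 R * op2 0 R'" by simp
qed

text \<open>Skew-invertibility as a statement on linear systems: contraction over one index from
  each pair of \<open>R\<close> is undone by \<Psi>.\<close>

lemma \<Psi>_solve:
  fixes \<Phi> :: "'n \<Rightarrow> 'n \<Rightarrow> complex"
  assumes "\<And>b u. (\<Sum>f\<in>UNIV. \<Sum>d\<in>UNIV. R $ (b, f) $ (u, d) * \<Phi> f d) = X b u"
  shows "\<Phi> y x = (\<Sum>u\<in>UNIV. \<Sum>b\<in>UNIV. \<Psi> $ (x, u) $ (y, b) * X b u)"
proof -
  have "(\<Sum>u\<in>UNIV. \<Sum>b\<in>UNIV. \<Psi> $ (x, u) $ (y, b) * X b u)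
    = (\<Sum>u\<in>UNIV. \<Sum>b\<in>UNIV. \<Sum>p\<in>UNIV. \<Phi> (fst p) (snd p) * (\<Psi> $ (x, u) $ (y, b) * R $ (b, fst p) $ (u, snd p)))"
    unfolding assms[symmetric] by (simp add: sum_UNIV_prod sum_distrib_left mult_ac)
  also have "\<dots> = (\<Sum>u\<in>UNIV. \<Sum>p\<in>UNIV. \<Sum>b\<in>UNIV. \<Phi> (fst p) (snd p) * (\<Psi> $ (x, u) $ (y, b) * R $ (b, fst p) $ (u, snd p)))"
    by (intro sum.cong refl sum.swap)
  also have "\<dots> = (\<Sum>p\<in>UNIV. \<Sum>u\<in>UNIV. \<Sum>b\<in>UNIV. \<Phi> (fst p) (snd p) * (\<Psi> $ (x, u) $ (y, b) * R $ (b, fst p) $ (u, snd p)))"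
    by (rule sum.swap)
  also have "\<dots> = (\<Sum>p\<in>UNIV. \<Phi> (fst p) (snd p) * (if x = snd p \<and> fst p = y then 1 else 0))"
    unfolding \<Psi>_R[symmetric] by (simp add: sum_distrib_left)
  also have "\<dots> = (\<Sum>p\<in>UNIV. if p = (y, x) then \<Phi> y x else 0)"
    by (intro sum.cong refl) auto
  finally show ?thesis by simp
qed

text \<open>In operator form R^-1 C_2 = C_1 \<Psi>_21, obtained by solving \<open>R_trace\<close>
  for the part not involving \<open>R\<close>. The next lemma is its mirror image C_2 R^-1 =
  \<Psi>_21 C_1, from \<open>R_trace'\<close>.\<close>

lemma R'_C: "(\<Sum>k\<in>UNIV. R' $ (v, x) $ (g, k) * C $ k $ y) = (\<Sum>u\<in>UNIV. C $ v $ u * \<Psi> $ (x, u) $ (y, g))"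
proof -
  have "(\<Sum>f\<in>UNIV. \<Sum>d\<in>UNIV. R $ (b, f) $ (u, d) * (\<Sum>k\<in>UNIV. R' $ (v, d) $ (g, k) * C $ k $ f))
     = (if b = g then C $ v $ u else 0)" for b u
  proof -
    have "(\<Sum>f\<in>UNIV. \<Sum>d\<in>UNIV. R $ (b, f) $ (u, d) * (\<Sum>k\<in>UNIV. R' $ (v, d) $ (g, k) * C $ k $ f))
      = (\<Sum>f\<in>UNIV. \<Sum>d\<in>UNIV. \<Sum>k\<in>UNIV. C $ k $ f * R $ (b, f) $ (u, d) * R' $ (v, d) $ (g, k))"
      by (simp add: sum_distrib_left mult_ac)
    also have "\<dots> = (\<Sum>f\<in>UNIV. \<Sum>k\<in>UNIV. \<Sum>d\<in>UNIV. C $ k $ f * R $ (b, f) $ (u, d) * R' $ (v, d) $ (g, k))"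
      by (intro sum.cong refl sum.swap)
    also have "\<dots> = (\<Sum>k\<in>UNIV. \<Sum>f\<in>UNIV. \<Sum>d\<in>UNIV. C $ k $ f * R $ (b, f) $ (u, d) * R' $ (v, d) $ (g, k))"
      by (rule sum.swap)
    finally show ?thesis unfolding R_trace .
  qed
  from \<Psi>_solve[OF this] show ?thesis
    by (simp add: if_distrib mult.commute cong: if_cong)
qed

lemma C_R': "(\<Sum>f\<in>UNIV. C $ x $ f * R' $ (b, f) $ (u, y)) = (\<Sum>v\<in>UNIV. \<Psi> $ (x, b) $ (y, v) * C $ v $ u)"
proof -
  have "(\<Sum>d\<in>UNIV. \<Sum>k\<in>UNIV. R $ (v, d) $ (g, k) * (\<Sum>f\<in>UNIV. C $ k $ f * R' $ (b, f) $ (u, d)))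
     = (if b = g then C $ v $ u else 0)" for v g
  proof -
    have "(\<Sum>d\<in>UNIV. \<Sum>k\<in>UNIV. R $ (v, d) $ (g, k) * (\<Sum>f\<in>UNIV. C $ k $ f * R' $ (b, f) $ (u, d)))
      = (\<Sum>d\<in>UNIV. \<Sum>k\<in>UNIV. \<Sum>f\<in>UNIV. C $ k $ f * R' $ (b, f) $ (u, d) * R $ (v, d) $ (g, k))"
      by (simp add: sum_distrib_left mult_ac)
    also have "\<dots> = (\<Sum>k\<in>UNIV. \<Sum>d\<in>UNIV. \<Sum>f\<in>UNIV. C $ k $ f * R' $ (b, f) $ (u, d) * R $ (v, d) $ (g, k))"
      by (rule sum.swap)
    also have "\<dots> = (\<Sum>k\<in>UNIV. \<Sum>f\<in>UNIV. \<Sum>d\<in>UNIV. C $ k $ f * R' $ (b, f) $ (u, d) * R $ (v, d) $ (g, k))"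
      by (intro sum.cong refl sum.swap)
    finally show ?thesis unfolding R_trace' .
  qed
  from \<Psi>_solve[OF this, of x y]
  have "(\<Sum>f\<in>UNIV. C $ x $ f * R' $ (b, f) $ (u, y)) = (\<Sum>g\<in>UNIV. \<Sum>v\<in>UNIV. if b = g then \<Psi> $ (x, g) $ (y, v) * C $ v $ u else 0)"
    by (simp add: if_distrib cong: if_cong)
  also have "\<dots> = (\<Sum>v\<in>UNIV. \<Sum>g\<in>UNIV. if b = g then \<Psi> $ (x, g) $ (y, v) * C $ v $ u else 0)"
    by (rule sum.swap)
  finally show ?thesis by simp
qed

text \<open>Both sides equal C_1 \<Psi>_21 C_1 by the two preceding lemmas. The statement for
  \<open>R\<close> follows because \<open>R\<close> and its inverse differ by a scalar.\<close>

lemma R'_CC: "(\<Sum>p\<in>UNIV. R' $ s $ p * (C $ fst p $ fst t * C $ snd p $ snd t))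
       = (\<Sum>p\<in>UNIV. (C $ fst s $ fst p * C $ snd s $ snd p) * R' $ p $ t)"
proof -
  obtain s1 s2 t1 t2 where st: "s = (s1, s2)" "t = (t1, t2)" by (cases s; cases t)
  have "(\<Sum>p\<in>UNIV. R' $ s $ p * (C $ fst p $ fst t * C $ snd p $ snd t))
    = (\<Sum>g\<in>UNIV. (\<Sum>k\<in>UNIV. R' $ (s1, s2) $ (g, k) * C $ k $ t2) * C $ g $ t1)"
    by (simp add: st sum_UNIV_prod sum_distrib_right sum_distrib_left mult_ac)
  also have "\<dots> = (\<Sum>g\<in>UNIV. \<Sum>u\<in>UNIV. C $ s1 $ u * \<Psi> $ (s2, u) $ (t2, g) * C $ g $ t1)"
    unfolding R'_C by (simp add: sum_distrib_right)
  also have "\<dots> = (\<Sum>u\<in>UNIV. \<Sum>g\<in>UNIV. C $ s1 $ u * \<Psi> $ (s2, u) $ (t2, g) * C $ g $ t1)"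
    by (rule sum.swap)
  also have "\<dots> = (\<Sum>u\<in>UNIV. C $ s1 $ u * (\<Sum>f\<in>UNIV. C $ s2 $ f * R' $ (u, f) $ (t1, t2)))"
    unfolding C_R' by (simp add: sum_distrib_left mult_ac)
  also have "\<dots> = (\<Sum>p\<in>UNIV. (C $ fst s $ fst p * C $ snd s $ snd p) * R' $ p $ t)"
    by (simp add: st sum_UNIV_prod sum_distrib_left mult_ac)
  finally show ?thesis .
qed

lemma R_CC: "(\<Sum>p\<in>UNIV. R $ s $ p * (C $ fst p $ fst t * C $ snd p $ snd t))
       = (\<Sum>p\<in>UNIV. (C $ fst s $ fst p * C $ snd s $ snd p) * R $ p $ t)"
proof -
  have R: "R $ s $ p = R' $ s $ p + (if s = p then a else 0)" for s p
    by (simp add: R'_def mat_def)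
  have "(\<Sum>p\<in>UNIV. (if s = p then a else 0) * X p) = (\<Sum>p\<in>UNIV. if s = p then a * X p else 0)"
    "(\<Sum>p\<in>UNIV. X p * (if p = t then a else 0)) = (\<Sum>p\<in>UNIV. if p = t then X p * a else 0)"
    for X :: "'n \<times> 'n \<Rightarrow> complex"
    by (intro sum.cong refl; simp)+
  then have "(\<Sum>p\<in>UNIV. (if s = p then a else 0) * X p) = a * X s"
    "(\<Sum>p\<in>UNIV. X p * (if p = t then a else 0)) = X t * a" for X :: "'n \<times> 'n \<Rightarrow> complex"
    by simp_all
  then show ?thesis
    unfolding R using R'_CC[of s t]
    by (simp only: distrib_left distrib_right sum.distrib mult.commute[of _ a])
qed

end

section \<open>Identifying the concrete tensor formulas with the abstract tower\<close>

lemma ttrace_Suc: "ttrace (Suc K) f = ttrace K (\<lambda>r c. \<Sum>b\<in>UNIV. f (r @ [b]) (c @ [b]))"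
  for f :: "('n::finite, 'a::comm_monoid_add) tmat"
proof -
  have "ttrace (Suc K) f = (\<Sum>p\<in>{l. length l = K} \<times> UNIV. f (fst p @ [snd p]) (fst p @ [snd p]))"
    unfolding ttrace_def
    by (rule sum.reindex_bij_witness[of _ "\<lambda>p. fst p @ [snd p]" "\<lambda>l. (butlast l, last l)"])
      (auto simp: length_Suc_conv_rev)
  then show ?thesis by (simp add: ttrace_def sum.cartesian_product case_prod_beta)
qed

context trace_coefficients begin

lemma tmap_tone: "tmap \<iota> (tone K) = (tone K :: ('m, 'a) tmat)"
  by (auto simp: tmap_def tone_def fun_eq_iff \<iota>_0 \<iota>_1)

primrec ptrs :: "nat \<Rightarrow> (nat \<Rightarrow> 'n, 'a) rfmat \<Rightarrow> (nat \<Rightarrow> 'n, 'a) rfmat" where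
  "ptrs 0 X = X"
| "ptrs (Suc K) X = ptrs K (ptr K X)"

primrec CC :: "nat \<Rightarrow> (nat \<Rightarrow> 'n, 'a) rfmat" where
  "CC 0 = 1"
| "CC (Suc K) = CC K * Cop K"

lemma ptrs_embed: "ptrs K (embed 0 K f) = smat (ttrace K f)"
proof (induction K arbitrary: f)
  case 0
  show ?case by (simp add: smat_def ttrace_def, rule embed_eqI, simp)
qed (simp add: ptr_embed ttrace_Suc)

lemma CC_loc: "CC K \<in> loc K"
proof (induction K)
  case 0
  have "smat (1::'a) \<in> (loc 0 :: (nat \<Rightarrow> 'n, 'a) rfmat set)" by (rule smat_loc)
  then show ?case by (simp add: smat_1)
next
  case (Suc K)
  have "Cop K \<in> loc (Suc K)" using op1_loc[of K] by (simp add: Cop_def)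
  then show ?case using Suc loc_mono[of K "Suc K"] by (auto intro: loc_mult)
qed

lemma embed_CC: "n \<le> K \<Longrightarrow> embed 0 K (tmap \<iota> (tprod K (\<lambda>r. at1 K r C) n)) = CC n"
proof (induction n)
  case 0
  show ?case by (simp add: embed_tone tmap_tone)
next
  case (Suc n)
  then show ?case
    using embed_at1[of n K 0 "map_matrix \<iota> C"]
    by (simp add: tmap_\<iota>_tmul embed_tmul at1_map Cop_def op1_def)
qed

end

context hecke_representation begin

lemma matrix_inv_R: "matrix_inv R = R'"
proof -
  have "R' ** R = mat 1" using R_R' matrix_left_right_inverse by metis
  then have "\<exists>A. R ** A = mat 1 \<and> A ** R = mat 1" using R_R' by blast
  then have "R ** matrix_inv R = mat 1" unfolding matrix_inv_def by (rule someI2_ex) simp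
  then have "R' ** (R ** matrix_inv R) = R'" by simp
  then show ?thesis unfolding matrix_mul_assoc \<open>R' ** R = mat 1\<close> by simp
qed

text \<open>Each new factor \<open>Cop K\<close> stands inside the traces already taken; as
  \<open>CC K\<close> does not touch position \<open>K\<close>, it can enter that trace, and all
  factors collect in front of \<open>X\<close>.\<close>

lemma traces_ptrs: "tower.traces 0 K X = ptrs K (CC K * X)"
proof (induction K arbitrary: X)
  case (Suc K)
  have "tower.traces 0 (Suc K) X = ptrs K (CC K * ptr K (Cop K * X))"
    by (simp add: Suc tr_def)
  also have "\<dots> = ptrs K (ptr K (CC K * (Cop K * X)))"
    by (simp add: ptr_left CC_loc)
  finally show ?case by (simp add: mult.assoc)
qed simp

lemma traces_embed: "tower.traces 0 K (embed 0 K f) = smat (ttrace K (tmul K (tmap \<iota> (tprod K (\<lambda>r. at1 K r C) K)) f))"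
proof -
  have "tower.traces 0 K (embed 0 K f) = ptrs K (embed 0 K (tmap \<iota> (tprod K (\<lambda>r. at1 K r C) K)) * embed 0 K f)"
    by (simp add: traces_ptrs embed_CC)
  then show ?thesis by (simp add: ptrs_embed flip: embed_tmul)
qed

lemma embed_at2_Rop: "Suc (Suc i) \<le> K \<Longrightarrow> embed 0 K (at2 K (Suc i) (map_matrix \<iota> R)) = Rop i"
  using embed_at2[of i K 0 "map_matrix \<iota> R"] by (simp add: Rop_def op2_def)

lemma embed_at2_Ri: "Suc (Suc i) \<le> K \<Longrightarrow> embed 0 K (at2 K (Suc i) (map_matrix \<iota> R')) = tower.Ri i"
  using embed_at2[of i K 0 "map_matrix \<iota> R'"] by (simp add: tower.Ri_def Rop_minus op2_def)

lemma embed_skew_symmetrizer: "n \<le> K \<Longrightarrow> embed 0 K (tmap \<iota> (skew_symmetrizer q R K n)) = tower.skew 0 n"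
proof (induction n)
  case 0
  show ?case by (simp add: embed_tone tmap_tone)
next
  case (Suc n)
  have 2: "tmap \<iota> (tscale a f) = tscale (\<iota> a) (tmap \<iota> f)" for a f
    by (simp add: tmap_def tscale_def fun_eq_iff \<iota>_mult)
  have 3: "tmap \<iota> (tdiff f g) = tdiff (tmap \<iota> f) (tmap \<iota> g)" for f g
    by (simp add: tmap_def tdiff_def fun_eq_iff \<iota>_diff)
  show ?case
  proof (cases n)
    case 0
    then show ?thesis by (simp add: tmap_tone embed_tone)
  next
    case (Suc k)
    then show ?thesis using Suc.IH Suc.prems embed_at2_Rop[of k K]
      by (simp add: tmap_tone 2 3 tmap_\<iota>_tmul embed_tscale embed_tmul embed_tdiff embed_tone at2_map flip: smat_def sc_def)
  qed
qed

lemma embed_Lbar: "Suc i \<le> K \<Longrightarrow> embed 0 K (Lbar \<iota> R K (M l) (Suc i)) = tower.Lb i l"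
proof (induction i)
  case 0
  then have "embed 0 K (at1 K 1 (M l)) = op1 0 (M l)"
    using embed_at1[of 0 K 0 "M l"] by (simp add: op1_def)
  then show ?case by simp
next
  case (Suc i)
  then show ?case
    using embed_at2_Rop[of i K] embed_at2_Ri[of i K]
    by (simp add: embed_tmul at2_map matrix_inv_R)
qed

lemma Lprod_snoc: "tower.Lprod i (ls @ [l]) = tower.Lprod i ls * tower.Lb (i + length ls) l"
  by (simp add: tower.Lprod_append)

text \<open>Factors are numbered from 1 in \<open>tprod\<close> and positions from 0 in the tower,
  hence \<open>r - 1\<close>.\<close>

lemma embed_tprod_Lbar:
  "n \<le> K \<Longrightarrow> embed 0 K (tprod K (\<lambda>r. Lbar \<iota> R K (M (f (r - 1))) r) n) = tower.Lprod 0 (map f [0..<n])"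
proof (induction n)
  case (Suc n)
  have "tower.Lprod 0 (map f [0..<Suc n]) = tower.Lprod 0 (map f [0..<n]) * tower.Lb n (f n)"
    by (simp add: Lprod_snoc)
  moreover have "embed 0 K (Lbar \<iota> R K (M (f n)) (Suc n)) = tower.Lb n (f n)"
    using Suc.prems by (rule embed_Lbar)
  ultimately show ?case using Suc by (simp add: embed_tmul del: Lbar.simps upt_Suc)
qed (simp add: embed_tone)

lemma esym_eq:
  "tower.esym (map f [0..<k]) = smat (ttrace k (tmul k (tmap \<iota> (tprod k (\<lambda>r. at1 k r C) k))
     (tmul k (tmap \<iota> (skew_symmetrizer q R k k)) (tprod k (\<lambda>r. Lbar \<iota> R k (M (f (r - 1))) r) k))))"
  unfolding traces_embed[symmetric] tower.esym_def
  unfolding embed_tmul embed_skew_symmetrizer[OF order_refl] embed_tprod_Lbar[OF order_refl] by simp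

lemma regular_smat:
  assumes "\<And>y. z * y \<in> I \<Longrightarrow> y \<in> I"
  shows "tower.regular (smat z)"
  unfolding tower.regular_def using assms by (auto simp: Iop_def)

lemma RE_iff:
  "tower.RE l m \<longleftrightarrow> (embed 0 2 (tdiff
      (tmul 2 (tmul 2 (tdiff (tscale (\<xi> m - \<xi> l) (tmap \<iota> (at2 2 1 R))) (tscale (\<iota> (q - inverse q) * \<xi> m) (tone 2)))
          (Lbar \<iota> R 2 (M l) 1)) (Lbar \<iota> R 2 (M m) 2))
      (tmul 2 (tmul 2 (Lbar \<iota> R 2 (M m) 1) (Lbar \<iota> R 2 (M l) 2))
         (tdiff (tscale (\<xi> m - \<xi> l) (tmap \<iota> (at2 2 1 R))) (tscale (\<iota> (q - inverse q) * \<xi> m) (tone 2))))) \<in> Iop)"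
proof -
  have R: "embed 0 2 (tmap \<iota> (at2 2 1 R)) = Rop 0" using embed_at2_Rop[of 0 2] by (simp add: at2_map)
  have L: "embed 0 2 (Lbar \<iota> R 2 (M l) 1) = tower.Lb 0 l" "embed 0 2 (Lbar \<iota> R 2 (M l) 2) = tower.Lb (Suc 0) l" for l
    using embed_Lbar[of 0 2 l] embed_Lbar[of 1 2 l] by (simp_all only: One_nat_def numeral_2_eq_2)
  have X: "embed 0 2 (tdiff (tscale (\<xi> m - \<xi> l) (tmap \<iota> (at2 2 1 R))) (tscale (\<iota> (q - inverse q) * \<xi> m) (tone 2)))
     = tower.Rx 0 l m"
    by (simp add: embed_tdiff embed_tscale R[simplified] embed_tone tower.Rx_def sc_def smat_mult smat_diff flip: smat_def)
  show ?thesis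
    unfolding tower.RE_def tower.cong_def embed_tdiff[of _ _ "tmul 2 _ _"] embed_tmul X L ..
qed

end

section \<open>Series over the free algebra\<close>

abbreviation coeff_at :: "'a fps \<Rightarrow> nat \<Rightarrow> 'a" (infixl "$$" 75) where
  "f $$ n \<equiv> fps_nth f n"

lemma scalar_commute: "x * scalar c = scalar c * x" for x :: "'n freealg"
proof -
  have x: "x = (\<Sum>w\<in>Poly_Mapping.keys x. Poly_Mapping.single w (Poly_Mapping.lookup x w))"
    by (rule poly_mapping_eqI) (simp add: lookup_sum lookup_single when_def in_keys_iff)
  have "Poly_Mapping.single w a * scalar c = scalar c * Poly_Mapping.single w a"
    for w :: "(nat \<times> 'n \<times> 'n) free_monoid" and a
    by (simp add: scalar_def mult_single mult.commute)
  then show ?thesis by (subst (1 2) x) (simp add: sum_distrib_left sum_distrib_right)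
qed

lemma scalar_add: "scalar (a + b) = scalar a + scalar b"
  by (simp add: scalar_def single_add)

lemma scalar_mult: "scalar (a * b) = scalar a * scalar b"
  by (simp add: scalar_def mult_single)

lemma scalar_1: "scalar 1 = 1"
  by (simp add: scalar_def)

lemma scalar_left_commute: "x * (scalar c * y) = scalar c * (x * y)"
  by (metis scalar_commute mult.assoc)

lemma scalar2_commute: "F * scalar2 c = scalar2 c * F"
  by (simp add: scalar2_def fps_eq_iff scalar_commute)

lemma fps_const_X_commute: "F * fps_const fps_X = fps_const fps_X * F"
  for F :: "'a::ring_1 fps fps"
  by (simp add: fps_eq_iff fps_mult_fps_X_commute)

lemma u_inv_commute: "F * u_inv = u_inv * F"
  by (simp add: u_inv_def fps_const_X_commute)

lemma v_inv_commute: "F * v_inv = v_inv * F"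
  by (simp add: v_inv_def fps_mult_fps_X_commute)

definition unital_hom :: "('a::ring_1 \<Rightarrow> 'b::ring_1) \<Rightarrow> bool" where
  "unital_hom h \<longleftrightarrow> (\<forall>x y. h (x + y) = h x + h y) \<and> (\<forall>x y. h (x * y) = h x * h y) \<and> h 1 = 1"

lemma unital_hom_add: "unital_hom h \<Longrightarrow> h (x + y) = h x + h y"
  and unital_hom_mult: "unital_hom h \<Longrightarrow> h (x * y) = h x * h y"
  and unital_hom_1: "unital_hom h \<Longrightarrow> h 1 = 1"
  by (simp_all add: unital_hom_def)

lemma unital_hom_0: "unital_hom h \<Longrightarrow> h 0 = 0"
  using unital_hom_add[of h 0 0] by simp

lemma unital_hom_diff: "unital_hom h \<Longrightarrow> h (x - y) = h x - h y"
  using unital_hom_add[of h "x - y" y] by (simp add: algebra_simps)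

lemma unital_hom_sum: "unital_hom h \<Longrightarrow> h (sum f A) = (\<Sum>a\<in>A. h (f a))"
  by (induction A rule: infinite_finite_induct) (simp_all add: unital_hom_0 unital_hom_add)

lemma unital_hom_comp: "unital_hom g \<Longrightarrow> unital_hom h \<Longrightarrow> unital_hom (\<lambda>x. g (h x))"
  by (simp add: unital_hom_def)

lemma unital_hom_in_u: "unital_hom in_u"
  by (simp add: unital_hom_def in_u_def fps_eq_iff fps_mult_nth)

lemma unital_hom_in_v: "unital_hom in_v"
  by (simp add: unital_hom_def in_v_def fps_eq_iff fps_mult_nth fps_sum_nth)
   
text \<open>Multiplies u^-1 by \<open>c\<close> and v^-1 by \<open>d\<close>, whereas
  \<open>rescale\<close> multiplies the parameter itself; hence the inverses in the lemmas relating
  the two.\<close>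

definition scale :: "complex \<Rightarrow> complex \<Rightarrow> 'n freealg2 \<Rightarrow> 'n freealg2" where
  "scale c d F = Abs_fps (\<lambda>b. Abs_fps (\<lambda>a. scalar (c ^ a * d ^ b) * fps_nth (fps_nth F b) a))"

text \<open>The substitution v = u. It respects products although the coefficients do not commute,
  because the two variables are central.\<close>

definition diag :: "'n freealg2 \<Rightarrow> 'n freealg fps" where
  "diag F = Abs_fps (\<lambda>n. \<Sum>b=0..n. fps_nth (fps_nth F b) (n - b))"

lemma unital_hom_scale: "unital_hom (scale c d)"
  unfolding unital_hom_def
proof (intro conjI allI)
  fix F G :: "'a freealg2"
  show "scale c d (F + G) = scale c d F + scale c d G"
    by (simp add: scale_def fps_eq_iff distrib_left)
  show "scale c d 1 = (1 :: 'a freealg2)"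
    by (simp add: scale_def fps_eq_iff scalar_1)
  show "scale c d (F * G) = scale c d F * scale c d G"
  proof (simp add: scale_def fps_eq_iff fps_mult_nth fps_sum_nth sum_distrib_left, intro allI sum.cong refl)
    fix b a i j :: nat assume "i \<in> {0..b}" "j \<in> {0..a}"
    then have eq: "c ^ a * d ^ b = (c ^ j * d ^ i) * (c ^ (a - j) * d ^ (b - i))"
      by (simp add: mult_ac flip: power_add)
    show "scalar (c ^ a * d ^ b) * (F $$ i $$ j * G $$ (b - i) $$ (a - j)) =
       scalar (c ^ j * d ^ i) * F $$ i $$ j * (scalar (c ^ (a - j) * d ^ (b - i)) * G $$ (b - i) $$ (a - j))"
      unfolding eq scalar_mult[of "c ^ j * d ^ i"]
      by (simp only: mult.assoc scalar_left_commute[of "F $$ i $$ j"])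
  qed
qed

lemma unital_hom_diag: "unital_hom diag"
  unfolding unital_hom_def
proof (intro conjI allI)
  fix F G :: "'a freealg2"
  show "diag (F + G) = diag F + diag G"
    by (simp add: diag_def fps_eq_iff sum.distrib)
  show "diag 1 = (1 :: 'a freealg fps)"
  proof (rule fps_ext)
    fix n
    have "(\<Sum>b=0..n. (1 :: 'a freealg2) $$ b $$ (n - b)) = (\<Sum>b=0..n. if b = 0 then (if n = 0 then 1 else 0) else 0)"
      by (rule sum.cong) auto
    then show "diag 1 $$ n = (1 :: 'a freealg fps) $$ n" by (simp add: diag_def)
  qed
  show "diag (F * G) = diag F * diag G"
  proof (rule fps_ext)
    fix n
    have key: "n - (i + j) - (b - i) = n - b - j" if "i \<le> b" for i j b :: nat
      using that by simp
    have "diag (F * G) $$ n = (\<Sum>b=0..n. \<Sum>i=0..b. \<Sum>j=0..n - b. F $$ i $$ j * G $$ (b - i) $$ (n - b - j))"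
      by (simp add: diag_def fps_mult_nth fps_sum_nth)
    also have "\<dots> = (\<Sum>(b, i, j)\<in>(SIGMA b:{0..n}. {0..b} \<times> {0..n - b}). F $$ i $$ j * G $$ (b - i) $$ (n - b - j))"
      by (simp add: sum.Sigma sum.cartesian_product)
    also have "\<dots> = (\<Sum>(m, i, k)\<in>(SIGMA m:{0..n}. {0..m} \<times> {0..n - m}). F $$ i $$ (m - i) * G $$ k $$ (n - m - k))"
      \<comment> \<open>Terms are regrouped by \<open>m = i + j\<close>, the total degree of the
        part from \<open>F\<close>; \<open>k = b - i\<close> is the v-degree of the part from
        \<open>G\<close>.\<close>
      by (rule sum.reindex_bij_witness[of _ "\<lambda>(m, i, k). (i + k, i, m - i)" "\<lambda>(b, i, j). (i + j, i, b - i)"])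
        (auto simp: key add.commute)
    also have "\<dots> = (\<Sum>m=0..n. \<Sum>i=0..m. \<Sum>k=0..n - m. F $$ i $$ (m - i) * G $$ k $$ (n - m - k))"
      by (simp add: sum.Sigma sum.cartesian_product)
    also have "\<dots> = (diag F * diag G) $$ n"
      by (simp add: diag_def fps_mult_nth sum_product)
    finally show "diag (F * G) $$ n = (diag F * diag G) $$ n" .
  qed
qed

lemma scale_in_u: "scale c d (in_u f) = in_u (rescale (inverse c) f)"
  by (simp add: scale_def in_u_def rescale_def fps_eq_iff)

lemma scale_in_v: "scale c d (in_v f) = in_v (rescale (inverse d) f)"
  by (simp add: scale_def in_v_def rescale_def fps_eq_iff)

lemma diag_in_u: "diag (in_u f) = f"
proof (rule fps_ext)
  fix n
  have "(\<Sum>b=0..n. in_u f $$ b $$ (n - b)) = (\<Sum>b=0..n. if b = 0 then f $$ n else 0)"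
    by (rule sum.cong) (auto simp: in_u_def)
  then show "diag (in_u f) $$ n = f $$ n" by (simp add: diag_def)
qed

lemma diag_in_v: "diag (in_v f) = f"
proof (rule fps_ext)
  fix n
  have "(\<Sum>b=0..n. in_v f $$ b $$ (n - b)) = (\<Sum>b=0..n. if b = n then f $$ n else 0)"
    by (rule sum.cong) (auto simp: in_v_def)
  then show "diag (in_v f) $$ n = f $$ n" by (simp add: diag_def)
qed

lemma in_u_const_series: "in_u (const_series c) = scalar2 c"
  by (simp add: in_u_def const_series_def scalar2_def)

lemma in_v_const_series: "in_v (const_series c) = scalar2 c"
  by (simp add: in_v_def const_series_def scalar2_def fps_eq_iff)

lemma rescale_const_series: "rescale c (const_series a) = const_series a"
  by (simp add: rescale_def const_series_def fps_eq_iff scalar_1)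

lemma u_inv_in_u: "u_inv = in_u fps_X"
  by (simp add: u_inv_def in_u_def)

lemma v_inv_in_v: "v_inv = in_v fps_X"
  by (simp add: v_inv_def in_v_def fps_eq_iff fps_X_def)

lemma rescale_X: "c \<noteq> 0 \<Longrightarrow> rescale (inverse c) fps_X = const_series c * fps_X"
  by (simp add: rescale_def fps_eq_iff fps_X_def const_series_def)

text \<open>The label \<open>(False, c)\<close> stands for the spectral parameter with inverse \<open>c u\<^sup>-\<^sup>1\<close>, and
  \<open>(True, c)\<close> for the one with inverse \<open>c v\<^sup>-\<^sup>1\<close>. If two labels involve the same variable, the
  substitution has to go through the diagonal \<open>v = u\<close>, which is why \<open>diag\<close> is needed.\<close>

definition var :: "bool \<Rightarrow> 'n freealg fps \<Rightarrow> 'n freealg2" where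
  "var w = (if w then in_v else in_u)"

definition at_label :: "bool \<times> complex \<Rightarrow> 'n freealg fps \<Rightarrow> 'n freealg2" where
  "at_label l f = var (fst l) (rescale (inverse (snd l)) f)"

definition substitution :: "bool \<times> complex \<Rightarrow> bool \<times> complex \<Rightarrow> 'n freealg2 \<Rightarrow> 'n freealg2" where
  "substitution l m F =
    (if fst l = fst m then var (fst l) (diag (scale (snd l) (snd m) F)) else scale (snd l) (snd m) F)"

lemma unital_hom_var: "unital_hom (var w)"
  by (simp add: var_def unital_hom_in_u unital_hom_in_v)

lemma unital_hom_substitution: "unital_hom (substitution l m)"
  unfolding substitution_def
  by (cases "fst l = fst m") (simp_all add: unital_hom_scale unital_hom_comp[OF unital_hom_var unital_hom_comp[OF unital_hom_diag unital_hom_scale]])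

text \<open>With \<open>False\<close> below \<open>True\<close>, the assumption excludes only
  \<open>l\<close> in v together with \<open>m\<close> in u, where the two variables would have to
  be interchanged.\<close>

lemma substitution_in_u: "fst l \<le> fst m \<Longrightarrow> substitution l m (in_u f) = at_label l f"
  by (cases l; cases m) (auto simp: substitution_def at_label_def scale_in_u diag_in_u var_def)

lemma substitution_in_v: "fst l \<le> fst m \<Longrightarrow> substitution l m (in_v f) = at_label m f"
  by (cases l; cases m) (auto simp: substitution_def at_label_def scale_in_v diag_in_v var_def)

section \<open>The ideal of relations and series with coefficients in it\<close>

definition coeff_ideal :: "'a set \<Rightarrow> 'a fps fps set" where
  "coeff_ideal I = {F. \<forall>b a. fps_nth (fps_nth F b) a \<in> I}"

lemma ring_freealg: "ring (freealg_ring :: 'n freealg ring)"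
proof (rule ringI)
  show "abelian_group (freealg_ring :: 'n freealg ring)"
  proof (rule abelian_groupI)
    fix x :: "'n freealg"
    show "\<exists>y\<in>carrier freealg_ring. y \<oplus>\<^bsub>freealg_ring\<^esub> x = \<zero>\<^bsub>freealg_ring\<^esub>"
      by (rule bexI[of _ "- x"]) (simp_all add: freealg_ring_def)
  qed (simp_all add: freealg_ring_def add_ac)
  show "Group.monoid (freealg_ring :: 'n freealg ring)"
    by (rule monoidI) (simp_all add: freealg_ring_def mult.assoc)
qed (simp_all add: freealg_ring_def distrib_left distrib_right)

lemma ideal_yangian: "ideal (yangian_ideal q R) freealg_ring"
  unfolding yangian_ideal_def
  by (rule ring.genideal_ideal[OF ring_freealg]) (simp add: freealg_ring_def)

lemma yangian_ideal_0: "0 \<in> yangian_ideal q R"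
  using additive_subgroup.zero_closed[OF ideal.axioms(1)[OF ideal_yangian, of q R]] by (simp add: freealg_ring_def)

lemma yangian_ideal_add: "x \<in> yangian_ideal q R \<Longrightarrow> y \<in> yangian_ideal q R \<Longrightarrow> x + y \<in> yangian_ideal q R"
  using additive_subgroup.a_closed[OF ideal.axioms(1)[OF ideal_yangian, of q R]] by (simp add: freealg_ring_def)

lemma yangian_ideal_left: "x \<in> yangian_ideal q R \<Longrightarrow> y * x \<in> yangian_ideal q R"
  using ideal.I_l_closed[OF ideal_yangian, of x q R y] by (simp add: freealg_ring_def)

lemma yangian_ideal_right: "x \<in> yangian_ideal q R \<Longrightarrow> x * y \<in> yangian_ideal q R"
  using ideal.I_r_closed[OF ideal_yangian, of x q R y] by (simp add: freealg_ring_def)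

lemma relators_in_ideal: "RE_relators q R \<subseteq> yangian_ideal q R"
  unfolding yangian_ideal_def
  by (rule ring.genideal_self[OF ring_freealg]) (simp add: freealg_ring_def)

lemma to_yangian_mult:
  "to_yangian q R x \<otimes>\<^bsub>braided_yangian q R\<^esub> to_yangian q R y = to_yangian q R (x * y)"
proof -
  have "rcoset_mult freealg_ring (yangian_ideal q R) (to_yangian q R x) (to_yangian q R y)
      = to_yangian q R (x \<otimes>\<^bsub>freealg_ring\<^esub> y)"
    unfolding to_yangian_def by (rule ideal.rcoset_mult_add[OF ideal_yangian]) (simp_all add: freealg_ring_def)
  then show ?thesis by (simp add: braided_yangian_def FactRing_def freealg_ring_def)
qed

lemma to_yangian_eqI:
  assumes "x - y \<in> yangian_ideal q R"
  shows "to_yangian q R x = to_yangian q R y"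
proof -
  have "to_yangian q R z = (\<lambda>h. h + z) ` yangian_ideal q R" for z
    by (auto simp: to_yangian_def a_r_coset_def r_coset_def freealg_ring_def)
  moreover have "h + x \<in> (\<lambda>h. h + y) ` yangian_ideal q R" if "h \<in> yangian_ideal q R" for h
    using yangian_ideal_add[OF that assms] by (intro image_eqI[of _ _ "h + (x - y)"]) simp_all
  moreover have "h + y \<in> (\<lambda>h. h + x) ` yangian_ideal q R" if "h \<in> yangian_ideal q R" for h
  proof -
    have "h + - 1 * (x - y) \<in> yangian_ideal q R"
      using yangian_ideal_add[OF that yangian_ideal_left[OF assms]] .
    then show ?thesis by (intro image_eqI[of _ _ "h + - 1 * (x - y)"]) simp_all
  qed
  ultimately show ?thesis by auto
qed

lemma coeff_ideal_mult:
  fixes I :: "'a::ring_1 set"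
  assumes "0 \<in> I" "\<And>x y. x \<in> I \<Longrightarrow> y \<in> I \<Longrightarrow> x + y \<in> I"
  shows "(\<And>x y. y \<in> I \<Longrightarrow> x * y \<in> I) \<Longrightarrow> G \<in> coeff_ideal I \<Longrightarrow> F * G \<in> coeff_ideal I"
    and "(\<And>x y. x \<in> I \<Longrightarrow> x * y \<in> I) \<Longrightarrow> F \<in> coeff_ideal I \<Longrightarrow> F * G \<in> coeff_ideal I"
proof -
  have sum: "sum f A \<in> I" if "\<And>a. a \<in> A \<Longrightarrow> f a \<in> I" for f and A :: "nat set"
    using that by (induction A rule: infinite_finite_induct) (auto simp: assms)
  show "F * G \<in> coeff_ideal I" if "\<And>x y. y \<in> I \<Longrightarrow> x * y \<in> I" "G \<in> coeff_ideal I"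
    using that by (auto simp: coeff_ideal_def fps_mult_nth fps_sum_nth intro!: sum)
  show "F * G \<in> coeff_ideal I" if "\<And>x y. x \<in> I \<Longrightarrow> x * y \<in> I" "F \<in> coeff_ideal I"
    using that by (auto simp: coeff_ideal_def fps_mult_nth fps_sum_nth intro!: sum)
qed

lemma yangian_ideal_diff: "x \<in> yangian_ideal q R \<Longrightarrow> y \<in> yangian_ideal q R \<Longrightarrow> x - y \<in> yangian_ideal q R"
  using yangian_ideal_add[of x q R "- 1 * y"] yangian_ideal_left[of y q R "- 1"] by simp

lemma yangian_ideal_sum: "(\<And>a. a \<in> A \<Longrightarrow> f a \<in> yangian_ideal q R) \<Longrightarrow> sum f A \<in> yangian_ideal q R"
  by (induction A rule: infinite_finite_induct) (auto simp: yangian_ideal_0 yangian_ideal_add)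

lemma tmap_tmap: "tmap g (tmap h f) = tmap (\<lambda>x. g (h x)) f"
  by (simp add: tmap_def)

lemma tmap_tmul: "unital_hom h \<Longrightarrow> tmap h (tmul K f g) = tmul K (tmap h f) (tmap h g)"
  by (simp add: fun_eq_iff tmap_def tmul_def unital_hom_sum unital_hom_mult)

lemma tmap_tone: "unital_hom h \<Longrightarrow> tmap h (tone K) = tone K"
  by (auto simp: fun_eq_iff tmap_def tone_def unital_hom_0 unital_hom_1)

lemma tmap_tdiff: "unital_hom h \<Longrightarrow> tmap h (tdiff f g) = tdiff (tmap h f) (tmap h g)"
  by (simp add: fun_eq_iff tmap_def tdiff_def unital_hom_diff)

lemma tmap_tscale: "unital_hom h \<Longrightarrow> tmap h (tscale c f) = tscale (h c) (tmap h f)"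
  by (simp add: fun_eq_iff tmap_def tscale_def unital_hom_mult)

lemma tmap_tprod: "unital_hom h \<Longrightarrow> tmap h (tprod K f n) = tprod K (\<lambda>r. tmap h (f r)) n"
  by (induction n) (simp_all add: tmap_tone tmap_tmul)

lemma tmap_Lbar: "unital_hom h \<Longrightarrow> tmap h (Lbar \<iota> R K N k) = Lbar (\<lambda>c. h (\<iota> c)) R K (map_matrix h N) k"
proof (induction k)
  case (Suc k)
  have "tmap h (at1 K (Suc 0) N) = at1 K (Suc 0) (map_matrix h N)"
    using Suc.prems by (auto simp: fun_eq_iff tmap_def at1_def map_matrix_def unital_hom_0)
  with Suc show ?case by (simp add: tmap_tmul tmap_tmap)
qed (simp add: tmap_tone)

lemma hom_ttrace: "unital_hom h \<Longrightarrow> h (ttrace K f) = ttrace K (tmap h f)"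
  by (simp add: ttrace_def tmap_def unital_hom_sum)

lemma map_matrix_comp: "map_matrix g (map_matrix h N) = map_matrix (\<lambda>x. g (h x)) N"
  by (simp add: map_matrix_def vec_eq_iff)

lemma var_const_series: "var w (const_series c) = scalar2 c"
  by (simp add: var_def in_u_const_series in_v_const_series)

lemma at_label_pair: "at_label (w, c) = (\<lambda>f. var w (rescale (inverse c) f))"
  by (simp add: fun_eq_iff at_label_def)

lemma hom_elem_sym_free:
  "var w (elem_sym_free q R k) = ttrace k (tmul k (tmap scalar2 (tprod k (\<lambda>r. at1 k r (C_matrix R)) k))
     (tmul k (tmap scalar2 (skew_symmetrizer q R k k))
       (tprod k (\<lambda>r. Lbar scalar2 R k (map_matrix (at_label (w, q ^ (2 * (r - 1)))) L_series) r) k)))"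
  unfolding elem_sym_free_def R_trace_def
  by (simp add: hom_ttrace[OF unital_hom_var] tmap_tmul[OF unital_hom_var] tmap_tmap tmap_tprod[OF unital_hom_var]
      tmap_Lbar[OF unital_hom_var] var_const_series map_matrix_comp at_label_pair power_inverse)

lemma substitution_scalar2:
  assumes "fst l \<le> fst m"
  shows "substitution l m (scalar2 c) = scalar2 c"
  using substitution_in_u[OF assms, of "const_series c"]
  by (simp add: in_u_const_series at_label_def rescale_const_series var_const_series)

lemma at_label_X: "snd l \<noteq> 0 \<Longrightarrow> at_label l fps_X = scalar2 (snd l) * (if fst l then v_inv else u_inv)"
  by (simp add: at_label_def rescale_X unital_hom_mult[OF unital_hom_var] var_const_series)
    (simp add: var_def u_inv_in_u v_inv_in_v)

text \<open>A coefficient after the substitution is a finite sum of scalar multiples of coefficients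
  before it.\<close>

lemma substitution_coeff_ideal:
  assumes "F \<in> coeff_ideal (yangian_ideal q R)"
  shows "substitution l m F \<in> coeff_ideal (yangian_ideal q R)"
proof -
  have 1: "scale c d F \<in> coeff_ideal (yangian_ideal q R)" for c d
    using assms by (simp add: coeff_ideal_def scale_def yangian_ideal_left)
  have 2: "diag G $$ n \<in> yangian_ideal q R" if "G \<in> coeff_ideal (yangian_ideal q R)" for G n
    using that by (auto simp: coeff_ideal_def diag_def intro!: yangian_ideal_sum)
  have 3: "var w g \<in> coeff_ideal (yangian_ideal q R)" if "\<And>n. g $$ n \<in> yangian_ideal q R" for w g
    using that by (auto simp: coeff_ideal_def var_def in_u_def in_v_def yangian_ideal_0)
  show ?thesis unfolding substitution_def using 1 2 3 by auto
qed

lemma RE_relation_in_ideal: "RE_relation q R i j \<in> coeff_ideal (yangian_ideal q R)"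
  unfolding coeff_ideal_def
  by (intro CollectI allI subsetD[OF relators_in_ideal]) (auto simp: RE_relators_def)

text \<open>Every instance of the relation that is used, also with both parameters in the same
  variable, is a specialization of the generic one.\<close>

lemma tmap_RE_relation:
  assumes lm: "fst l \<le> fst m"
  shows "tmap (substitution l m) (RE_relation q R) =
    (let M = (\<lambda>l. map_matrix (at_label l) L_series);
         X = tdiff (tscale (at_label m fps_X - at_label l fps_X) (tmap scalar2 (at2 2 1 R)))
               (tscale (scalar2 (q - inverse q) * at_label m fps_X) (tone 2))
     in tdiff (tmul 2 (tmul 2 X (Lbar scalar2 R 2 (M l) 1)) (Lbar scalar2 R 2 (M m) 2))
         (tmul 2 (tmul 2 (Lbar scalar2 R 2 (M m) 1) (Lbar scalar2 R 2 (M l) 2)) X))"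
proof -
  note h = unital_hom_substitution[of l m]
  have uv: "substitution l m u_inv = at_label l fps_X" "substitution l m v_inv = at_label m fps_X"
    by (simp_all add: u_inv_in_u v_inv_in_v substitution_in_u[OF lm] substitution_in_v[OF lm])
  show ?thesis
    unfolding RE_relation_def Let_def current_R_def
    by (simp only: tmap_tdiff[OF h] tmap_tmul[OF h] tmap_tscale[OF h] tmap_tone[OF h] tmap_tmap tmap_Lbar[OF h]
        unital_hom_diff[OF h] unital_hom_mult[OF h] uv substitution_scalar2[OF lm] map_matrix_comp
        substitution_in_u[OF lm] substitution_in_v[OF lm])
qed

lemma scalar_cancel:
  assumes "c \<noteq> 0" "scalar c * x \<in> yangian_ideal q R"
  shows "x \<in> yangian_ideal q R"
proof -
  have "scalar (inverse c) * (scalar c * x) = x"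
    using assms(1) by (simp add: scalar_1 flip: mult.assoc scalar_mult)
  then show ?thesis using yangian_ideal_left[OF assms(2), of "scalar (inverse c)"] by simp
qed

lemma at_label_X_regular:
  assumes "snd l \<noteq> 0" "at_label l fps_X * F \<in> coeff_ideal (yangian_ideal q R)"
  shows "F \<in> coeff_ideal (yangian_ideal q R)"
proof (cases "fst l")
  case True
  have "scalar (snd l) * F $$ b $$ a = (at_label l fps_X * F) $$ Suc b $$ a" for a b
    using assms(1) True by (simp add: at_label_X v_inv_def scalar2_def mult.assoc)
  then have "scalar (snd l) * F $$ b $$ a \<in> yangian_ideal q R" for a b
    using assms(2) by (simp add: coeff_ideal_def)
  then have "F $$ b $$ a \<in> yangian_ideal q R" for a b by (rule scalar_cancel[OF assms(1)])
  then show ?thesis by (simp add: coeff_ideal_def)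
next
  case False
  have "scalar (snd l) * F $$ b $$ a = (at_label l fps_X * F) $$ b $$ Suc a" for a b
    using assms(1) False by (simp add: at_label_X u_inv_def scalar2_def mult.assoc)
  then have "scalar (snd l) * F $$ b $$ a \<in> yangian_ideal q R" for a b
    using assms(2) by (simp add: coeff_ideal_def)
  then have "F $$ b $$ a \<in> yangian_ideal q R" for a b by (rule scalar_cancel[OF assms(1)])
  then show ?thesis by (simp add: coeff_ideal_def)
qed

text \<open>Induction on the degree in v^-1: the lowest coefficient of \<open>z\<close> multiplies
  the current coefficient of \<open>F\<close>, and all other terms involve earlier ones, already
  known to lie in the ideal.\<close>

lemma coeff_ideal_cancel:
  assumes const: "\<And>f. (\<And>a. (z $$ 0 * f) $$ a \<in> yangian_ideal q R) \<Longrightarrow> (\<And>a. f $$ a \<in> yangian_ideal q R)"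
    and "z * F \<in> coeff_ideal (yangian_ideal q R)"
  shows "F \<in> coeff_ideal (yangian_ideal q R)"
proof -
  have "\<forall>a. F $$ n $$ a \<in> yangian_ideal q R" for n
  proof (induction n rule: less_induct)
    case (less n)
    have "(z $$ 0 * F $$ n) $$ a \<in> yangian_ideal q R" for a
    proof -
      have "(z * F) $$ n = z $$ 0 * F $$ n + (\<Sum>i=1..n. z $$ i * F $$ (n - i))"
        by (simp add: fps_mult_nth sum.atLeast_Suc_atMost)
      then have "(z $$ 0 * F $$ n) $$ a = (z * F) $$ n $$ a - (\<Sum>i=1..n. (z $$ i * F $$ (n - i)) $$ a)"
        by (simp add: fps_sum_nth)
      moreover have "(z $$ i * F $$ (n - i)) $$ a \<in> yangian_ideal q R" if "i \<in> {1..n}" for i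
        using less[of "n - i"] that by (auto simp: fps_mult_nth intro!: yangian_ideal_sum yangian_ideal_left)
      ultimately show ?thesis
        using assms(2) by (auto simp: coeff_ideal_def intro!: yangian_ideal_diff yangian_ideal_sum)
    qed
    then show ?case using const by blast
  qed
  then show ?thesis by (simp add: coeff_ideal_def)
qed

text \<open>At v^-1 = 0 the unitarity factor becomes -(c u^-1)^2, whose product with a series is a
  shift by two degrees up to a nonzero scalar.\<close>

lemma cross_regular:
  assumes "c \<noteq> 0" "d \<noteq> 0"
    and "(scalar2 e * (at_label (False, c) fps_X * at_label (True, d) fps_X) -
       (at_label (True, d) fps_X - at_label (False, c) fps_X) * (at_label (True, d) fps_X - at_label (False, c) fps_X)) * F
       \<in> coeff_ideal (yangian_ideal q R)" (is "?z * F \<in> _")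
  shows "F \<in> coeff_ideal (yangian_ideal q R)"
proof (rule coeff_ideal_cancel[OF _ assms(3)])
  fix f and a
  assume h: "\<And>a. (?z $$ 0 * f) $$ a \<in> yangian_ideal q R"
  have "?z $$ 0 = - ((fps_const (scalar c) * fps_X) * (fps_const (scalar c) * fps_X))"
    using assms(1,2) by (simp add: at_label_X u_inv_def v_inv_def scalar2_def)
  also have "\<dots> * f = - (fps_const (scalar c) * (fps_X * (fps_const (scalar c) * (fps_X * f))))"
    by (simp add: mult.assoc)
  finally have "(?z $$ 0 * f) $$ Suc (Suc a) = - (scalar c * (scalar c * f $$ a))"
    by simp
  then have "scalar c * (scalar c * f $$ a) = - 1 * (?z $$ 0 * f) $$ Suc (Suc a)" by simp
  then have "scalar c * (scalar c * f $$ a) \<in> yangian_ideal q R"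
    using yangian_ideal_left[OF h[of "Suc (Suc a)"], of "- 1"] by simp
  then show "f $$ a \<in> yangian_ideal q R"
    by (rule scalar_cancel[OF assms(1) scalar_cancel[OF assms(1)]])
qed

section \<open>Assembly for the braided Yangian\<close>

lemma hecke_inverse:
  fixes R :: "complex ^ 'n::finite ^ 'n"
  assumes "q \<noteq> 0" "(R - mat q) ** (R + mat (inverse q)) = 0"
  shows "R ** (R - mat (q - inverse q)) = mat 1"
proof -
  have m: "(A ** mat c) $ i $ j = A $ i $ j * c" "(mat c ** A) $ i $ j = c * A $ i $ j"
    for A :: "complex ^ 'n ^ 'n" and i j c
    by (simp_all add: matrix_matrix_mult_def mat_def if_distrib if_distribR cong: if_cong)
  define X where "X = R + mat (inverse q)"
  have "R ** X = (R - mat q) ** X + mat q ** X"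
    by (simp add: vec_eq_iff matrix_matrix_mult_def algebra_simps flip: sum.distrib)
  then have 1: "R ** R + R ** mat (inverse q) = mat q ** X"
    using assms(2) by (simp add: X_def matrix_add_ldistrib)
  have 2: "R ** (R - mat (q - inverse q)) + R ** mat (q - inverse q) = R ** R"
    by (simp flip: matrix_add_ldistrib)
  show ?thesis
    unfolding vec_eq_iff
  proof (intro allI)
    fix i j
    have "(R ** R) $ i $ j + R $ i $ j * inverse q = q * (R $ i $ j + mat (inverse q) $ i $ j)"
      using arg_cong[OF 1, of "\<lambda>A. A $ i $ j"] by (simp add: m X_def)
    moreover have "(R ** (R - mat (q - inverse q))) $ i $ j + R $ i $ j * (q - inverse q) = (R ** R) $ i $ j"
      using arg_cong[OF 2, of "\<lambda>A. A $ i $ j"] by (simp add: m)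
    moreover have "q * mat (inverse q) $ i $ j = (mat 1 :: complex ^ 'n ^ 'n) $ i $ j"
      using assms(1) by (simp add: mat_def)
    ultimately show "(R ** (R - mat (q - inverse q))) $ i $ j = mat 1 $ i $ j"
      by (simp add: algebra_simps)
  qed
qed

theorem proposition8:
  fixes R :: "('n::finite) rmat" and q :: complex and m :: nat
  assumes "hecke_symmetry q R" and "generic q"
    and "skew_invertible R"
    and "even_birank q R m"
  shows "\<forall>k\<ge>1. \<forall>p\<ge>1. \<forall>a b.
    elem_sym q R k a \<otimes>\<^bsub>braided_yangian q R\<^esub> elem_sym q R p b =
    elem_sym q R p b \<otimes>\<^bsub>braided_yangian q R\<^esub> elem_sym q R k a"
proof -
  have q0: "q \<noteq> 0" and br: "braiding R" and hecke: "(R - mat q) ** (R + mat (inverse q)) = 0"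
    using assms(1) by (auto simp: hecke_symmetry_def)
  define \<Psi> where "\<Psi> = (SOME \<Psi>. skew_inverse_of R \<Psi>)"
  have \<Psi>: "skew_inverse_of R \<Psi>"
    using assms(3) unfolding skew_invertible_def \<Psi>_def by (rule someI_ex)
  define R' where "R' = R - mat (q - inverse q)"
  have RR': "R ** R' = mat 1" unfolding R'_def by (rule hecke_inverse[OF q0 hecke])
  interpret hs: hecke_skew_inverse R \<Psi> "C_matrix R" R' "q - inverse q"
    by unfold_locales (use \<Psi> RR' br in \<open>simp_all add: C_matrix_def \<Psi>_def R'_def Let_def\<close>)
  define I where "I = yangian_ideal q R"
  note I_closed = yangian_ideal_0[of q R, folded I_def] yangian_ideal_add[of _ q R, folded I_def]
    yangian_ideal_left[of _ q R, folded I_def] yangian_ideal_right[of _ q R, folded I_def]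
  \<comment> \<open>The label type also contains \<open>c = 0\<close>, for which
    \<open>at_label_X\<close> gives nothing; the value 0 is central, as the locale demands of all
    labels.\<close>
  define \<xi> :: "bool \<times> complex \<Rightarrow> 'n freealg2" where "\<xi> l = (if snd l = 0 then 0 else at_label l fps_X)" for l
  define M :: "bool \<times> complex \<Rightarrow> ('n freealg2) ^ 'n ^ 'n" where "M l = map_matrix (at_label l) L_series" for l
  interpret hr: hecke_representation scalar2 "C_matrix R" q R R' "coeff_ideal I" \<xi> M
  proof
    show "scalar2 (a + b) = scalar2 a + scalar2 b" for a b by (simp add: scalar2_def scalar_add)
    show "scalar2 (a * b) = scalar2 a * scalar2 b" for a b by (simp add: scalar2_def scalar_mult)
    show "scalar2 1 = 1" by (simp add: scalar2_def scalar_1)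
    show "z * scalar2 a = scalar2 a * z" for z a by (rule scalar2_commute)
    show "z * \<xi> l = \<xi> l * z" for z l
      unfolding \<xi>_def by (simp add: at_label_X) (metis mult.assoc scalar2_commute u_inv_commute v_inv_commute)
    show "(0 :: 'n freealg2) \<in> coeff_ideal I" by (simp add: coeff_ideal_def I_closed)
    show "y + z \<in> coeff_ideal I" if "y \<in> coeff_ideal I" "z \<in> coeff_ideal I" for y z
      using that by (simp add: coeff_ideal_def I_closed)
    show "z * y \<in> coeff_ideal I" if "y \<in> coeff_ideal I" for y z
      by (rule coeff_ideal_mult(1)[OF I_closed(1,2) I_closed(3) that])
    show "y * z \<in> coeff_ideal I" if "y \<in> coeff_ideal I" for y z
      by (rule coeff_ideal_mult(2)[OF I_closed(1,2) I_closed(4) that])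
  qed (use q0 assms(2) br RR' hs.R_trace hs.R_CC in \<open>simp_all add: R'_def\<close>)
  have RE: "hr.tower.RE l m" if lm: "fst l \<le> fst m" "snd l \<noteq> 0" "snd m \<noteq> 0" for l m
  proof -
    have "substitution l m (RE_relation q R i j) \<in> coeff_ideal I" for i j
      unfolding I_def by (rule substitution_coeff_ideal[OF RE_relation_in_ideal])
    then have "embed 0 2 (tmap (substitution l m) (RE_relation q R)) \<in> hr.Iop"
      by (auto simp: hr.Iop_def entry_embed tmap_def hr.I_0)
    moreover have "at_label l fps_X = \<xi> l" "at_label m fps_X = \<xi> m"
      using lm by (simp_all add: \<xi>_def)
    ultimately show ?thesis
      unfolding hr.RE_iff tmap_RE_relation[OF lm(1)] Let_def by (simp only: M_def)
  qed
  have regular: "hr.tower.regular (smat (\<xi> l))" if "snd l \<noteq> 0" for l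
    by (rule hr.regular_smat) (use that at_label_X_regular[of l _ q R] in \<open>simp add: \<xi>_def I_def\<close>)
  \<comment> \<open>The parameter q^(-2i) u has the inverse q^(2i) u^-1.\<close>
  define labels where "labels w n = map (\<lambda>i. (w, q ^ (2 * i))) [0..<n]" for w :: bool and n
  have chain: "hr.tower.chain (labels w n)" for w n
    unfolding hr.tower.chain_def hr.tower.fusible_def hr.tower.qstep_def
  proof (intro allI impI conjI)
    fix j assume j: "Suc j < length (labels w n)"
    then have l: "labels w n ! j = (w, q ^ (2 * j))" "labels w n ! Suc j = (w, q ^ 2 * q ^ (2 * j))"
      by (simp_all add: labels_def power2_eq_square mult.assoc)
    show "hr.tower.RE (labels w n ! j) (labels w n ! Suc j)" unfolding l by (rule RE) (use q0 in simp_all)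
    show "hr.tower.regular (smat (\<xi> (labels w n ! j)))" unfolding l by (rule regular) (use q0 in simp)
    have "\<xi> (w, q ^ 2 * q ^ (2 * j)) = scalar2 (q ^ 2) * \<xi> (w, q ^ (2 * j))"
      using q0 by (simp add: \<xi>_def at_label_X hr.\<iota>_mult mult.assoc)
    then show "smat (\<xi> (labels w n ! Suc j)) = hr.sc (q ^ 2) * smat (\<xi> (labels w n ! j))"
      unfolding l hr.sc_def by (simp only: smat_mult)
  qed
  have esym: "hr.tower.esym (labels w n) = smat (var w (elem_sym_free q R n))" for w n
    unfolding labels_def hr.esym_eq hom_elem_sym_free by (simp only: M_def)
  have comm: "in_u (elem_sym_free q R k) * in_v (elem_sym_free q R p) - in_v (elem_sym_free q R p) * in_u (elem_sym_free q R k)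
      \<in> coeff_ideal I" for k p
  proof -
    have "hr.tower.esym (labels False k) * hr.tower.esym (labels True p)
        - hr.tower.esym (labels True p) * hr.tower.esym (labels False k) \<in> hr.Iop"
      unfolding hr.tower.cong_def[symmetric]
    proof (rule hr.tower.esym_commute[OF chain chain])
      fix l m assume "l \<in> set (labels False k)" "m \<in> set (labels True p)"
      then obtain c d where lm: "l = (False, c)" "m = (True, d)" "c \<noteq> 0" "d \<noteq> 0"
        using q0 by (auto simp: labels_def)
      have "hr.tower.pass_factor l m = smat (scalar2 ((q - inverse q)\<^sup>2) * (\<xi> l * \<xi> m) - (\<xi> m - \<xi> l) * (\<xi> m - \<xi> l))"
        unfolding hr.tower.pass_factor_def hr.sc_def by (simp only: smat_mult smat_diff)
      moreover have "hr.tower.regular \<dots>"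
        by (rule hr.regular_smat, unfold I_def, rule cross_regular[of c d "(q - inverse q)\<^sup>2"])
          (use lm in \<open>simp_all add: \<xi>_def\<close>)
      ultimately show "hr.tower.RE l m \<and> hr.tower.regular (hr.tower.pass_factor l m)"
        using RE lm by simp
    qed
    then have "smat (in_u (elem_sym_free q R k) * in_v (elem_sym_free q R p)
       - in_v (elem_sym_free q R p) * in_u (elem_sym_free q R k)) \<in> hr.Iop"
      unfolding esym by (simp add: var_def smat_mult smat_diff)
    \<comment> \<open>Any diagonal entry recovers the scalar, so an arbitrary constant index is
      used.\<close>
    then have "entry (smat (in_u (elem_sym_free q R k) * in_v (elem_sym_free q R p)
       - in_v (elem_sym_free q R p) * in_u (elem_sym_free q R k))) (\<lambda>_. undefined :: 'n) (\<lambda>_. undefined) \<in> coeff_ideal I"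
      unfolding hr.Iop_def by blast
    then show ?thesis by (simp add: entry_smat)
  qed
  show ?thesis
  proof (intro allI impI)
    fix k p a b :: nat
    have "(in_u f * in_v h) $$ b $$ a = f $$ a * h $$ b" "(in_v h * in_u f) $$ b $$ a = h $$ b * f $$ a" for f h :: "'n freealg fps"
      by (simp_all add: in_u_def in_v_def)
    moreover have "(in_u (elem_sym_free q R k) * in_v (elem_sym_free q R p)
        - in_v (elem_sym_free q R p) * in_u (elem_sym_free q R k)) $$ b $$ a \<in> yangian_ideal q R"
      using comm[of k p] unfolding coeff_ideal_def I_def by blast
    ultimately have "elem_sym_free q R k $$ a * elem_sym_free q R p $$ b - elem_sym_free q R p $$ b * elem_sym_free q R k $$ a
        \<in> yangian_ideal q R"
      by simp
    then show "elem_sym q R k a \<otimes>\<^bsub>braided_yangian q R\<^esub> elem_sym q R p b =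
        elem_sym q R p b \<otimes>\<^bsub>braided_yangian q R\<^esub> elem_sym q R k a"
      unfolding elem_sym_def to_yangian_mult by (rule to_yangian_eqI)
  qed
qed

end
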